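(* Consider the system (with $'=\frac{d}{ds}$, $s\in\mathbb{C}$) $$\phi'=\frac{-\left(i-\frac1s\right)\phi-\frac{1}{s^{3}}}{1+s^2\phi\varphi},\qquad \varphi'=\frac{\left(i+\frac1s\right)\varphi-\frac{1}{s^{3}}}{1+s^2\phi\varphi},$$ which is the inner equation of the unfolding of the Hopf-zero singularity $$\dot x=-xz+\left(\tfrac{\alpha(\delta^2)}{\delta}+cz\right)y+\delta^{-2}f,\quad \dot y=-\left(\tfrac{\alpha(\delta^2)}{\delta}+cz\right)x-yz+\delta^{-2}g,\quad \dot z=-1+b(x^2+y^2)+z^2+\delta^{-2}h,$$ with $f,g,h$ evaluated at $(\delta x,\delta y,\delta z,\delta)$, for $\alpha(0)=1$, $b=1$, $g=h=0$ and $f(X,Y,Z,\delta)=Z^3$. Let $\psi^{\pm}=(\phi^\pm,\varphi^\pm)$ be the two distinguished solutions of this inner equation described in the context, and let $$\Theta=\lim_{\Im s\to-\infty}s^{-1}e^{is}\left(\phi^+(s)-\phi^-(s)\right)\qquad(\Re s=0)$$ be the associated Stokes constant. Then $\Theta\neq0$, and moreover $$\Re\Theta\in[1.0378681,\,1.0598665],\qquad \Im\Theta\in[-0.000253,\,0.000253].$$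
   Context: Fix $\beta\in(0,\pi/2)$ with $6\sin^2\beta=1$. For $\rho>0$ put $$\mathcal{D}^-_\rho=\{s\in\mathbb{C}:\ |\Im s|\ge \tan\beta\,\Re s+\rho,\ \Re s\le 0\},\qquad \mathcal{D}^+_\rho=\{s: -s\in\mathcal{D}^-_\rho\}.$$ It is known (Baldomá--Seara) that, for $\rho$ large enough, the inner equation has solutions $\psi^\pm=(\phi^\pm,\varphi^\pm)$, analytic in $\mathcal{D}^\pm_\rho$, with $\lim_{\Re s\to\pm\infty}\psi^\pm(s)=0$. They are the solutions obtained by a contraction argument in the space of pairs with $\sup_{s\in\mathcal{D}^\pm_\rho}|s^3\phi^\pm(s)|<\infty$ and $\sup_{s\in\mathcal{D}^\pm_\rho}|s^3\varphi^\pm(s)|<\infty$. The limit defining $\Theta$ is also known to exist, and it does not depend on $\rho$. *)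

theory Defs
  imports "HOL-Complex_Analysis.Complex_Analysis"
begin

text \<open>The inner equation for the pair of unknowns $(\phi,\varphi)$, written here as
  \<open>(\<phi>, \<theta>)\<close>.\<close>

definition inner_denom :: "complex \<Rightarrow> complex \<Rightarrow> complex \<Rightarrow> complex" where
  "inner_denom s \<phi> \<theta> = 1 + s^2 * \<phi> * \<theta>"

definition inner_rhs1 :: "complex \<Rightarrow> complex \<Rightarrow> complex \<Rightarrow> complex" where
  "inner_rhs1 s \<phi> \<theta> = (- (\<i> - 1 / s) * \<phi> - 1 / s^3) / inner_denom s \<phi> \<theta>"

definition inner_rhs2 :: "complex \<Rightarrow> complex \<Rightarrow> complex \<Rightarrow> complex" where
  "inner_rhs2 s \<phi> \<theta> = ((\<i> + 1 / s) * \<theta> - 1 / s^3) / inner_denom s \<phi> \<theta>"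

text \<open>The denominator is required not to vanish, because division by zero is total in HOL.
  On the closed domains below, \<open>analytic_on\<close> means holomorphic on an open neighbourhood.\<close>

definition inner_solution_on ::
  "complex set \<Rightarrow> (complex \<Rightarrow> complex) \<Rightarrow> (complex \<Rightarrow> complex) \<Rightarrow> bool" where
  "inner_solution_on D \<phi> \<theta> \<longleftrightarrow>
     \<phi> analytic_on D \<and> \<theta> analytic_on D \<and>
     (\<forall>s\<in>D. inner_denom s (\<phi> s) (\<theta> s) \<noteq> 0 \<and>
        (\<phi> has_field_derivative inner_rhs1 s (\<phi> s) (\<theta> s)) (at s) \<and>
        (\<theta> has_field_derivative inner_rhs2 s (\<phi> s) (\<theta> s)) (at s))"

definition D_minus :: "real \<Rightarrow> real \<Rightarrow> complex set" where
  "D_minus \<beta> \<rho> = {s. \<bar>Im s\<bar> \<ge> tan \<beta> * Re s + \<rho> \<and> Re s \<le> 0}"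

definition D_plus :: "real \<Rightarrow> real \<Rightarrow> complex set" where
  "D_plus \<beta> \<rho> = {s. - s \<in> D_minus \<beta> \<rho>}"

definition weight3_bounded :: "complex set \<Rightarrow> (complex \<Rightarrow> complex) \<Rightarrow> bool" where
  "weight3_bounded D f \<longleftrightarrow> bdd_above ((\<lambda>s. cmod (s^3 * f s)) ` D)"

text \<open>The solutions produced by the contraction argument. The weighted bounds determine them:
  two solutions with finite weighted norms lie in a common ball, on which the fixed-point
  operator is a contraction once \<open>\<rho>\<close> is increased.\<close>

definition distinguished_minus ::
  "real \<Rightarrow> real \<Rightarrow> (complex \<Rightarrow> complex) \<Rightarrow> (complex \<Rightarrow> complex) \<Rightarrow> bool" where
  "distinguished_minus \<beta> \<rho> \<phi> \<theta> \<longleftrightarrow>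
     inner_solution_on (D_minus \<beta> \<rho>) \<phi> \<theta> \<and>
     weight3_bounded (D_minus \<beta> \<rho>) \<phi> \<and> weight3_bounded (D_minus \<beta> \<rho>) \<theta> \<and>
     ((\<lambda>s. (\<phi> s, \<theta> s)) \<longlongrightarrow> (0, 0))
       (inf (filtercomap Re at_bot) (principal (D_minus \<beta> \<rho>)))"

definition distinguished_plus ::
  "real \<Rightarrow> real \<Rightarrow> (complex \<Rightarrow> complex) \<Rightarrow> (complex \<Rightarrow> complex) \<Rightarrow> bool" where
  "distinguished_plus \<beta> \<rho> \<phi> \<theta> \<longleftrightarrow>
     inner_solution_on (D_plus \<beta> \<rho>) \<phi> \<theta> \<and>
     weight3_bounded (D_plus \<beta> \<rho>) \<phi> \<and> weight3_bounded (D_plus \<beta> \<rho>) \<theta> \<and>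
     ((\<lambda>s. (\<phi> s, \<theta> s)) \<longlongrightarrow> (0, 0))
       (inf (filtercomap Re at_top) (principal (D_plus \<beta> \<rho>)))"

definition is_stokes_constant ::
  "(complex \<Rightarrow> complex) \<Rightarrow> (complex \<Rightarrow> complex) \<Rightarrow> complex \<Rightarrow> bool" where
  "is_stokes_constant \<phi>p \<phi>m \<Theta> \<longleftrightarrow>
     ((\<lambda>s. inverse s * exp (\<i> * s) * (\<phi>p s - \<phi>m s)) \<longlongrightarrow> \<Theta>)
       (inf (filtercomap Im at_bot) (principal {s. Re s = 0}))"

text \<open>The unfolding of the Hopf-zero singularity, complexified, and its relation to the inner
  equation: with $X = \delta x$, $Y = \delta y$, $Z = \delta z$ and time scaled by $\delta$, the
  vector field is multiplied by $\delta^2$. Its limit as $\delta \to 0$, in the unknowns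
  $\phi = X + iY$, $\varphi = X - iY$ and with $s = -1/Z$ as independent variable
  (so $ds = dZ/Z^2$), is the inner equation. The linear part has no $c/s$ term, so $c = 0$.\<close>

type_synonym perturbation = "complex \<Rightarrow> complex \<Rightarrow> complex \<Rightarrow> real \<Rightarrow> complex"

definition unfolding_x ::
  "(real \<Rightarrow> real) \<Rightarrow> real \<Rightarrow> perturbation \<Rightarrow> real \<Rightarrow> complex \<Rightarrow> complex \<Rightarrow> complex \<Rightarrow> complex" where
  "unfolding_x \<alpha> c f \<delta> x y z =
     - x * z + (of_real (\<alpha> (\<delta>^2) / \<delta>) + of_real c * z) * y
     + f (of_real \<delta> * x) (of_real \<delta> * y) (of_real \<delta> * z) \<delta> / of_real (\<delta>^2)"

definition unfolding_y ::
  "(real \<Rightarrow> real) \<Rightarrow> real \<Rightarrow> perturbation \<Rightarrow> real \<Rightarrow> complex \<Rightarrow> complex \<Rightarrow> complex \<Rightarrow> complex" where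
  "unfolding_y \<alpha> c g \<delta> x y z =
     - (of_real (\<alpha> (\<delta>^2) / \<delta>) + of_real c * z) * x - y * z
     + g (of_real \<delta> * x) (of_real \<delta> * y) (of_real \<delta> * z) \<delta> / of_real (\<delta>^2)"

definition unfolding_z ::
  "real \<Rightarrow> perturbation \<Rightarrow> real \<Rightarrow> complex \<Rightarrow> complex \<Rightarrow> complex \<Rightarrow> complex" where
  "unfolding_z b h \<delta> x y z =
     - 1 + of_real b * (x^2 + y^2) + z^2
     + h (of_real \<delta> * x) (of_real \<delta> * y) (of_real \<delta> * z) \<delta> / of_real (\<delta>^2)"

lemma inner_equation_of_unfolding:
  fixes \<alpha> :: "real \<Rightarrow> real" and s \<phi> \<theta> X Y Z :: complex
  assumes "isCont \<alpha> 0" "\<alpha> 0 = 1" "s \<noteq> 0" "inner_denom s \<phi> \<theta> \<noteq> 0"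
  assumes X: "X = (\<phi> + \<theta>) / 2" and Y: "Y = (\<phi> - \<theta>) / (2 * \<i>)" and Z: "Z = - 1 / s"
  defines "f \<equiv> (\<lambda>X Y Z \<delta>. Z^3) :: perturbation"
    and "zero \<equiv> (\<lambda>X Y Z \<delta>. 0) :: perturbation"
  shows "\<exists>X' Y' Z'.
     ((\<lambda>\<delta>. of_real (\<delta>^2) * unfolding_x \<alpha> 0 f \<delta> (X / of_real \<delta>) (Y / of_real \<delta>) (Z / of_real \<delta>))
        \<longlongrightarrow> X') (at_right 0) \<and>
     ((\<lambda>\<delta>. of_real (\<delta>^2) * unfolding_y \<alpha> 0 zero \<delta> (X / of_real \<delta>) (Y / of_real \<delta>) (Z / of_real \<delta>))
        \<longlongrightarrow> Y') (at_right 0) \<and>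
     ((\<lambda>\<delta>. of_real (\<delta>^2) * unfolding_z 1 zero \<delta> (X / of_real \<delta>) (Y / of_real \<delta>) (Z / of_real \<delta>))
        \<longlongrightarrow> Z') (at_right 0) \<and>
     Z' / Z^2 \<noteq> 0 \<and>
     (X' + \<i> * Y') / (Z' / Z^2) = inner_rhs1 s \<phi> \<theta> \<and>
     (X' - \<i> * Y') / (Z' / Z^2) = inner_rhs2 s \<phi> \<theta>"
proof (intro exI conjI)
  have al: "((\<lambda>\<delta>. \<alpha> (\<delta>^2)) \<longlongrightarrow> 1) (at_right 0)"
  proof -
    have "((\<lambda>\<delta>::real. \<delta>^2) \<longlongrightarrow> 0) (at_right 0)"
      by (auto intro!: tendsto_eq_intros)
    from isCont_tendsto_compose[OF _ this] assms(1,2) show ?thesis by force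
  qed
  have alc: "((\<lambda>\<delta>. complex_of_real (\<alpha> (\<delta>^2))) \<longlongrightarrow> 1) (at_right 0)"
    using tendsto_of_real[OF al, where 'a=complex] by simp
  have ev: "eventually (\<lambda>\<delta>::real. \<delta> \<noteq> 0) (at_right 0)"
    by (simp add: eventually_at_filter)
  show "((\<lambda>\<delta>. of_real (\<delta>^2) * unfolding_x \<alpha> 0 f \<delta> (X / of_real \<delta>) (Y / of_real \<delta>) (Z / of_real \<delta>))
        \<longlongrightarrow> - X * Z + Y + Z^3) (at_right 0)"
  proof (rule Lim_transform_eventually)
    show "((\<lambda>\<delta>. - X * Z + of_real (\<alpha> (\<delta>^2)) * Y + Z^3) \<longlongrightarrow> - X * Z + Y + Z^3) (at_right 0)"
      by (rule tendsto_eq_intros alc refl | simp)+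
    show "eventually (\<lambda>\<delta>. - X * Z + of_real (\<alpha> (\<delta>^2)) * Y + Z^3 =
       of_real (\<delta>^2) * unfolding_x \<alpha> 0 f \<delta> (X / of_real \<delta>) (Y / of_real \<delta>) (Z / of_real \<delta>)) (at_right 0)"
      using ev by eventually_elim (simp add: unfolding_x_def f_def field_simps power2_eq_square)
  qed
  show "((\<lambda>\<delta>. of_real (\<delta>^2) * unfolding_y \<alpha> 0 zero \<delta> (X / of_real \<delta>) (Y / of_real \<delta>) (Z / of_real \<delta>))
        \<longlongrightarrow> - X - Y * Z) (at_right 0)"
  proof (rule Lim_transform_eventually)
    show "((\<lambda>\<delta>. - of_real (\<alpha> (\<delta>^2)) * X - Y * Z) \<longlongrightarrow> - X - Y * Z) (at_right 0)"
      by (rule tendsto_eq_intros alc refl | simp)+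
    show "eventually (\<lambda>\<delta>. - of_real (\<alpha> (\<delta>^2)) * X - Y * Z =
       of_real (\<delta>^2) * unfolding_y \<alpha> 0 zero \<delta> (X / of_real \<delta>) (Y / of_real \<delta>) (Z / of_real \<delta>)) (at_right 0)"
      using ev by eventually_elim (simp add: unfolding_y_def zero_def field_simps power2_eq_square)
  qed
  show "((\<lambda>\<delta>. of_real (\<delta>^2) * unfolding_z 1 zero \<delta> (X / of_real \<delta>) (Y / of_real \<delta>) (Z / of_real \<delta>))
        \<longlongrightarrow> X^2 + Y^2 + Z^2) (at_right 0)"
  proof (rule Lim_transform_eventually)
    show "((\<lambda>\<delta>. - of_real (\<delta>^2) + X^2 + Y^2 + Z^2) \<longlongrightarrow> X^2 + Y^2 + Z^2) (at_right 0)"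
      by (auto intro!: tendsto_eq_intros)
    show "eventually (\<lambda>\<delta>. - of_real (\<delta>^2) + X^2 + Y^2 + Z^2 =
       of_real (\<delta>^2) * unfolding_z 1 zero \<delta> (X / of_real \<delta>) (Y / of_real \<delta>) (Z / of_real \<delta>)) (at_right 0)"
      using ev by eventually_elim (simp add: unfolding_z_def zero_def field_simps power2_eq_square)
  qed
  have XY: "X^2 + Y^2 = \<phi> * \<theta>"
    unfolding X Y by (simp add: power_divide power_mult_distrib power2_eq_square field_simps)
  have den: "(X^2 + Y^2 + Z^2) / Z^2 = inner_denom s \<phi> \<theta>"
    unfolding XY inner_denom_def Z using \<open>s \<noteq> 0\<close> by (simp add: field_simps power2_eq_square)
  show "(X^2 + Y^2 + Z^2) / Z^2 \<noteq> 0"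
    using den assms(4) by simp
  have Y_eq: "Y = - \<i> * ((\<phi> - \<theta>) / 2)" unfolding Y by (simp add: field_simps)
  have n1: "- X * Z + Y + Z^3 + \<i> * (- X - Y * Z) = - (\<i> - 1 / s) * \<phi> - 1 / s^3"
    unfolding X Y_eq Z using \<open>s \<noteq> 0\<close>
    by (simp add: field_simps power2_eq_square power3_eq_cube)
  have n2: "- X * Z + Y + Z^3 - \<i> * (- X - Y * Z) = (\<i> + 1 / s) * \<theta> - 1 / s^3"
    unfolding X Y_eq Z using \<open>s \<noteq> 0\<close>
    by (simp add: field_simps power2_eq_square power3_eq_cube)
  show "(- X * Z + Y + Z^3 + \<i> * (- X - Y * Z)) / ((X^2 + Y^2 + Z^2) / Z^2) = inner_rhs1 s \<phi> \<theta>"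
    unfolding den n1 inner_rhs1_def ..
  show "(- X * Z + Y + Z^3 - \<i> * (- X - Y * Z)) / ((X^2 + Y^2 + Z^2) / Z^2) = inner_rhs2 s \<phi> \<theta>"
    unfolding den n2 inner_rhs2_def ..
qed

end

theory Submission
  imports Defs "HOL-Computational_Algebra.Fundamental_Theorem_Algebra"
begin

text \<open>
  The Stokes constant is read off from the growth of the coefficients of the formal solution.
  Rotate by \<open>s = \<i> z\<close> and put \<open>U z = \<phi> s / z\<close>, \<open>W z = - \<theta> s / z\<close>. Both distinguished
  solutions are asymptotic to the same formal series \<open>\<Sum> \<alpha>\<^sub>k z\<^bsup>-k-4\<^esup>\<close>, because along vertical rays
  the linear part of the equation is an isometry. The symmetry \<open>(\<phi>, \<theta>)(s) \<mapsto> (\<theta>, \<phi>)(-s)\<close>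
  exchanges the two domains, so by uniqueness a single pair \<open>(U, W)\<close> on the upper half plane
  carries all the information: the jump of \<open>\<phi>\<close> along the imaginary axis becomes \<open>W y - U (- y)\<close>.
  Cauchy's theorem for \<open>z\<^sup>m (U z + (-1)\<^bsup>m+1\<^esup> W z)\<close> expresses \<open>2 \<pi> \<i> \<alpha>\<^bsub>m-3\<^esub>\<close>, up to an
  error of geometric growth, as the \<open>m\<close>-th moment of the two jumps, and the jump
  \<open>\<i> \<Theta> exp (- y)\<close> dominates. Hence \<open>\<Theta> = (\<pi>/3) lim v\<^sub>k\<close> where \<open>\<alpha>\<^sub>k = (-1)\<^bsup>k+1\<^esup> (k+3)! v\<^sub>k / 6\<close>.
  The recursion for \<open>v\<^sub>k\<close> is real, starts at 1, and its cubic term perturbs it by less than 0.0088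
  in total.
\<close>

section \<open>The formal solution\<close>

text \<open>The difference measured by \<Theta> lies beyond all orders: every truncation of the
  series is blind to it, so neither the expansion nor the contraction argument yields its value. It
  becomes a leading term only in the late coefficients, because the integral of
  \<open>y^m exp (- y)\<close> is \<open>m!\<close>, while whatever comes from a contour of fixed
  size grows geometrically in \<open>m\<close>. Existence of the limit is assumed, so \<Theta> only
  has to be identified; no rate of convergence is required. Division by \<open>z\<close> in
  \<open>U\<close> and \<open>W\<close> absorbs the \<open>1/s\<close> part of the linear terms. The
  linear coefficients become exactly 1 and -1, which is what makes integration along vertical rays
  free of loss. The value is near pi/3 because without the cubic term the recursion for the
  normalised coefficients is constant. That term enters five orders later, when the factorials
  already make it small. The lower end of the asserted interval tolerates a deviation of slightly
  more than 0.0089 from 1; this is the target for the estimate 0.0088. Since all coefficients are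
  real, the imaginary part of \<Theta> comes out as exactly 0.\<close>

text \<open>With \<open>x = 1 / z\<close> and \<open>U = x\<^sup>4 a(x)\<close>, \<open>W = x\<^sup>4 a(- x)\<close>, the formal inner equation is the fixed
  point equation of the following map. It raises the order of agreement of two polynomials by one,
  so iterating it from 0 stabilises the coefficients.\<close>

definition inner_step :: "complex poly \<Rightarrow> complex poly" where
  "inner_step a = - 1 - [:0, 4:] * a - [:0, 0, 1:] * pderiv a
     - monom 1 5 * (a * (a \<circ>\<^sub>p [:0, - 1:]) * (3 * a + [:0, 1:] * pderiv a))"

primrec inner_poly :: "nat \<Rightarrow> complex poly" where
  "inner_poly 0 = 0"
| "inner_poly (Suc m) = inner_step (inner_poly m)"

lemma coeff_pcompose_uminus: "coeff (p \<circ>\<^sub>p [:0, - 1:]) n = (- 1) ^ n * coeff p n" for p :: "'a::comm_ring_1 poly"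
  using coeff_pcompose_linear[of p "-1" n] by simp

lemma coeff_linear_mult: "coeff ([:0, c:] * p) n = (if n = 0 then 0 else c * coeff p (n - 1))" for p :: "'a::comm_ring_1 poly"
  by (cases n) (simp_all add: coeff_pCons)

lemma coeff_mult3:
  "coeff (a * b * c) n = (\<Sum>m\<le>n. (\<Sum>i\<le>m. coeff a i * coeff b (m - i)) * coeff c (n - m))"
  by (simp add: coeff_mult)

text \<open>This is the coefficient of \<open>x^n\<close> in a(x) a(-x) (3 a(x) + x a'(x)): the sign
  belongs to the reflected factor, and the weight \<open>n - m + 3\<close> to the last one.\<close>

definition cubic_sum :: "(nat \<Rightarrow> complex) \<Rightarrow> nat \<Rightarrow> complex" where
  "cubic_sum f n = (\<Sum>m\<le>n. (\<Sum>i\<le>m. f i * ((- 1) ^ (m - i) * f (m - i))) * (of_nat (n - m + 3) * f (n - m)))"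

lemma coeff_inner_step:
  "coeff (inner_step a) n =
     (if n = 0 then - 1 else - of_nat (n + 3) * coeff a (n - 1)
        - (if n < 5 then 0 else cubic_sum (coeff a) (n - 5)))"
proof -
  have c3: "coeff (3 * a + [:0, 1:] * pderiv a) k = of_nat (k + 3) * coeff a k" for k
  proof -
    have "(3::complex poly) = [:3:]" by (simp add: numeral_poly)
    hence "coeff (3 * a) k = 3 * coeff a k"
      by (simp only: mult_pCons_left) simp
    thus ?thesis by (cases k) (simp_all add: coeff_linear_mult coeff_pderiv algebra_simps)
  qed
  have d: "coeff ([:0, 0, 1:] * pderiv a) n = (if n = 0 then 0 else of_nat (n - 1) * coeff a (n - 1))"
    by (cases n; cases "n - 1") (simp_all add: coeff_pCons coeff_pderiv)
  have t: "coeff (monom 1 5 * (a * (a \<circ>\<^sub>p [:0, - 1:]) * (3 * a + [:0, 1:] * pderiv a))) n =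
      (if n < 5 then 0 else cubic_sum (coeff a) (n - 5))"
    unfolding coeff_monom_mult coeff_mult3 c3 cubic_sum_def coeff_pcompose_uminus
    by simp
  show ?thesis
    unfolding inner_step_def coeff_diff coeff_minus t d coeff_linear_mult
    by (cases n) (auto simp: algebra_simps)
qed

lemma cubic_sum_cong: "(\<And>i. i \<le> n \<Longrightarrow> f i = g i) \<Longrightarrow> cubic_sum f n = cubic_sum g n"
  unfolding cubic_sum_def by (intro sum.cong refl arg_cong2[where f="(*)"]) auto

definition inner_coeff :: "nat \<Rightarrow> complex" where
  "inner_coeff k = coeff (inner_poly (Suc k)) k"

text \<open>In \<open>coeff_inner_step\<close>, the coefficient of index k depends only on
  coefficients of smaller index; hence it no longer changes after k + 1 iterations.\<close>

lemma coeff_inner_poly: "k < m \<Longrightarrow> coeff (inner_poly m) k = inner_coeff k"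
proof (induction k arbitrary: m rule: less_induct)
  case (less k)
  have "coeff (inner_poly (Suc n)) k = coeff (inner_poly (Suc k)) k" if "k \<le> n" for n
  proof -
    have *: "coeff (inner_poly n) j = coeff (inner_poly k) j" if "j < k" for j
      using less.IH[OF that, of n] less.IH[OF that, of k] that \<open>k \<le> n\<close> by simp
    show ?thesis
      unfolding inner_poly.simps coeff_inner_step
      using * cubic_sum_cong[of "k - 5" "coeff (inner_poly n)" "coeff (inner_poly k)"] by auto
  qed
  from this[of "m - 1"] less.prems show ?case by (simp add: inner_coeff_def del: inner_poly.simps)
qed

lemma inner_coeff_0: "inner_coeff 0 = - 1"
  by (simp add: inner_coeff_def coeff_inner_step)

lemma inner_coeff_rec:
  assumes "n > 0"
  shows "inner_coeff n = - of_nat (n + 3) * inner_coeff (n - 1)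
        - (if n < 5 then 0 else cubic_sum inner_coeff (n - 5))"
proof -
  have *: "coeff (inner_poly n) j = inner_coeff j" if "j < n" for j
    by (rule coeff_inner_poly) (use that in auto)
  have "inner_coeff n = coeff (inner_step (inner_poly n)) n"
    by (simp add: inner_coeff_def)
  also have "\<dots> = - of_nat (n + 3) * inner_coeff (n - 1)
        - (if n < 5 then 0 else cubic_sum inner_coeff (n - 5))"
    unfolding coeff_inner_step using * assms
      cubic_sum_cong[of "n - 5" "coeff (inner_poly n)" inner_coeff] by auto
  finally show ?thesis .
qed

lemma inner_coeff_Reals: "inner_coeff n \<in> \<real>"
proof (induction n rule: less_induct)
  case (less n)
  show ?case
  proof (cases "n = 0")
    case False
    have "cubic_sum inner_coeff (n - 5) \<in> \<real>" if "5 \<le> n"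
      unfolding cubic_sum_def
      by (intro sum_in_Reals Reals_mult Reals_power Reals_minus Reals_1 Reals_of_nat less.IH)
        (use that in auto)
    thus ?thesis unfolding inner_coeff_rec[OF False[unfolded neq0_conv]]
      using less.IH[of "n - 1"] False by (auto intro!: Reals_diff Reals_mult Reals_minus Reals_of_nat)
  qed (simp add: inner_coeff_0)
qed

text \<open>The first m coefficients are already stable, so one further iteration changes nothing
  below \<open>x^m\<close>. This is the sense in which \<open>inner_poly m\<close> solves the fixed
  point equation approximately.\<close>

lemma inner_step_residual:
  obtains c where "inner_poly m - inner_step (inner_poly m) = monom 1 m * c"
proof -
  have "coeff (inner_poly m - inner_poly (Suc m)) k = 0" if "k < m" for k
    unfolding coeff_diff using coeff_inner_poly[of k m] coeff_inner_poly[of k "Suc m"] that by simp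
  hence "monom 1 m dvd inner_poly m - inner_poly (Suc m)"
    by (subst monom_1_dvd_iff') auto
  thus ?thesis using that by (auto elim!: dvdE)
qed

section \<open>Factorial convolutions and the size of the cubic perturbation\<close>

definition fact_conv :: "nat \<Rightarrow> nat" where
  "fact_conv m = (\<Sum>i\<le>m. fact (i + 3) * fact (m - i + 3))"

text \<open>Equality holds at i = 1. Raising i by one multiplies the left side by i + 4 and the
  right side by i + j + 3, which is at least as large because j \<ge> 1. Interior terms of a
  factorial convolution are thus a whole factor smaller than the two end terms.\<close>

lemma fact_mult_fact_le:
  assumes "i \<ge> 1" "j \<ge> 1"
  shows "fact (i + 3) * fact (j + 3) \<le> (24 * fact (i + j + 2) :: nat)"
  using \<open>i \<ge> 1\<close>
proof (induction i rule: dec_induct)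
  case base
  have "1 + j + 2 = j + 3" "1 + 3 = (4 :: nat)" by simp_all
  thus ?case by (simp only: fact_numeral) (simp add: fact_numeral del: fact_Suc)
next
  case (step i)
  have "fact (Suc i + 3) * fact (j + 3) = (i + 4) * (fact (i + 3) * fact (j + 3) :: nat)"
    using fact_Suc[of "i + 3", where 'a=nat] by (simp add: eval_nat_numeral algebra_simps del: fact_Suc)
  also have "\<dots> \<le> (i + j + 3) * (24 * fact (i + j + 2) :: nat)"
    using assms(2) by (intro mult_le_mono[OF _ step.IH]) auto
  also have "\<dots> = 24 * fact (Suc i + j + 2)"
  proof -
    have e: "Suc i + j + 2 = Suc (i + j + 2)" "i + j + 3 = Suc (i + j + 2)" by simp_all
    have "fact (Suc i + j + 2) = (i + j + 3) * (fact (i + j + 2) :: nat)"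
      by (simp only: e fact_Suc of_nat_id)
    thus ?thesis by (simp only: mult.left_commute)
  qed
  finally show ?case .
qed

text \<open>The two end terms give \<open>12 * fact (m + 3)\<close>. The remaining m - 1 terms are
  at most \<open>24 * fact (m + 2)\<close> each and together cost no more than
  \<open>24 * fact (m + 3)\<close>.\<close>

lemma fact_conv_le: "fact_conv m \<le> 36 * fact (m + 3)"
proof (cases "m = 0")
  case True
  thus ?thesis by (simp add: fact_conv_def fact_numeral)
next
  case False
  have "{..m} = insert 0 (insert m {1..<m})" using False by auto
  hence "fact_conv m = 12 * fact (m + 3) + (\<Sum>i\<in>{1..<m}. fact (i + 3) * fact (m - i + 3))"
    using False by (simp add: fact_conv_def fact_numeral)
  also have "(\<Sum>i\<in>{1..<m}. fact (i + 3) * fact (m - i + 3)) \<le> (\<Sum>i\<in>{1..<m}. 24 * fact (m + 2) :: nat)"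
  proof (rule sum_mono)
    fix i assume i: "i \<in> {1..<m}"
    hence "1 \<le> i" "1 \<le> m - i" "i + (m - i) + 2 = m + 2" by auto
    thus "fact (i + 3) * fact (m - i + 3) \<le> (24 * fact (m + 2) :: nat)"
      using fact_mult_fact_le[of i "m - i"] by simp
  qed
  also have "\<dots> = (m - 1) * (24 * fact (m + 2))" by simp
  also have "\<dots> \<le> (m + 3) * (24 * fact (m + 2))" by (intro mult_right_mono) auto
  also have "\<dots> = 24 * fact (m + 3)"
    using fact_Suc[of "m + 2", where 'a=nat] by (simp add: numeral_3_eq_3 del: fact_Suc)
  finally show ?thesis by simp
qed

text \<open>The majorant of \<open>cubic_sum\<close> obtained by dropping the signs and putting
  \<open>fact (k + 3)\<close> for the coefficient of index k. It is a natural number, so that its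
  first values can be evaluated exactly.\<close>

definition cubic_bound :: "nat \<Rightarrow> nat" where
  "cubic_bound n = (\<Sum>m\<le>n. fact_conv m * ((n - m + 3) * fact (n - m + 3)))"

lemma cubic_bound_le: "cubic_bound n \<le> 1296 * (n + 3) * fact (n + 3)"
proof -
  have "cubic_bound n \<le> (\<Sum>m\<le>n. (36 * fact (m + 3)) * ((n + 3) * fact (n - m + 3)))"
    unfolding cubic_bound_def by (intro sum_mono mult_mono fact_conv_le) auto
  also have "\<dots> = 36 * (n + 3) * fact_conv n"
    unfolding fact_conv_def by (simp add: sum_distrib_left sum_distrib_right algebra_simps)
  also have "\<dots> \<le> 36 * (n + 3) * (36 * fact (n + 3))"
    by (intro mult_left_mono fact_conv_le) auto
  also have "\<dots> = 1296 * (n + 3) * fact (n + 3)" by simp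
  finally show ?thesis .
qed

text \<open>The factor \<open>(k + 3)! / 6\<close> solves the linear part of the recursion.\<close>

definition norm_coeff :: "nat \<Rightarrow> complex" where
  "norm_coeff k = (- 1) ^ Suc k * 6 * inner_coeff k / fact (k + 3)"

lemma inner_coeff_norm_coeff: "inner_coeff k = (- 1) ^ Suc k * fact (k + 3) / 6 * norm_coeff k"
  by (simp add: norm_coeff_def)

lemma cubic_sum_bound:
  assumes "\<And>k. k \<le> n \<Longrightarrow> norm (norm_coeff k) \<le> V" "V \<ge> 0"
  shows "norm (cubic_sum inner_coeff n) \<le> V ^ 3 / 216 * cubic_bound n"
proof -
  have ic: "norm (inner_coeff k) \<le> fact (k + 3) * (V / 6)" if "k \<le> n" for k
    using assms(1)[OF that] by (auto simp: inner_coeff_norm_coeff norm_mult norm_power norm_divide intro: mult_left_mono)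
  have "norm (cubic_sum inner_coeff n) \<le> (\<Sum>m\<le>n. (\<Sum>i\<le>m. fact (i + 3) * (V / 6) * (fact (m - i + 3) * (V / 6))) *
         (real (n - m + 3) * (fact (n - m + 3) * (V / 6))))"
    unfolding cubic_sum_def
  proof (rule sum_norm_le)
    fix m assume m: "m \<in> {..n}"
    have "norm (\<Sum>i\<le>m. inner_coeff i * ((- 1) ^ (m - i) * inner_coeff (m - i)))
        \<le> (\<Sum>i\<le>m. fact (i + 3) * (V / 6) * (fact (m - i + 3) * (V / 6)))"
    proof (rule sum_norm_le)
      fix i assume "i \<in> {..m}"
      thus "norm (inner_coeff i * ((- 1) ^ (m - i) * inner_coeff (m - i)))
          \<le> fact (i + 3) * (V / 6) * (fact (m - i + 3) * (V / 6))"
        using m \<open>V \<ge> 0\<close> unfolding norm_mult norm_power norm_minus_cancel norm_one power_one mult_1_left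
        by (intro mult_mono ic) auto
    qed
    moreover have "norm (of_nat (n - m + 3) * inner_coeff (n - m))
        \<le> real (n - m + 3) * (fact (n - m + 3) * (V / 6))"
      unfolding norm_mult norm_of_nat by (intro mult_left_mono ic) auto
    ultimately show "norm ((\<Sum>i\<le>m. inner_coeff i * ((- 1) ^ (m - i) * inner_coeff (m - i))) *
        (of_nat (n - m + 3) * inner_coeff (n - m)))
      \<le> (\<Sum>i\<le>m. fact (i + 3) * (V / 6) * (fact (m - i + 3) * (V / 6))) *
         (real (n - m + 3) * (fact (n - m + 3) * (V / 6)))"
      unfolding norm_mult[of "sum _ _"] using \<open>V \<ge> 0\<close>
      by (intro mult_mono) (auto intro!: sum_nonneg)
  qed
  also have "\<dots> = V ^ 3 / 216 * cubic_bound n"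
    unfolding cubic_bound_def fact_conv_def of_nat_sum sum_distrib_left sum_distrib_right
    by (intro sum.cong refl) (simp add: power3_eq_cube)
  finally show ?thesis .
qed

lemma norm_coeff_0: "norm_coeff 0 = 1"
  by (simp add: norm_coeff_def inner_coeff_0 fact_numeral)

lemma norm_coeff_Suc:
  "norm_coeff (Suc n) = norm_coeff n +
     (if n < 4 then 0 else (- 1) ^ Suc n * 6 / fact (n + 4) * cubic_sum inner_coeff (n - 4))"
proof -
  have f: "(fact (n + 4) :: complex) = of_nat (n + 4) * fact (n + 3)"
    using fact_Suc[of "n + 3", where 'a=complex] by (simp add: eval_nat_numeral del: fact_Suc)
  have nz: "of_nat (n + 4) \<noteq> (0 :: complex)" "fact (n + 3) \<noteq> (0 :: complex)"
    by (simp_all only: of_nat_eq_0_iff fact_nonzero) simp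
  have alg: "s * 6 * (- k * c - X) / (k * F) = (- s) * 6 * c / F + (- s) * 6 / (k * F) * X"
    if "k \<noteq> 0" "F \<noteq> 0" for s k c X F :: complex
    using that by (simp add: field_simps)
  define X where "X = (if n < 4 then 0 else cubic_sum inner_coeff (n - 4))"
  have "inner_coeff (Suc n) = - of_nat (n + 4) * inner_coeff n - X"
  proof -
    have "X = (if Suc n < 5 then 0 else cubic_sum inner_coeff (Suc n - 5))" by (auto simp: X_def)
    thus ?thesis using inner_coeff_rec[of "Suc n"] by (simp add: add.commute)
  qed
  hence "norm_coeff (Suc n) = norm_coeff n + (- 1) ^ Suc n * 6 / fact (n + 4) * X"
    using alg[OF nz, of "(- 1) ^ n" "inner_coeff n" X]
    by (simp add: norm_coeff_def f[symmetric] del: of_nat_add fact_Suc)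
      (simp add: eval_nat_numeral del: fact_Suc)
  thus ?thesis by (simp add: X_def)
qed

text \<open>Bound for the step from \<open>norm_coeff n\<close> to \<open>norm_coeff (Suc n)\<close>
  when all earlier values have modulus at most 1: the factor \<open>6 / fact (n + 4)\<close> of the
  recursion times 1/216 from three normalisations by 6.\<close>

definition incr_bound :: "nat \<Rightarrow> real" where
  "incr_bound n = (if n < 4 then 0 else cubic_bound (n - 4) / (36 * fact (n + 4)))"

lemma inverse_telescope:
  fixes a :: real
  assumes "a > 0"
  shows "36 / ((a + 3) * (a + 2) * (a + 1) * a) =
    12 / (a * (a + 1) * (a + 2)) - 12 / ((a + 1) * (a + 2) * (a + 3))"
proof -
  define b c d where "b = a + 1" "c = a + 2" "d = a + 3"
  hence "b > 0" "c > 0" "d > 0" and d: "d = a + 3" using assms by auto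
  hence "36 / (d * c * b * a) = 12 / (a * b * c) - 12 / (b * c * d)"
    using assms by (simp add: divide_simps d)
  thus ?thesis by (simp add: b_c_d_def)
qed

text \<open>With m = n - 4, the estimate \<open>cubic_bound_le\<close> leaves (m + 3) (m + 3)! over
  (m + 8)!. Replacing m + 3 by m + 4 cancels one factor and leaves the reciprocal of four
  consecutive integers, which telescopes.\<close>

lemma incr_bound_tail:
  assumes "n \<ge> 12"
  shows "incr_bound n \<le> 12 / ((n + 1) * (n + 2) * (n + 3)) - 12 / ((n + 2) * (n + 3) * (n + 4))"
proof -
  define m where "m = n - 4"
  have n: "n = m + 4" using assms by (simp add: m_def)
  have fr: "fact (m + 4) = (real m + 4) * fact (m + 3)" "fact (m + 5) = (real m + 5) * fact (m + 4)"
    "fact (m + 6) = (real m + 6) * fact (m + 5)" "fact (m + 7) = (real m + 7) * fact (m + 6)"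
    "fact (m + 8) = (real m + 8) * fact (m + 7)"
    by (subst fact_reduce; simp)+
  define F :: real where "F = fact (m + 3)"
  have F: "F > 0" by (simp add: F_def)
  define Q where "Q = (real m + 8) * (real m + 7) * (real m + 6) * (real m + 5) * (real m + 4)"
  have Q: "Q > 0" unfolding Q_def by (intro mult_pos_pos) auto
  have fQ: "fact (n + 4) = Q * F"
    unfolding n Q_def F_def by (simp add: fr add.commute[of 8])
  have "real (cubic_bound m) \<le> real (1296 * (m + 3) * fact (m + 3))"
    using cubic_bound_le by (simp only: of_nat_le_iff)
  also have "\<dots> = 1296 * (real m + 3) * F" by (simp add: F_def)
  finally have cb: "real (cubic_bound m) \<le> 1296 * (real m + 3) * F" .
  have "incr_bound n = real (cubic_bound m) / (36 * (Q * F))"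
    using assms by (simp add: incr_bound_def m_def[symmetric] fQ)
  also have "\<dots> \<le> 1296 * (real m + 3) * F / (36 * (Q * F))"
    using F Q by (intro divide_right_mono cb) auto
  also have "\<dots> = 36 * (real m + 3) / Q"
    using F by (simp add: divide_simps)
  also have "\<dots> \<le> 36 * (real m + 4) / Q"
    using Q by (intro divide_right_mono) auto
  also have "\<dots> = 36 / ((real m + 8) * (real m + 7) * (real m + 6) * (real m + 5))"
  proof -
    have "36 * (u + 4) / (P * (u + 4)) = 36 / P" if "u + 4 \<noteq> 0" for u P :: real
      using that by (rule nonzero_mult_divide_mult_cancel_right)
    thus ?thesis unfolding Q_def by (simp del: distrib_left_numeral)
  qed
  also have "\<dots> = 12 / ((n + 1) * (n + 2) * (n + 3)) - 12 / ((n + 2) * (n + 3) * (n + 4))"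
    using inverse_telescope[of "real m + 5"] by (simp add: n add.commute)
  finally show ?thesis by (simp only: of_nat_mult of_nat_add of_nat_1 of_nat_numeral)
qed

lemma incr_bound_sum_12: "(\<Sum>n<12. incr_bound n) \<le> 34 / 10000"
proof -
  have fc: "fact_conv 0 = 36" "fact_conv 1 = 288" "fact_conv 2 = 2016" "fact_conv 3 = 14400"
    "fact_conv 4 = 109440" "fact_conv 5 = 898560" "fact_conv 6 = 8017920" "fact_conv 7 = 77898240"
    by (simp_all add: fact_conv_def fact_numeral atMost_nat_numeral)
  have cb: "cubic_bound 0 = 648" "cubic_bound 1 = 8640" "cubic_bound 2 = 85536" "cubic_bound 3 = 781056" "cubic_bound 4 = 7076160" "cubic_bound 5 = 65802240" "cubic_bound 6 = 640051200" "cubic_bound 7 = 6589071360"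
    by (simp_all add: cubic_bound_def fc[unfolded One_nat_def] fc fact_numeral atMost_nat_numeral)
  have "(\<Sum>n<12. incr_bound n) = (\<Sum>n\<in>{4..<12}. incr_bound n)"
    by (rule sum.mono_neutral_right) (auto simp: incr_bound_def)
  also have "\<dots> = (\<Sum>n\<in>{4,5,6,7,8,9,10,11}. incr_bound n)"
    by (rule sum.cong) auto
  also have "\<dots> \<le> 34 / 10000"
    by (simp add: incr_bound_def cb[unfolded One_nat_def] fact_numeral)
  finally show ?thesis .
qed

text \<open>The telescoping bound is too weak for small indices: from index 4 on it would sum to
  12/210. The terms below 12 are therefore evaluated, and the tail costs at most 12/2730 < 0.0044,
  for a total below 0.0078.\<close>

lemma incr_bound_sum: "(\<Sum>n<N. incr_bound n) \<le> 8 / 1000"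
proof -
  have tail: "(\<Sum>n<12 + k. incr_bound n) \<le> 34 / 10000 + (12 / (13 * 14 * 15) - 12 / ((real k + 13) * (real k + 14) * (real k + 15)))" for k
  proof (induction k)
    case 0
    show ?case using incr_bound_sum_12 by simp
  next
    case (Suc k)
    have "12 + Suc k = Suc (12 + k)" by simp
    hence "(\<Sum>n<12 + Suc k. incr_bound n) = (\<Sum>n<12 + k. incr_bound n) + incr_bound (12 + k)"
      by (simp only: sum.lessThan_Suc)
    thus ?case using Suc incr_bound_tail[of "12 + k"] by (simp add: add.commute)
  qed
  have "(\<Sum>n<N. incr_bound n) \<le> (\<Sum>n<12 + N. incr_bound n)"
    by (rule sum_mono2) (auto simp: incr_bound_def)
  also note tail[of N]
  also have "34 / 10000 + (12 / (13 * 14 * 15) - 12 / ((real N + 13) * (real N + 14) * (real N + 15))) \<le> 8 / 1000"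
  proof -
    have "0 \<le> 12 / ((real N + 13) * (real N + 14) * (real N + 15))" by simp
    thus ?thesis by linarith
  qed
  finally show ?thesis .
qed

text \<open>A bootstrap by strong induction: the cubic bound presupposes control of the earlier
  values, and the modulus bound 1.01 reproduces itself because \<open>1.01 ^ 3 * (8 / 1000)\<close>
  is below 0.01.\<close>

lemma norm_coeff_bound: "norm (norm_coeff n - 1) \<le> 88 / 10000"
proof -
  have "norm (norm_coeff n - 1) \<le> (1.01) ^ 3 * (\<Sum>k<n. incr_bound k)"
  proof (induction n rule: less_induct)
    case (less n)
    show ?case
    proof (cases n)
      case 0
      thus ?thesis by (simp add: norm_coeff_0)
    next
      case (Suc m)
      have V: "norm (norm_coeff k) \<le> 1.01" if "k < n" for k
      proof -
        have "norm (norm_coeff k - 1) \<le> (1.01) ^ 3 * (8 / 1000)"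
          using less[OF that] incr_bound_sum[of k] by (rule order_trans[OF _ mult_left_mono]) auto
        moreover have "norm (norm_coeff k) \<le> norm (norm_coeff k - 1) + norm (1::complex)"
          using norm_triangle_ineq[of "norm_coeff k - 1" 1] by simp
        ultimately show ?thesis by (simp add: power3_eq_cube)
      qed
      have "norm (norm_coeff n - norm_coeff m) \<le> (1.01) ^ 3 * incr_bound m"
      proof (cases "m < 4")
        case False
        have "norm (norm_coeff n - norm_coeff m) = 6 / fact (m + 4) * norm (cubic_sum inner_coeff (m - 4))"
          using False by (simp add: Suc norm_coeff_Suc norm_mult norm_power norm_divide)
        also have "\<dots> \<le> 6 / fact (m + 4) * (1.01 ^ 3 / 216 * cubic_bound (m - 4))"
          using V Suc by (intro mult_left_mono cubic_sum_bound) auto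
        also have "\<dots> = (1.01) ^ 3 * incr_bound m"
          using False by (simp add: incr_bound_def field_simps)
        finally show ?thesis .
      qed (simp add: Suc norm_coeff_Suc incr_bound_def)
      moreover have "norm (norm_coeff n - 1) \<le> norm (norm_coeff n - norm_coeff m) + norm (norm_coeff m - 1)"
        using norm_triangle_ineq[of "norm_coeff n - norm_coeff m" "norm_coeff m - 1"] by simp
      ultimately show ?thesis
        using less[of m] by (simp add: Suc distrib_left)
    qed
  qed
  also have "\<dots> \<le> (1.01) ^ 3 * (8 / 1000)"
    by (intro mult_left_mono incr_bound_sum) auto
  also have "\<dots> \<le> 88 / 10000" by (simp add: power3_eq_cube)
  finally show ?thesis .
qed

lemma norm_coeff_Reals: "norm_coeff n \<in> \<real>"
  unfolding norm_coeff_def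
  by (intro Reals_divide Reals_mult Reals_power Reals_minus Reals_1 inner_coeff_Reals Reals_numeral) (metis Reals_of_nat of_nat_fact)

section \<open>Approximate solutions on the upper half plane\<close>

definition upper_domain :: "real \<Rightarrow> complex set" where
  "upper_domain r = {z. 0 \<le> Im z \<and> r \<le> norm z}"

section \<open>Integration along vertical rays\<close>

lemma norm_add_vertical_ge:
  assumes "0 \<le> Im z" "0 \<le> t"
  shows "(norm z + t) / 2 \<le> norm (z + \<i> * of_real t)"
proof -
  have "((norm z + t) / 2)\<^sup>2 \<le> (norm z)\<^sup>2 + t\<^sup>2"
  proof -
    have "((norm z + t) / 2)\<^sup>2 + ((norm z - t) / 2)\<^sup>2 + ((norm z)\<^sup>2 + t\<^sup>2) / 2 = (norm z)\<^sup>2 + t\<^sup>2"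
      by (simp add: power2_eq_square field_simps)
    moreover have "0 \<le> ((norm z - t) / 2)\<^sup>2" "0 \<le> ((norm z)\<^sup>2 + t\<^sup>2) / 2" by simp_all
    ultimately show ?thesis by linarith
  qed
  \<comment> \<open>The cross term \<open>2 * t * Im z\<close> is nonnegative: moving upwards in the
    upper half plane cannot bring the point closer to the origin.\<close>
  also have "\<dots> \<le> (norm (z + \<i> * of_real t))\<^sup>2"
    using assms by (simp add: cmod_power2 power2_sum)
  finally show ?thesis by (rule power2_le_imp_le) simp
qed

lemma upper_domain_add_vertical:
  "z \<in> upper_domain r \<Longrightarrow> 0 \<le> t \<Longrightarrow> z + \<i> * of_real t \<in> upper_domain r"
proof -
  assume z: "z \<in> upper_domain r" "0 \<le> t"
  have "(norm z)\<^sup>2 \<le> (norm (z + \<i> * of_real t))\<^sup>2"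
    using z by (simp add: cmod_power2 power2_sum upper_domain_def)
  hence "norm z \<le> norm (z + \<i> * of_real t)" by (rule power2_le_imp_le) simp
  thus ?thesis using z by (simp add: upper_domain_def)
qed

text \<open>On the ray z + i t the homogeneous solutions are multiples of
  \<open>exp (\<sigma> * \<i> * t)\<close>, of modulus one for both signs of \<sigma>. Hence f(z)
  equals its value at infinity, which is 0 by the decay of f, up to the integral of k along the ray.
  The integration costs one power of |z|; the power of 2 pays for replacing |z + i t| by (|z| + t) /
  2.\<close>

lemma vertical_ray_bound:
  fixes f k :: "complex \<Rightarrow> complex"
  assumes der: "\<And>w. w \<in> upper_domain r \<Longrightarrow> (f has_field_derivative \<sigma> * f w + k w) (at w)"
    and \<sigma>: "\<sigma> = 1 \<or> \<sigma> = - 1"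
    and k: "\<And>w. w \<in> upper_domain r \<Longrightarrow> norm (k w) \<le> K / norm w ^ Suc m"
    and f: "\<And>w. w \<in> upper_domain r \<Longrightarrow> norm (f w) \<le> C / norm w"
    and "0 < m" "0 \<le> K" "0 < r" and z: "z \<in> upper_domain r"
  shows "norm (f z) \<le> K * 2 ^ Suc m / norm z ^ m"
proof -
  define n where "n = norm z"
  have n: "n > 0" using z \<open>0 < r\<close> by (auto simp: upper_domain_def n_def)
  have up: "z + \<i> * of_real t \<in> upper_domain r" if "0 \<le> t" for t
    using upper_domain_add_vertical z that .
  have ge: "(n + t) / 2 \<le> norm (z + \<i> * of_real t)" if "0 \<le> t" for t
    using norm_add_vertical_ge[of z t] z that by (simp add: upper_domain_def n_def)
  define c where "c = K * 2 ^ Suc m"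
  have c: "c \<ge> 0" using \<open>0 \<le> K\<close> by (simp add: c_def)
  have bnd: "norm (f z) \<le> c / n ^ m + 2 * \<bar>C\<bar> / (n + T)" if T: "0 < T" for T
  proof -
    define h where "h = (\<lambda>t::real. exp (- \<sigma> * \<i> * of_real t) * f (z + \<i> * of_real t))"
    define h' where "h' = (\<lambda>t::real. \<i> * exp (- \<sigma> * \<i> * of_real t) * k (z + \<i> * of_real t))"
    define g where "g = (\<lambda>t. - (c / real m) * inverse (n + t) ^ m)"
    have dh: "(h has_vector_derivative h' t) (at t)" if "0 \<le> t" for t
    proof -
      have 1: "((\<lambda>w. exp (- \<sigma> * \<i> * w)) has_field_derivative exp (- \<sigma> * \<i> * of_real t) * (- \<sigma> * \<i>)) (at (of_real t))"
        by (auto intro!: derivative_eq_intros)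
      have 2: "((\<lambda>w. f (z + \<i> * w)) has_field_derivative
          (\<sigma> * f (z + \<i> * of_real t) + k (z + \<i> * of_real t)) * \<i>) (at (of_real t))"
        by (rule DERIV_chain2[where f=f and g="\<lambda>w. z + \<i> * w", OF der[OF up[OF that]]])
          (auto intro!: derivative_eq_intros)
      have "((\<lambda>w. exp (- \<sigma> * \<i> * w) * f (z + \<i> * w)) has_field_derivative h' t) (at (of_real t))"
        using DERIV_mult[OF 1 2] by (simp add: h'_def algebra_simps)
      from has_vector_derivative_real_field[OF this] show ?thesis by (simp add: h_def)
    qed
    have dg: "(g has_vector_derivative c * inverse (n + t) ^ Suc m) (at t)" if "0 \<le> t" for t
    proof -
      have "(g has_real_derivative c * inverse (n + t) ^ Suc m) (at t)"
      proof -
        have "((\<lambda>t. inverse (n + t)) has_real_derivative - (inverse (n + t) * inverse (n + t))) (at t)"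
          using n that by (auto intro!: derivative_eq_intros)
        from DERIV_cmult[OF DERIV_power[OF this, of m], of "- (c / real m)"] show ?thesis
          unfolding g_def using \<open>0 < m\<close> by (cases m) (simp_all del: of_nat_Suc)
      qed
      thus ?thesis by (simp add: has_real_derivative_iff_has_vector_derivative)
    qed
    have bd: "norm (h' t) \<le> c * inverse (n + t) ^ Suc m" if "0 \<le> t" for t
    proof -
      have "norm (h' t) = norm (k (z + \<i> * of_real t))"
        using \<sigma> by (auto simp: h'_def norm_mult)
      also have "\<dots> \<le> K / norm (z + \<i> * of_real t) ^ Suc m" by (rule k[OF up[OF that]])
      also have "\<dots> \<le> K / ((n + t) / 2) ^ Suc m"
        using n that \<open>0 \<le> K\<close> ge[OF that]
        by (intro divide_left_mono power_mono mult_pos_pos zero_less_power) auto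
      also have "\<dots> = c * inverse (n + t) ^ Suc m"
        by (simp add: c_def power_divide divide_simps power_inverse)
      finally show ?thesis .
    qed
    have "norm (h T - h 0) \<le> g T - g 0"
      using T by (intro differentiable_bound_general[where f'=h' and \<phi>'="\<lambda>t. c * inverse (n + t) ^ Suc m"]
          continuous_at_imp_continuous_on ballI dh dg bd)
        (auto intro: has_vector_derivative_continuous dh dg)
    also have "\<dots> \<le> - g 0"
      using c n T by (auto simp: g_def intro!: divide_nonneg_nonneg mult_nonneg_nonneg)
    also have "- g 0 = (c / n ^ m) / real m"
      by (simp add: g_def power_inverse divide_inverse mult_ac)
    also have "\<dots> \<le> (c / n ^ m) / 1"
      using c n \<open>0 < m\<close> by (intro divide_left_mono divide_nonneg_nonneg) auto
    also have "\<dots> = c / n ^ m" by simp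
    finally have "norm (h T - h 0) \<le> c / n ^ m" .
    moreover have "norm (h 0) \<le> norm (h T) + norm (h T - h 0)"
      by (metis norm_minus_commute norm_triangle_sub)
    moreover have "h 0 = f z" by (simp add: h_def)
    moreover have "norm (h T) \<le> 2 * \<bar>C\<bar> / (n + T)"
    proof -
      have "norm (h T) = norm (f (z + \<i> * of_real T))"
        using \<sigma> by (auto simp: h_def norm_mult)
      also have "\<dots> \<le> C / norm (z + \<i> * of_real T)" using f up T by simp
      also have "\<dots> \<le> \<bar>C\<bar> / norm (z + \<i> * of_real T)" by (simp add: divide_right_mono)
      also have "\<dots> \<le> \<bar>C\<bar> / ((n + T) / 2)"
      proof -
        have "0 < norm (z + \<i> * of_real T)" using ge[of T] n T by (auto intro!: less_le_trans[OF _ ge])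
        thus ?thesis using ge[of T] n T by (intro divide_left_mono mult_pos_pos) auto
      qed
      finally show ?thesis by (simp add: mult.commute)
    qed
    ultimately show ?thesis by simp
  qed
  \<comment> \<open>The far endpoint of the ray goes to infinity, so the constant C disappears from
    the result. This is what allows the bound to be iterated.\<close>
  have "((\<lambda>T. c / n ^ m + 2 * \<bar>C\<bar> / (n + T)) \<longlongrightarrow> c / n ^ m + 0) at_top"
    by (rule tendsto_add[OF tendsto_const tendsto_divide_0[OF tendsto_const
        filterlim_at_top_imp_at_infinity[OF filterlim_tendsto_add_at_top[OF tendsto_const filterlim_ident]]]])
  moreover have "eventually (\<lambda>T. norm (f z) \<le> c / n ^ m + 2 * \<bar>C\<bar> / (n + T)) at_top"
    using eventually_gt_at_top[of 0] by eventually_elim (rule bnd)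
  ultimately have "norm (f z) \<le> c / n ^ m + 0"
    by (intro tendsto_lowerbound) auto
  thus ?thesis by (simp add: c_def n_def)
qed

section \<open>The nonlinearity in weighted variables and its Lipschitz bounds\<close>

definition inner_nonlin :: "complex \<Rightarrow> complex \<Rightarrow> complex \<Rightarrow> complex" where
  "inner_nonlin x a b = a * b * (a * (1 + x) + 1) / (1 + x ^ 4 * a * b)"

text \<open>With N and D the numerator and denominator and d the distance of the arguments, the
  smallness of x keeps |D| above 1/2. The difference of N costs \<open>5 * M\<^sup>2 * d\<close> and
  is divided once by 1/2. The difference of D costs \<open>M * d\<close>, is multiplied by |N| \<le>
  \<open>3 * M ^ 3\<close> and divided twice by 1/2. The sum is 10 M^2 d + 12 M^4 d, whence the
  22.\<close>

lemma inner_nonlin_lipschitz: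
  assumes M: "1 \<le> M" and x: "norm x \<le> 1" "norm x ^ 4 * M\<^sup>2 \<le> 1 / 2"
    and ab: "norm a \<le> M" "norm b \<le> M" "norm a' \<le> M" "norm b' \<le> M"
  shows "norm (inner_nonlin x a b - inner_nonlin x a' b') \<le> 22 * M ^ 4 * (norm (a - a') + norm (b - b'))"
proof -
  define d where "d = norm (a - a') + norm (b - b')"
  have d0: "d \<ge> 0" by (simp add: d_def)
  define N D where "N = (\<lambda>a b. a * b * (a * (1 + x) + 1))" "D = (\<lambda>a b. 1 + x ^ 4 * a * b)"
  have D_ge: "1 / 2 \<le> norm (D u v)" if "norm u \<le> M" "norm v \<le> M" for u v
  proof -
    have "norm (x ^ 4 * u * v) \<le> norm x ^ 4 * M\<^sup>2"
      using that M unfolding norm_mult norm_power power2_eq_square mult.assoc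
      by (intro mult_left_mono mult_mono) auto
    moreover have "norm (1::complex) \<le> norm (D u v) + norm (x ^ 4 * u * v)"
      unfolding N_D_def by (metis add_diff_cancel_right' norm_triangle_ineq4)
    ultimately show ?thesis using x by simp
  qed
  have lin: "norm (u * (1 + x) + 1) \<le> 3 * M" if "norm u \<le> M" for u
  proof -
    have "norm (1 + x) \<le> 2" using norm_triangle_ineq[of 1 x] x by simp
    hence "norm (u * (1 + x)) \<le> M * 2" using that M unfolding norm_mult by (intro mult_mono) auto
    thus ?thesis using norm_triangle_ineq[of "u * (1 + x)" 1] M by simp
  qed
  have prod: "norm (a * b - a' * b') \<le> M * d"
  proof -
    have "a * b - a' * b' = a * (b - b') + (a - a') * b'" by (simp add: algebra_simps)
    hence "norm (a * b - a' * b') \<le> norm a * norm (b - b') + norm (a - a') * norm b'"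
      using norm_triangle_ineq[of "a * (b - b')" "(a - a') * b'"] by (simp add: norm_mult)
    also have "\<dots> \<le> M * norm (b - b') + norm (a - a') * M"
      using ab M by (intro add_mono mult_mono) auto
    finally show ?thesis by (simp add: d_def algebra_simps)
  qed
  have "norm (N a b - N a' b') \<le> 5 * M\<^sup>2 * d"
  proof -
    have "N a b - N a' b' = (a * b - a' * b') * (a * (1 + x) + 1) + a' * b' * ((a - a') * (1 + x))"
      by (simp add: N_D_def algebra_simps)
    hence "norm (N a b - N a' b') \<le> norm (a * b - a' * b') * norm (a * (1 + x) + 1)
        + norm a' * norm b' * (norm (a - a') * norm (1 + x))"
      using norm_triangle_ineq[of "(a * b - a' * b') * (a * (1 + x) + 1)" "a' * b' * ((a - a') * (1 + x))"]
      by (simp add: norm_mult)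
    also have "\<dots> \<le> (M * d) * (3 * M) + M * M * (d * 2)"
      using ab M d0 norm_triangle_ineq[of 1 x] x
      by (intro add_mono mult_mono prod lin mult_nonneg_nonneg) (auto simp: d_def)
    finally show ?thesis by (simp add: power2_eq_square algebra_simps)
  qed
  hence i1: "norm ((N a b - N a' b') / D a b) \<le> 5 * M\<^sup>2 * d / (1 / 2)"
    unfolding norm_divide using d0 by (intro frac_le D_ge ab) auto
  have i2: "norm (N a' b' * (D a b - D a' b') / (D a b * D a' b')) \<le> (M * M * (3 * M)) * (M * d) / (1 / 2 * (1 / 2))"
  proof -
    have "norm (N a' b') \<le> M * M * (3 * M)"
      unfolding N_D_def norm_mult using ab M by (intro mult_mono lin mult_nonneg_nonneg) auto
    moreover have "norm (D a b - D a' b') \<le> 1 * (M * d)"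
    proof -
      have "D a b - D a' b' = x ^ 4 * (a * b - a' * b')" by (simp add: N_D_def algebra_simps)
      thus ?thesis using prod x unfolding norm_mult norm_power
        by (metis mult_mono norm_ge_zero norm_mult norm_power power_le_one zero_le_one zero_le_power)
    qed
    ultimately show ?thesis unfolding norm_divide norm_mult using d0 M
      by (intro frac_le mult_mono D_ge ab mult_nonneg_nonneg mult_pos_pos) auto
  qed
  have eq: "inner_nonlin x a b - inner_nonlin x a' b' =
      (N a b - N a' b') / D a b - N a' b' * (D a b - D a' b') / (D a b * D a' b')"
  proof -
    have "D a b \<noteq> 0" "D a' b' \<noteq> 0" using D_ge[of a b] D_ge[of a' b'] ab by auto
    moreover have "inner_nonlin x u v = N u v / D u v" for u v
      by (simp add: inner_nonlin_def N_D_def)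
    ultimately show ?thesis by (simp add: field_simps)
  qed
  have "norm (inner_nonlin x a b - inner_nonlin x a' b') \<le>
      5 * M\<^sup>2 * d / (1 / 2) + (M * M * (3 * M)) * (M * d) / (1 / 2 * (1 / 2))"
    unfolding eq by (rule order_trans[OF norm_triangle_ineq4 add_mono[OF i1 i2]])
  also have "\<dots> = 10 * M\<^sup>2 * d + 12 * M ^ 4 * d"
    by (simp add: power2_eq_square power4_eq_xxxx)
  also have "\<dots> \<le> 10 * M ^ 4 * d + 12 * M ^ 4 * d"
    using d0 M by (intro add_mono mult_right_mono mult_left_mono power_increasing) auto
  finally show ?thesis by (simp add: d_def)
qed

text \<open>The right-hand side for \<open>U\<close> after the rotation, split into linear part,
  forcing and remainder. The remainder is written in the weighted variables \<open>z ^ 4 * u\<close>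
  and \<open>z ^ 4 * w\<close>, which stay bounded, so that its size can be read off from the factor
  \<open>1 / z ^ 8\<close>.\<close>

definition inner_field1 :: "complex \<Rightarrow> complex \<Rightarrow> complex \<Rightarrow> complex" where
  "inner_field1 z u w = u + 1 / z ^ 4 - inner_nonlin (1 / z) (z ^ 4 * u) (z ^ 4 * w) / z ^ 8"

definition inner_field2 :: "complex \<Rightarrow> complex \<Rightarrow> complex \<Rightarrow> complex" where
  "inner_field2 z u w = - w - 1 / z ^ 4 + inner_nonlin (- 1 / z) (z ^ 4 * w) (z ^ 4 * u) / z ^ 8"

text \<open>The case \<open>C = 0\<close> is that of exact solutions.\<close>

definition inner_approx_sol ::
    "nat \<Rightarrow> real \<Rightarrow> real \<Rightarrow> (complex \<Rightarrow> complex) \<Rightarrow> (complex \<Rightarrow> complex) \<Rightarrow> bool" where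
  "inner_approx_sol n C r U W \<longleftrightarrow> (\<exists>R1 R2. \<forall>z\<in>upper_domain r.
     (U has_field_derivative inner_field1 z (U z) (W z) + R1 z) (at z) \<and>
     (W has_field_derivative inner_field2 z (U z) (W z) + R2 z) (at z) \<and>
     norm (R1 z) \<le> C / norm z ^ n \<and> norm (R2 z) \<le> C / norm z ^ n)"

definition weight4_bounded :: "real \<Rightarrow> real \<Rightarrow> (complex \<Rightarrow> complex) \<Rightarrow> bool" where
  "weight4_bounded M r U \<longleftrightarrow> (\<forall>z\<in>upper_domain r. norm (z ^ 4 * U z) \<le> M)"

text \<open>The weights turn a difference of u into one of size |z|^4 times larger, and division by
  \<open>z ^ 8\<close> leaves a Lipschitz constant of order |z|^(-4). It is integrable along rays
  and small far out.\<close>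

lemma inner_field_lipschitz:
  assumes "1 \<le> M" "1 \<le> norm z" "2 * M\<^sup>2 \<le> norm z ^ 4"
    and "norm (z ^ 4 * u) \<le> M" "norm (z ^ 4 * w) \<le> M" "norm (z ^ 4 * u') \<le> M" "norm (z ^ 4 * w') \<le> M"
  shows "norm (inner_field1 z u w - inner_field1 z u' w' - (u - u'))
           \<le> 22 * M ^ 4 / norm z ^ 4 * (norm (u - u') + norm (w - w'))"
    and "norm (inner_field2 z u w - inner_field2 z u' w' + (w - w'))
           \<le> 22 * M ^ 4 / norm z ^ 4 * (norm (u - u') + norm (w - w'))"
proof -
  have z: "norm (1 / z) \<le> 1" "norm (- 1 / z) \<le> 1" "norm (1 / z) ^ 4 * M\<^sup>2 \<le> 1 / 2" "norm (- 1 / z) ^ 4 * M\<^sup>2 \<le> 1 / 2"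
    using assms(2,3) by (auto simp: norm_divide power_divide divide_le_eq_1)
  have z0: "norm z > 0" using assms by linarith
  have e: "norm (z ^ 4 * u - z ^ 4 * u') = norm z ^ 4 * norm (u - u')" for u u'
    by (simp add: norm_mult norm_power right_diff_distrib[symmetric])
  have scale: "norm (g / z ^ 8) \<le> 22 * M ^ 4 / norm z ^ 4 * (norm (u - u') + norm (w - w'))"
    if "norm g \<le> 22 * M ^ 4 * (norm z ^ 4 * norm (u - u') + norm z ^ 4 * norm (w - w'))" for g
  proof -
    have "norm (g / z ^ 8) \<le> 22 * M ^ 4 * (norm z ^ 4 * norm (u - u') + norm z ^ 4 * norm (w - w')) / norm z ^ 8"
      unfolding norm_divide norm_power by (intro divide_right_mono that) auto
    also have "\<dots> = 22 * M ^ 4 / norm z ^ 4 * (norm (u - u') + norm (w - w'))"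
    proof -
      have "norm z ^ 8 = norm z ^ 4 * norm z ^ 4" by (simp flip: power_add)
      thus ?thesis using z0 by (simp add: field_simps)
    qed
    finally show ?thesis .
  qed
  have "inner_field1 z u w - inner_field1 z u' w' - (u - u') =
      - ((inner_nonlin (1 / z) (z ^ 4 * u) (z ^ 4 * w) - inner_nonlin (1 / z) (z ^ 4 * u') (z ^ 4 * w')) / z ^ 8)"
    by (simp add: inner_field1_def diff_divide_distrib)
  thus "norm (inner_field1 z u w - inner_field1 z u' w' - (u - u'))
           \<le> 22 * M ^ 4 / norm z ^ 4 * (norm (u - u') + norm (w - w'))"
    using scale[OF inner_nonlin_lipschitz[OF \<open>1 \<le> M\<close> z(1,3) assms(4-7), unfolded e]] by (simp only: norm_minus_cancel)
  have "inner_field2 z u w - inner_field2 z u' w' + (w - w') =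
      (inner_nonlin (- 1 / z) (z ^ 4 * w) (z ^ 4 * u) - inner_nonlin (- 1 / z) (z ^ 4 * w') (z ^ 4 * u')) / z ^ 8"
    by (simp add: inner_field2_def diff_divide_distrib)
  moreover have "norm (inner_nonlin (- 1 / z) (z ^ 4 * w) (z ^ 4 * u) - inner_nonlin (- 1 / z) (z ^ 4 * w') (z ^ 4 * u'))
     \<le> 22 * M ^ 4 * (norm z ^ 4 * norm (u - u') + norm z ^ 4 * norm (w - w'))"
    using inner_nonlin_lipschitz[OF \<open>1 \<le> M\<close> z(2,4) assms(5,4,7,6), unfolded e] by (simp add: add.commute)
  ultimately show "norm (inner_field2 z u w - inner_field2 z u' w' + (w - w'))
           \<le> 22 * M ^ 4 / norm z ^ 4 * (norm (u - u') + norm (w - w'))"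
    using scale by simp
qed

section \<open>Comparison and uniqueness of approximate solutions\<close>

lemma approx_sol_difference:
  assumes sol: "inner_approx_sol n C r U W" "inner_approx_sol n C r U' W'"
    and wt: "weight4_bounded M r U" "weight4_bounded M r W" "weight4_bounded M r U'" "weight4_bounded M r W'"
    and r: "1 \<le> M" "1 \<le> r" "2 * M\<^sup>2 \<le> r ^ 4"
  obtains k1 k2 where
    "\<And>z. z \<in> upper_domain r \<Longrightarrow> ((\<lambda>z. U z - U' z) has_field_derivative 1 * (U z - U' z) + k1 z) (at z)"
    "\<And>z. z \<in> upper_domain r \<Longrightarrow> ((\<lambda>z. W z - W' z) has_field_derivative (- 1) * (W z - W' z) + k2 z) (at z)"
    "\<And>z. z \<in> upper_domain r \<Longrightarrow> norm (k1 z) \<le> 22 * M ^ 4 / norm z ^ 4 * (norm (U z - U' z) + norm (W z - W' z)) + 2 * C / norm z ^ n"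
    "\<And>z. z \<in> upper_domain r \<Longrightarrow> norm (k2 z) \<le> 22 * M ^ 4 / norm z ^ 4 * (norm (U z - U' z) + norm (W z - W' z)) + 2 * C / norm z ^ n"
proof -
  from sol obtain R1 R2 R1' R2' where R:
    "\<forall>z\<in>upper_domain r.
     (U has_field_derivative inner_field1 z (U z) (W z) + R1 z) (at z) \<and>
     (W has_field_derivative inner_field2 z (U z) (W z) + R2 z) (at z) \<and>
     norm (R1 z) \<le> C / norm z ^ n \<and> norm (R2 z) \<le> C / norm z ^ n"
    "\<forall>z\<in>upper_domain r.
     (U' has_field_derivative inner_field1 z (U' z) (W' z) + R1' z) (at z) \<and>
     (W' has_field_derivative inner_field2 z (U' z) (W' z) + R2' z) (at z) \<and>
     norm (R1' z) \<le> C / norm z ^ n \<and> norm (R2' z) \<le> C / norm z ^ n"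
    unfolding inner_approx_sol_def by blast
  define k1 where "k1 z = (inner_field1 z (U z) (W z) - inner_field1 z (U' z) (W' z) - (U z - U' z)) + (R1 z - R1' z)" for z
  define k2 where "k2 z = (inner_field2 z (U z) (W z) - inner_field2 z (U' z) (W' z) + (W z - W' z)) + (R2 z - R2' z)" for z
  have bound: "norm (p + (q - q')) \<le> B + 2 * C / c" if "norm p \<le> B" "norm q \<le> C / c" "norm q' \<le> C / c" for p q q' :: complex and B c
    using norm_triangle_ineq[of p "q - q'"] norm_triangle_ineq4[of q q'] that by simp
  show ?thesis
  proof (rule that[of k1 k2])
    fix z assume z: "z \<in> upper_domain r"
    have nz: "1 \<le> norm z" "2 * M\<^sup>2 \<le> norm z ^ 4"
    proof -
      have "r \<le> norm z" using z by (simp add: upper_domain_def)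
      thus "1 \<le> norm z" "2 * M\<^sup>2 \<le> norm z ^ 4"
        using r power_mono[of r "norm z" 4] by linarith+
    qed
    have w: "norm (z ^ 4 * U z) \<le> M" "norm (z ^ 4 * W z) \<le> M" "norm (z ^ 4 * U' z) \<le> M" "norm (z ^ 4 * W' z) \<le> M"
      using wt z by (auto simp: weight4_bounded_def)
    note lip = inner_field_lipschitz[OF r(1) nz w]
    show "norm (k1 z) \<le> 22 * M ^ 4 / norm z ^ 4 * (norm (U z - U' z) + norm (W z - W' z)) + 2 * C / norm z ^ n"
      unfolding k1_def using R z by (intro bound lip) auto
    show "norm (k2 z) \<le> 22 * M ^ 4 / norm z ^ 4 * (norm (U z - U' z) + norm (W z - W' z)) + 2 * C / norm z ^ n"
      unfolding k2_def using R z by (intro bound lip) auto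
    have d: "(U has_field_derivative inner_field1 z (U z) (W z) + R1 z) (at z)"
     "(W has_field_derivative inner_field2 z (U z) (W z) + R2 z) (at z)"
     "(U' has_field_derivative inner_field1 z (U' z) (W' z) + R1' z) (at z)"
     "(W' has_field_derivative inner_field2 z (U' z) (W' z) + R2' z) (at z)"
      using R z by auto
    show "((\<lambda>z. U z - U' z) has_field_derivative 1 * (U z - U' z) + k1 z) (at z)"
      using DERIV_diff[OF d(1,3)] by (simp add: k1_def algebra_simps)
    show "((\<lambda>z. W z - W' z) has_field_derivative (- 1) * (W z - W' z) + k2 z) (at z)"
      using DERIV_diff[OF d(2,4)] by (simp add: k2_def algebra_simps)
  qed
qed

lemma weight4_bounded_diff:
  assumes "weight4_bounded M r U" "weight4_bounded M r U'" "z \<in> upper_domain r" "0 < r"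
  shows "norm (U z - U' z) \<le> 2 * M / norm z ^ 4"
proof -
  have "norm z > 0" using assms by (auto simp: upper_domain_def)
  moreover have "norm (z ^ 4 * U z - z ^ 4 * U' z) \<le> 2 * M"
    using assms norm_triangle_ineq4[of "z ^ 4 * U z" "z ^ 4 * U' z"] by (force simp: weight4_bounded_def)
  moreover have "norm (z ^ 4 * U z - z ^ 4 * U' z) = norm z ^ 4 * norm (U z - U' z)"
    by (simp add: right_diff_distrib[symmetric] norm_mult norm_power)
  ultimately show ?thesis
    by (simp add: pos_le_divide_eq mult.commute)
qed

text \<open>Bootstrap on the decay exponent: if the difference is O(|z|^(-j)), the right-hand side
  is O(|z|^(-j-4)) plus the residual, and \<open>vertical_ray_bound\<close> returns O(|z|^(-j-1)).
  The weights supply the start j = 4, and the residual exponent \<open>Suc n\<close> lets the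
  improvement run up to j = n.\<close>

lemma approx_sol_close:
  assumes sol: "inner_approx_sol (Suc n) C r U W" "inner_approx_sol (Suc n) C r U' W'"
    and wt: "weight4_bounded M r U" "weight4_bounded M r W" "weight4_bounded M r U'" "weight4_bounded M r W'"
    and r: "1 \<le> M" "1 \<le> r" "2 * M\<^sup>2 \<le> r ^ 4" and "0 \<le> C" and "4 \<le> j" "j \<le> n"
  shows "\<exists>D\<ge>0. \<forall>z\<in>upper_domain r. norm (U z - U' z) \<le> D / norm z ^ j \<and> norm (W z - W' z) \<le> D / norm z ^ j"
  using \<open>4 \<le> j\<close> \<open>j \<le> n\<close>
proof (induction j rule: dec_induct)
  case base
  have "0 \<le> 2 * M" "0 < r" using r by auto
  thus ?case using weight4_bounded_diff wt by blast
next
  case (step j)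
  then obtain D where D: "D \<ge> 0"
    "\<And>z. z \<in> upper_domain r \<Longrightarrow> norm (U z - U' z) \<le> D / norm z ^ j"
    "\<And>z. z \<in> upper_domain r \<Longrightarrow> norm (W z - W' z) \<le> D / norm z ^ j"
    by auto
  define L where "L = 22 * M ^ 4"
  have L: "L \<ge> 0" using r by (simp add: L_def)
  obtain k1 k2 where k:
    "\<And>z. z \<in> upper_domain r \<Longrightarrow> ((\<lambda>z. U z - U' z) has_field_derivative 1 * (U z - U' z) + k1 z) (at z)"
    "\<And>z. z \<in> upper_domain r \<Longrightarrow> ((\<lambda>z. W z - W' z) has_field_derivative (- 1) * (W z - W' z) + k2 z) (at z)"
    "\<And>z. z \<in> upper_domain r \<Longrightarrow> norm (k1 z) \<le> L / norm z ^ 4 * (norm (U z - U' z) + norm (W z - W' z)) + 2 * C / norm z ^ Suc n"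
    "\<And>z. z \<in> upper_domain r \<Longrightarrow> norm (k2 z) \<le> L / norm z ^ 4 * (norm (U z - U' z) + norm (W z - W' z)) + 2 * C / norm z ^ Suc n"
    by (rule approx_sol_difference[OF sol wt r, folded L_def]) (erule that)
  define K where "K = 2 * L * D + 2 * C"
  have K: "K \<ge> 0" using L D \<open>0 \<le> C\<close> by (simp add: K_def)
  have kb: "norm k \<le> K / norm z ^ Suc (Suc j)"
    if z: "z \<in> upper_domain r" and k: "norm k \<le> L / norm z ^ 4 * (norm (U z - U' z) + norm (W z - W' z)) + 2 * C / norm z ^ Suc n" for k z
  proof -
    have nz: "1 \<le> norm z" "0 < norm z" using z r by (auto simp: upper_domain_def)
    note k
    also have "L / norm z ^ 4 * (norm (U z - U' z) + norm (W z - W' z)) + 2 * C / norm z ^ Suc n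
       \<le> L / norm z ^ 4 * (D / norm z ^ j + D / norm z ^ j) + 2 * C / norm z ^ Suc n"
      using L D z nz by (intro add_mono mult_left_mono order_refl) auto
    also have "\<dots> = 2 * L * D / norm z ^ (j + 4) + 2 * C / norm z ^ Suc n"
      by (simp add: power_add mult_ac)
    also have "\<dots> \<le> 2 * L * D / norm z ^ Suc (Suc j) + 2 * C / norm z ^ Suc (Suc j)"
      using L D nz \<open>0 \<le> C\<close> step.hyps step.prems
      by (intro add_mono divide_left_mono power_increasing mult_pos_pos zero_less_power) auto
    finally show ?thesis by (simp add: K_def add_divide_distrib)
  qed
  have dec: "D / norm z ^ j \<le> D / norm z" if "z \<in> upper_domain r" for z
  proof -
    have "1 \<le> norm z" using that r by (auto simp: upper_domain_def)
    thus ?thesis using D step power_increasing[of 1 j "norm z"] by (intro divide_left_mono mult_pos_pos) auto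
  qed
  have fb: "norm (U w - U' w) \<le> D / norm w" "norm (W w - W' w) \<le> D / norm w" if "w \<in> upper_domain r" for w
    using D(2)[OF that] D(3)[OF that] dec[OF that] by linarith+
  have pos: "0 < Suc j" "0 < r" using r(2) by auto
  show ?case
  proof (intro exI[of _ "K * 2 ^ Suc (Suc j)"] conjI ballI)
    show "0 \<le> K * 2 ^ Suc (Suc j)" using K by simp
    fix z assume z: "z \<in> upper_domain r"
    show "norm (U z - U' z) \<le> K * 2 ^ Suc (Suc j) / norm z ^ Suc j"
      by (rule vertical_ray_bound[where \<sigma>=1 and k=k1 and r=r, OF k(1) _ kb[OF _ k(3)] fb(1) pos(1) K pos(2) z]) simp_all
    show "norm (W z - W' z) \<le> K * 2 ^ Suc (Suc j) / norm z ^ Suc j"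
      by (rule vertical_ray_bound[where \<sigma>="- 1" and k=k2 and r=r, OF k(2) _ kb[OF _ k(4)] fb(2) pos(1) K pos(2) z]) simp_all
  qed
qed

text \<open>Without residual the exponent can be kept at 4 while the constant is improved: every
  pass along the rays halves the bound. The last condition on r makes the Lipschitz constant small
  enough for that.\<close>

lemma inner_sol_unique:
  assumes sol: "\<And>n. inner_approx_sol n 0 r U W" "\<And>n. inner_approx_sol n 0 r U' W'"
    and wt: "weight4_bounded M r U" "weight4_bounded M r W" "weight4_bounded M r U'" "weight4_bounded M r W'"
    and r: "1 \<le> M" "1 \<le> r" "2 * M\<^sup>2 \<le> r ^ 4" "64 * 2 * (22 * M ^ 4) \<le> r ^ 3"
    and z: "z \<in> upper_domain r"
  shows "U z = U' z" "W z = W' z"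
proof -
  define L where "L = 22 * M ^ 4"
  have L: "L \<ge> 0" using r(1) by (simp add: L_def)
  obtain k1 k2 where k:
    "\<And>z. z \<in> upper_domain r \<Longrightarrow> ((\<lambda>z. U z - U' z) has_field_derivative 1 * (U z - U' z) + k1 z) (at z)"
    "\<And>z. z \<in> upper_domain r \<Longrightarrow> ((\<lambda>z. W z - W' z) has_field_derivative (- 1) * (W z - W' z) + k2 z) (at z)"
    "\<And>z. z \<in> upper_domain r \<Longrightarrow> norm (k1 z) \<le> L / norm z ^ 4 * (norm (U z - U' z) + norm (W z - W' z)) + 2 * 0 / norm z ^ 0"
    "\<And>z. z \<in> upper_domain r \<Longrightarrow> norm (k2 z) \<le> L / norm z ^ 4 * (norm (U z - U' z) + norm (W z - W' z)) + 2 * 0 / norm z ^ 0"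
    by (rule approx_sol_difference[OF sol[of 0] wt r(1-3), folded L_def]) (erule that)
  have halve: "norm (U z - U' z) \<le> 2 * M * (1 / 2) ^ i / norm z ^ 4 \<and> norm (W z - W' z) \<le> 2 * M * (1 / 2) ^ i / norm z ^ 4"
    if "z \<in> upper_domain r" for i z
    using that
  proof (induction i arbitrary: z)
    case 0
    have "0 < r" using r(2) by simp
    thus ?case using weight4_bounded_diff[OF wt(1,3) 0] weight4_bounded_diff[OF wt(2,4) 0] by simp
  next
    case (Suc i)
    define D where "D = 2 * M * (1 / 2) ^ i"
    have D: "D \<ge> 0" using r(1) by (simp add: D_def)
    have kb: "norm k \<le> (D / 64) / norm z ^ Suc 4"
      if z: "z \<in> upper_domain r" and k: "norm k \<le> L / norm z ^ 4 * (norm (U z - U' z) + norm (W z - W' z)) + 2 * 0 / norm z ^ 0" for k z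
    proof -
      have nz: "r \<le> norm z" "1 \<le> norm z" using z r(2) by (auto simp: upper_domain_def)
      have "norm k \<le> L / norm z ^ 4 * (norm (U z - U' z) + norm (W z - W' z))" using k by simp
      also have "L / norm z ^ 4 * (norm (U z - U' z) + norm (W z - W' z))
          \<le> L / norm z ^ 4 * (D / norm z ^ 4 + D / norm z ^ 4)"
        using L Suc.IH[OF z] unfolding D_def by (intro mult_left_mono add_mono) auto
      also have "\<dots> = 2 * L * D / (norm z ^ 4 * norm z ^ 4)"
        by (simp add: mult_ac)
      \<comment> \<open>Of the eight powers, five are kept for the ray bound. The other three are
        spent against r^3 \<ge> 128 L, which gives D/64; the factor \<open>2 ^ Suc 4\<close> of the
        ray bound then leaves D/2.\<close>
      also have "norm z ^ 4 * norm z ^ 4 = norm z ^ 3 * norm z ^ Suc 4"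
        by (simp only: power_add[symmetric]) simp
      also have "2 * L * D / (norm z ^ 3 * norm z ^ Suc 4) = (2 * L * D / norm z ^ 3) / norm z ^ Suc 4"
        by (simp only: divide_divide_eq_left)
      also have "\<dots> \<le> (D / 64) / norm z ^ Suc 4"
      proof (intro divide_right_mono)
        have "64 * 2 * L \<le> r ^ 3" using r(4) unfolding L_def .
        also have "r ^ 3 \<le> norm z ^ 3" using nz(1) r(2) by (intro power_mono) auto
        finally have "D * (64 * 2 * L) \<le> D * norm z ^ 3" using D by (rule mult_left_mono)
        hence "2 * L * D \<le> D / 64 * norm z ^ 3" by (simp add: mult_ac)
        moreover have "0 < norm z ^ 3" using nz(2) by (intro zero_less_power) linarith
        ultimately show "2 * L * D / norm z ^ 3 \<le> D / 64" by (simp only: pos_divide_le_eq)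
      qed auto
      finally show ?thesis .
    qed
    have dec: "D / norm z ^ 4 \<le> D / norm z" if "z \<in> upper_domain r" for z
    proof -
      have "1 \<le> norm z" using that r(2) by (auto simp: upper_domain_def)
      thus ?thesis using D power_increasing[of 1 4 "norm z"] by (intro divide_left_mono mult_pos_pos) auto
    qed
    have fb: "norm (U w - U' w) \<le> D / norm w" "norm (W w - W' w) \<le> D / norm w" if "w \<in> upper_domain r" for w
      using Suc.IH[OF that] dec[OF that] unfolding D_def by linarith+
    have K: "0 \<le> D / 64" "0 < (4::nat)" "0 < r" using D r(2) by auto
    have "norm (U z - U' z) \<le> (D / 64) * 2 ^ Suc 4 / norm z ^ 4"
      by (rule vertical_ray_bound[where \<sigma>=1 and k=k1 and r=r, OF k(1) _ kb[OF _ k(3)] fb(1) K(2,1,3) Suc.prems]) simp_all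
    moreover have "norm (W z - W' z) \<le> (D / 64) * 2 ^ Suc 4 / norm z ^ 4"
      by (rule vertical_ray_bound[where \<sigma>="- 1" and k=k2 and r=r, OF k(2) _ kb[OF _ k(4)] fb(2) K(2,1,3) Suc.prems]) simp_all
    ultimately show ?case by (simp add: D_def)
  qed
  have "(\<lambda>i. (1 / 2 :: real) ^ i) \<longlonglongrightarrow> 0" by (rule LIMSEQ_power_zero) simp
  from tendsto_mult_right_zero[OF this] have lim: "(\<lambda>i. 2 * M / norm z ^ 4 * (1 / 2) ^ i) \<longlonglongrightarrow> 0" .
  have le: "norm (U z - U' z) \<le> 2 * M / norm z ^ 4 * (1 / 2) ^ i" "norm (W z - W' z) \<le> 2 * M / norm z ^ 4 * (1 / 2) ^ i" for i
    using halve[OF z, of i] by (simp_all only: times_divide_eq_left)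
  have "norm (U z - U' z) \<le> 0" "norm (W z - W' z) \<le> 0"
    by (rule LIMSEQ_le_const[OF lim]; use le in blast)+
  thus "U z = U' z" "W z = W' z" by simp_all
qed

lemma upper_domain_mono: "r \<le> r' \<Longrightarrow> upper_domain r' \<subseteq> upper_domain r"
  by (auto simp: upper_domain_def)

text \<open>For x = 1/z the left side is the z-derivative of x^4 p(x). Clearing the denominator
  makes the terms of order x^8 cancel, and of the nonlinearity only -x^9 a^2 b remains on the right.
  Together with the left side this produces the factor \<open>3 * a\<close> and the delay by five
  powers in \<open>inner_step\<close>.\<close>

lemma inner_poly_ode:
  assumes c: "p - inner_step p = monom 1 m * c" and nz: "1 + x ^ 4 * poly p x * poly p (- x) \<noteq> 0"
  shows "- (x ^ 5) * (4 * poly p x + x * poly (pderiv p) x) =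
    x ^ 4 * poly p x + x ^ 4 - x ^ 8 * inner_nonlin x (poly p x) (poly p (- x))
      - x ^ (m + 4) * poly c x / (1 + x ^ 4 * poly p x * poly p (- x))"
proof -
  define a b d where "a = poly p x" "b = poly p (- x)" "d = poly (pderiv p) x"
  define D where "D = 1 + x ^ 4 * a * b"
  have D: "D \<noteq> 0" using nz by (simp add: D_def a_b_d_def)
  have "poly (p - inner_step p) x = poly (monom 1 m * c) x" using c by simp
  hence "a - (- 1 - 4 * x * a - x\<^sup>2 * d - x ^ 5 * (a * b * (3 * a + x * d))) = x ^ m * poly c x"
    by (simp add: inner_step_def a_b_d_def poly_monom poly_pcompose power2_eq_square mult_ac)
  hence res: "x ^ m * poly c x = a + 1 + 4 * x * a + x\<^sup>2 * d + x ^ 5 * (a * b * (3 * a + x * d))"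
    by (simp only: diff_minus_eq_add minus_diff_eq diff_diff_eq2) (simp add: algebra_simps)
  have e1: "- (x ^ 5) * (4 * a + x * d) * D =
      (x ^ 4 * a + x ^ 4) * D - x ^ 8 * (a * b * (a * (1 + x) + 1)) - x ^ 4 * (x ^ m * poly c x)"
    unfolding res D_def by (simp add: algebra_simps eval_nat_numeral)
  have e2: "inner_nonlin x a b = a * b * (a * (1 + x) + 1) / D"
    by (simp add: inner_nonlin_def D_def)
  have gen: "L = A - X * (N / D) - Y / D" if "L * D = A * D - X * N - Y" for L A X N Y
  proof -
    have "L = (A * D - X * N - Y) / D" using that D by (simp add: eq_divide_eq)
    thus ?thesis using D by (simp add: diff_divide_distrib)
  qed
  have "- (x ^ 5) * (4 * a + x * d) =
      x ^ 4 * a + x ^ 4 - x ^ 8 * inner_nonlin x a b - x ^ 4 * (x ^ m * poly c x) / D"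
    unfolding e2 by (rule gen[OF e1])
  thus ?thesis by (simp add: a_b_d_def D_def power_add mult_ac)
qed

section \<open>Asymptotic expansion\<close>

definition series_approx :: "nat \<Rightarrow> complex \<Rightarrow> complex" where
  "series_approx m z = poly (inner_poly m) (1 / z) / z ^ 4"

definition series_approx_refl :: "nat \<Rightarrow> complex \<Rightarrow> complex" where
  "series_approx_refl m z = poly (inner_poly m) (- 1 / z) / z ^ 4"

lemma poly_over_power4_deriv:
  assumes "z \<noteq> 0"
  shows "((\<lambda>z. poly p (s / z) / z ^ 4) has_field_derivative
     - ((1 / z) ^ 5) * (4 * poly p (s / z) + (s / z) * poly (pderiv p) (s / z))) (at z)"
proof -
  have "((\<lambda>z. poly p (s / z)) has_field_derivative poly (pderiv p) (s / z) * (- s / z\<^sup>2)) (at z)"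
    using assms by (intro DERIV_chain2[OF poly_DERIV]) (auto intro!: derivative_eq_intros simp: power2_eq_square)
  moreover have "((\<lambda>z. z ^ 4) has_field_derivative 4 * z ^ 3) (at z)"
    by (auto intro!: derivative_eq_intros)
  ultimately have "((\<lambda>z. poly p (s / z) / z ^ 4) has_field_derivative
     (poly (pderiv p) (s / z) * (- s / z\<^sup>2) * z ^ 4 - poly p (s / z) * (4 * z ^ 3)) / (z ^ 4 * z ^ 4)) (at z)"
    using assms by (intro DERIV_divide) auto
  moreover have "(A * (- s / z\<^sup>2) * z ^ 4 - P * (4 * z ^ 3)) / (z ^ 4 * z ^ 4)
      = - ((1 / z) ^ 5) * (4 * P + (s / z) * A)" for A P
    using assms by (simp add: divide_simps) (simp add: algebra_simps eval_nat_numeral)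
  ultimately show ?thesis by simp
qed

text \<open>M and C come from bounds on the unit disc, which contains 1/z and -1/z as soon as |z|
  \<ge> 1; so they are independent of r. The reflected function obeys the second equation because x
  = -1/z reverses the sign of the z-derivative.\<close>

lemma series_approx_sol:
  obtains M C where "1 \<le> M" "0 \<le> C"
    "\<And>r. 1 \<le> r \<Longrightarrow> 2 * M\<^sup>2 \<le> r ^ 4 \<Longrightarrow> inner_approx_sol (m + 4) C r (series_approx m) (series_approx_refl m)"
    "\<And>r. 1 \<le> r \<Longrightarrow> weight4_bounded M r (series_approx m)"
    "\<And>r. 1 \<le> r \<Longrightarrow> weight4_bounded M r (series_approx_refl m)"
proof -
  define p where "p = inner_poly m"
  obtain c where c: "p - inner_step p = monom 1 m * c"
    unfolding p_def by (rule inner_step_residual)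
  obtain M0 where M0: "M0 > 0" "\<And>x. norm x \<le> 1 \<Longrightarrow> norm (poly p x) \<le> M0"
    using poly_bound_exists[of 1 p] by blast
  obtain C0 where C0: "C0 > 0" "\<And>x. norm x \<le> 1 \<Longrightarrow> norm (poly c x) \<le> C0"
    using poly_bound_exists[of 1 c] by blast
  define M where "M = max 1 M0"
  have M: "1 \<le> M" "\<And>x. norm x \<le> 1 \<Longrightarrow> norm (poly p x) \<le> M"
    using M0 by (auto simp: M_def intro: max.coboundedI2)
  define D where "D x = 1 + x ^ 4 * poly p x * poly p (- x)" for x
  define R where "R x = x ^ (m + 4) * poly c x / D x" for x
  have Dge: "1 / 2 \<le> norm (D x)" if "norm x \<le> 1" "norm x ^ 4 * M\<^sup>2 \<le> 1 / 2" for x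
  proof -
    have "norm (x ^ 4 * poly p x * poly p (- x)) \<le> norm x ^ 4 * M\<^sup>2"
      using M(2)[of x] M(2)[of "- x"] that M(1) unfolding norm_mult norm_power power2_eq_square mult.assoc
      by (intro mult_left_mono mult_mono) auto
    moreover have "norm (1::complex) \<le> norm (D x) + norm (x ^ 4 * poly p x * poly p (- x))"
      unfolding D_def by (metis add_diff_cancel_right' norm_triangle_ineq4)
    ultimately show ?thesis using that by simp
  qed
  have Rle: "norm (R x) \<le> 2 * C0 * norm x ^ (m + 4)" if x: "norm x \<le> 1" "norm x ^ 4 * M\<^sup>2 \<le> 1 / 2" for x
  proof -
    have "norm (R x) = norm x ^ (m + 4) * norm (poly c x) / norm (D x)"
      by (simp add: R_def norm_mult norm_divide norm_power)
    also have "\<dots> \<le> norm x ^ (m + 4) * C0 / (1 / 2)"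
      using C0 x Dge[OF x] by (intro frac_le mult_left_mono mult_nonneg_nonneg) auto
    finally show ?thesis by (simp add: mult_ac)
  qed
  have ode: "- (x ^ 5) * (4 * poly p x + x * poly (pderiv p) x) =
      x ^ 4 * poly p x + x ^ 4 - x ^ 8 * inner_nonlin x (poly p x) (poly p (- x)) - R x"
    if x: "norm x \<le> 1" "norm x ^ 4 * M\<^sup>2 \<le> 1 / 2" for x
  proof -
    have "D x \<noteq> 0" using Dge[OF x] by auto
    from inner_poly_ode[OF c this[unfolded D_def]] show ?thesis by (simp add: R_def D_def)
  qed
  show ?thesis
  proof (rule that[of M "2 * C0"])
    show "1 \<le> M" "0 \<le> 2 * C0" using M C0 by auto
    fix r :: real assume r: "1 \<le> r"
    have z1: "norm z \<ge> 1" if "z \<in> upper_domain r" for z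
      using that r by (auto simp: upper_domain_def)
    have x1: "norm (1 / z) \<le> 1" "norm (- 1 / z) \<le> 1" if "z \<in> upper_domain r" for z
      using z1[OF that] by (auto simp: norm_divide divide_le_eq_1)
    show "weight4_bounded M r (series_approx m)" "weight4_bounded M r (series_approx_refl m)"
      unfolding weight4_bounded_def
    proof safe
      fix z assume z: "z \<in> upper_domain r"
      have "z \<noteq> 0" using z1[OF z] by auto
      thus "norm (z ^ 4 * series_approx m z) \<le> M" "norm (z ^ 4 * series_approx_refl m z) \<le> M"
        using M(2)[OF x1(1)[OF z]] M(2)[OF x1(2)[OF z]]
        by (simp_all add: series_approx_def series_approx_refl_def p_def)
    qed
    assume rM: "2 * M\<^sup>2 \<le> r ^ 4"
    show "inner_approx_sol (m + 4) (2 * C0) r (series_approx m) (series_approx_refl m)"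
      unfolding inner_approx_sol_def
    proof (intro exI ballI)
      fix z assume z: "z \<in> upper_domain r"
      have nz: "z \<noteq> 0" using z1[OF z] by auto
      have "r ^ 4 \<le> norm z ^ 4" using z r by (intro power_mono) (auto simp: upper_domain_def)
      hence zM: "2 * M\<^sup>2 \<le> norm z ^ 4" using rM by simp
      hence xM: "norm (1 / z) ^ 4 * M\<^sup>2 \<le> 1 / 2" "norm (- 1 / z) ^ 4 * M\<^sup>2 \<le> 1 / 2"
        using nz by (simp_all add: norm_divide power_divide divide_le_eq)
      have x4: "(1 / z) ^ 4 = 1 / z ^ 4" "(1 / z) ^ 8 = 1 / z ^ 8" "(- 1 / z) ^ 4 = 1 / z ^ 4" "(- 1 / z) ^ 8 = 1 / z ^ 8"
        by (simp_all add: power_divide)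
      have zs: "z ^ 4 * series_approx m z = poly p (1 / z)" "z ^ 4 * series_approx_refl m z = poly p (- 1 / z)"
        using nz by (simp_all add: series_approx_def series_approx_refl_def p_def)
      have "(series_approx m has_field_derivative
          - ((1 / z) ^ 5) * (4 * poly p (1 / z) + (1 / z) * poly (pderiv p) (1 / z))) (at z)"
        using poly_over_power4_deriv[OF nz, of p 1] by (simp add: series_approx_def[abs_def] p_def)
      also have "- ((1 / z) ^ 5) * (4 * poly p (1 / z) + (1 / z) * poly (pderiv p) (1 / z)) =
          inner_field1 z (series_approx m z) (series_approx_refl m z) + (- R (1 / z))"
        unfolding ode[OF x1(1)[OF z] xM(1)] x4 inner_field1_def zs
        by (simp add: series_approx_def p_def)
      finally have d1: "(series_approx m has_field_derivative
          inner_field1 z (series_approx m z) (series_approx_refl m z) + (- R (1 / z))) (at z)" .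
      have "(series_approx_refl m has_field_derivative
          - ((1 / z) ^ 5) * (4 * poly p (- 1 / z) + (- 1 / z) * poly (pderiv p) (- 1 / z))) (at z)"
        using poly_over_power4_deriv[OF nz, of p "- 1"] by (simp add: series_approx_refl_def[abs_def] p_def)
      also have "- ((1 / z) ^ 5) * (4 * poly p (- 1 / z) + (- 1 / z) * poly (pderiv p) (- 1 / z)) =
          - (- ((- 1 / z) ^ 5) * (4 * poly p (- 1 / z) + (- 1 / z) * poly (pderiv p) (- 1 / z)))"
        by (simp add: power_divide)
      also have "\<dots> = inner_field2 z (series_approx m z) (series_approx_refl m z) + R (- 1 / z)"
        unfolding ode[OF x1(2)[OF z] xM(2)] x4 inner_field2_def zs
        by (simp add: series_approx_refl_def p_def)
      finally have d2: "(series_approx_refl m has_field_derivative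
          inner_field2 z (series_approx m z) (series_approx_refl m z) + R (- 1 / z)) (at z)" .
      have "norm (- R (1 / z)) \<le> 2 * C0 / norm z ^ (m + 4)" "norm (R (- 1 / z)) \<le> 2 * C0 / norm z ^ (m + 4)"
        using Rle[OF x1(1)[OF z] xM(1)] Rle[OF x1(2)[OF z] xM(2)] by (simp_all add: norm_divide power_divide)
      with d1 d2 show "(series_approx m has_field_derivative
           inner_field1 z (series_approx m z) (series_approx_refl m z) + (- R (1 / z))) (at z) \<and>
         (series_approx_refl m has_field_derivative
           inner_field2 z (series_approx m z) (series_approx_refl m z) + R (- 1 / z)) (at z) \<and>
         norm (- R (1 / z)) \<le> 2 * C0 / norm z ^ (m + 4) \<and> norm (R (- 1 / z)) \<le> 2 * C0 / norm z ^ (m + 4)"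
        by blast
    qed
  qed
qed

text \<open>\<open>inner_poly m\<close> also carries coefficients of index m and beyond, which need
  not be those of the series. Everything from index N on is absorbed in a polynomial multiple of
  \<open>x ^ N\<close>, bounded on the unit disc. Taking s = 1 and s = -1 treats both components at
  once.\<close>

lemma series_approx_truncation:
  assumes "N \<le> m"
  obtains C where "\<And>z. 1 \<le> norm z \<Longrightarrow>
     norm (series_approx m z - (\<Sum>k<N. inner_coeff k / z ^ (k + 4))) \<le> C / norm z ^ (N + 4) \<and>
     norm (series_approx_refl m z - (\<Sum>k<N. (- 1) ^ k * inner_coeff k / z ^ (k + 4))) \<le> C / norm z ^ (N + 4)"
proof -
  define t where "t = (\<Sum>k<N. monom (inner_coeff k) k)"
  have ct: "coeff t j = inner_coeff j" if "j < N" for j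
    using that by (simp add: t_def coeff_sum sum.delta' if_distrib cong: if_cong)
  have "monom 1 N dvd inner_poly m - t"
    using assms by (subst monom_1_dvd_iff') (auto simp: coeff_inner_poly ct)
  then obtain q where q: "inner_poly m - t = monom 1 N * q" by (auto elim: dvdE)
  obtain C where C: "C > 0" "\<And>x. norm x \<le> 1 \<Longrightarrow> norm (poly q x) \<le> C"
    using poly_bound_exists[of 1 q] by blast
  have pq: "poly (inner_poly m) x - (\<Sum>k<N. inner_coeff k * x ^ k) = x ^ N * poly q x" for x
    using arg_cong[OF q, of "\<lambda>p. poly p x"] by (simp add: t_def poly_sum poly_monom)
  have key: "norm (poly (inner_poly m) (s / z) / z ^ 4 - (\<Sum>k<N. s ^ k * inner_coeff k / z ^ (k + 4))) \<le> C / norm z ^ (N + 4)"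
    if z: "1 \<le> norm z" and s: "norm s = 1" for z s
  proof -
    have "(\<Sum>k<N. s ^ k * inner_coeff k / z ^ (k + 4)) = (\<Sum>k<N. inner_coeff k * (s / z) ^ k) / z ^ 4"
      by (simp add: sum_divide_distrib power_divide power_add mult_ac)
    hence "poly (inner_poly m) (s / z) / z ^ 4 - (\<Sum>k<N. s ^ k * inner_coeff k / z ^ (k + 4)) =
        (s / z) ^ N * poly q (s / z) / z ^ 4"
      by (simp add: pq[symmetric] diff_divide_distrib)
    moreover have "norm ((s / z) ^ N * poly q (s / z) / z ^ 4) = norm (poly q (s / z)) / norm z ^ (N + 4)"
      using s by (simp add: norm_mult norm_divide norm_power power_divide power_add)
    moreover have "norm (poly q (s / z)) \<le> C"
      using z s by (intro C) (auto simp: norm_divide divide_le_eq_1)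
    ultimately show ?thesis by (simp add: divide_right_mono)
  qed
  show ?thesis
    by (rule that[of C]) (use key[where s=1] key[where s="- 1"] in \<open>simp add: series_approx_def series_approx_refl_def\<close>)
qed

lemma inner_approx_sol_mono:
  assumes "inner_approx_sol n C r U W" "r \<le> r'" "C \<le> C'" "0 < r"
  shows "inner_approx_sol n C' r' U W"
proof -
  obtain R1 R2 where R: "\<forall>z\<in>upper_domain r.
     (U has_field_derivative inner_field1 z (U z) (W z) + R1 z) (at z) \<and>
     (W has_field_derivative inner_field2 z (U z) (W z) + R2 z) (at z) \<and>
     norm (R1 z) \<le> C / norm z ^ n \<and> norm (R2 z) \<le> C / norm z ^ n"
    using assms(1) unfolding inner_approx_sol_def by blast
  have "C / norm z ^ n \<le> C' / norm z ^ n" for z :: complex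
    using assms(3) by (intro divide_right_mono) auto
  note le = this
  show ?thesis
    unfolding inner_approx_sol_def
  proof (rule exI[of _ R1], rule exI[of _ R2], rule ballI)
    fix z assume "z \<in> upper_domain r'"
    hence "z \<in> upper_domain r" using upper_domain_mono[OF assms(2)] by blast
    from R[rule_format, OF this] le[of z]
    show "(U has_field_derivative inner_field1 z (U z) (W z) + R1 z) (at z) \<and>
     (W has_field_derivative inner_field2 z (U z) (W z) + R2 z) (at z) \<and>
     norm (R1 z) \<le> C' / norm z ^ n \<and> norm (R2 z) \<le> C' / norm z ^ n" by auto
  qed
qed

lemma weight4_bounded_mono:
  "weight4_bounded M r U \<Longrightarrow> r \<le> r' \<Longrightarrow> M \<le> M' \<Longrightarrow> weight4_bounded M' r' U"
  using upper_domain_mono[of r r'] by (auto simp: weight4_bounded_def intro: order_trans)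

text \<open>An exact solution is compared with \<open>series_approx (N + 1)\<close>. The index N + 1
  compensates for \<open>approx_sol_close\<close>, whose conclusion is one power weaker than the
  residual.\<close>

lemma inner_sol_asymptotic:
  assumes sol: "\<And>n. inner_approx_sol n 0 r U W" and r: "0 < r"
    and wt: "weight4_bounded M0 r U" "weight4_bounded M0 r W"
  obtains C r' where "r \<le> r'" "1 \<le> r'" "\<And>z. z \<in> upper_domain r' \<Longrightarrow>
     norm (U z - (\<Sum>k<N. inner_coeff k / z ^ (k + 4))) \<le> C / norm z ^ (N + 4) \<and>
     norm (W z - (\<Sum>k<N. (- 1) ^ k * inner_coeff k / z ^ (k + 4))) \<le> C / norm z ^ (N + 4)"
proof -
  obtain M1 C where M1: "1 \<le> M1" "0 \<le> C" and ap:
    "\<And>r. 1 \<le> r \<Longrightarrow> 2 * M1\<^sup>2 \<le> r ^ 4 \<Longrightarrow> inner_approx_sol (N + 1 + 4) C r (series_approx (N + 1)) (series_approx_refl (N + 1))"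
    "\<And>r. 1 \<le> r \<Longrightarrow> weight4_bounded M1 r (series_approx (N + 1))"
    "\<And>r. 1 \<le> r \<Longrightarrow> weight4_bounded M1 r (series_approx_refl (N + 1))"
    by (rule series_approx_sol[of "N + 1"]) blast
  define M where "M = max M0 M1"
  have M: "M0 \<le> M" "M1 \<le> M" "1 \<le> M" using M1 by (auto simp: M_def)
  define r' where "r' = max r (2 * M\<^sup>2)"
  have "1 \<le> M\<^sup>2" using M by simp
  hence r': "r \<le> r'" "1 \<le> r'" "2 * M\<^sup>2 \<le> r'" by (auto simp: r'_def)
  have r4: "2 * M\<^sup>2 \<le> r' ^ 4" using r' power_increasing[of 1 4 r'] by simp
  have "M1\<^sup>2 \<le> M\<^sup>2" using M M1 by (intro power_mono) auto
  hence r4': "2 * M1\<^sup>2 \<le> r' ^ 4" using r4 by simp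
  have ap': "inner_approx_sol (Suc (N + 4)) C r' (series_approx (N + 1)) (series_approx_refl (N + 1))"
    using ap(1)[OF r'(2) r4'] by simp
  have sol': "inner_approx_sol (Suc (N + 4)) C r' U W"
    by (rule inner_approx_sol_mono[OF sol r'(1) M1(2) r])
  obtain D where D: "\<forall>z\<in>upper_domain r'. norm (U z - series_approx (N + 1) z) \<le> D / norm z ^ (N + 4) \<and>
      norm (W z - series_approx_refl (N + 1) z) \<le> D / norm z ^ (N + 4)"
    using approx_sol_close[OF sol' ap' weight4_bounded_mono[OF wt(1) r'(1) M(1)] weight4_bounded_mono[OF wt(2) r'(1) M(1)]
        weight4_bounded_mono[OF ap(2)[OF r'(2)] order_refl M(2)] weight4_bounded_mono[OF ap(3)[OF r'(2)] order_refl M(2)]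
        M(3) r'(2) r4 M1(2), of "N + 4"] by auto
  obtain E where E: "\<And>z. 1 \<le> norm z \<Longrightarrow>
     norm (series_approx (N + 1) z - (\<Sum>k<N. inner_coeff k / z ^ (k + 4))) \<le> E / norm z ^ (N + 4) \<and>
     norm (series_approx_refl (N + 1) z - (\<Sum>k<N. (- 1) ^ k * inner_coeff k / z ^ (k + 4))) \<le> E / norm z ^ (N + 4)"
    using series_approx_truncation[of N "N + 1"] by auto
  show ?thesis
  proof (rule that[OF r'(1,2)])
    fix z assume z: "z \<in> upper_domain r'"
    have "1 \<le> norm z" using z r' by (auto simp: upper_domain_def)
    note bounds = D[rule_format, OF z] E[OF this]
    have tri: "norm (u - v) \<le> (D + E) / c" if "norm (u - w) \<le> D / c" "norm (w - v) \<le> E / c" for u v w :: complex and c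
      using norm_triangle_ineq[of "u - w" "w - v"] that by (simp add: add_divide_distrib)
    show "norm (U z - (\<Sum>k<N. inner_coeff k / z ^ (k + 4))) \<le> (D + E) / norm z ^ (N + 4) \<and>
     norm (W z - (\<Sum>k<N. (- 1) ^ k * inner_coeff k / z ^ (k + 4))) \<le> (D + E) / norm z ^ (N + 4)"
      using bounds by (intro conjI tri) auto
  qed
qed

section \<open>Coefficients as moments of the jumps\<close>

lemma contour_integral_linepath_primitive:
  assumes "convex S" "\<And>z. z \<in> S \<Longrightarrow> (F has_field_derivative H z) (at z within S)" "a \<in> S" "b \<in> S"
  shows "(H has_contour_integral F b - F a) (linepath a b)"
proof -
  have "path_image (linepath a b) \<subseteq> S"
    using closed_segment_subset[OF assms(3,4,1)] by simp
  from contour_integral_primitive[OF assms(2) valid_path_linepath this] show ?thesis by simp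
qed

text \<open>The path from \<open>R\<close> over \<open>\<i> R\<close> to \<open>- R\<close>. Polygonal arches keep the region between two of them
  a union of two convex sets, so that primitives exist.\<close>

definition arch :: "(complex \<Rightarrow> complex) \<Rightarrow> real \<Rightarrow> complex" where
  "arch H R = contour_integral (linepath (of_real R) (\<i> * of_real R)) H
     + contour_integral (linepath (\<i> * of_real R) (- of_real R)) H"

lemma norm_ge_half_sum: "(\<bar>Re z\<bar> + \<bar>Im z\<bar>) / 2 \<le> norm z"
  using abs_Re_le_cmod[of z] abs_Im_le_cmod[of z] by simp

text \<open>The imaginary axis cuts the region outside the inner arch into two convex pieces. Their
  primitives F and G have equal increments on the common segment, so that part cancels and only the
  real axis remains. The condition 2 r \<le> \<rho> guarantees |z| \<ge> r in both pieces, since |z|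
  is at least half of |Re z| + |Im z|.\<close>

lemma arch_decomposition:
  assumes H: "\<And>z. z \<in> upper_domain r \<Longrightarrow> H field_differentiable at z"
    and r: "0 < r" "2 * r \<le> \<rho>" "\<rho> \<le> R"
  shows "arch H R = arch H \<rho> - integral {\<rho>..R} (\<lambda>y. H (of_real y) + H (- of_real y))"
proof -
  define S where "S s = {z. 0 \<le> s * Re z} \<inter> {z. 0 \<le> Im z} \<inter> {z. \<rho> \<le> inner (Complex s 1) z}" for s :: real
  have conv: "convex (S s)" for s
  proof -
    have "{z. 0 \<le> s * Re z} = {z. 0 \<le> inner (Complex s 0) z}" by (simp add: inner_complex_def)
    moreover have "{z. 0 \<le> Im z} = {z. 0 \<le> inner (Complex 0 1) z}" by (simp add: inner_complex_def)
    moreover have "convex {z. b \<le> inner a z}" for a :: complex and b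
      by (rule convex_halfspace_ge)
    ultimately show ?thesis unfolding S_def by (intro convex_Int) simp_all
  qed
  have sub: "S s \<subseteq> upper_domain r" if "\<bar>s\<bar> = 1" for s
  proof
    fix z assume z: "z \<in> S s"
    have "\<rho> \<le> \<bar>Re z\<bar> + \<bar>Im z\<bar>"
    proof -
      have "s * Re z \<le> \<bar>s * Re z\<bar>" by simp
      hence "s * Re z \<le> \<bar>Re z\<bar>" using that by (simp add: abs_mult)
      thus ?thesis using z by (simp add: S_def inner_complex_def)
    qed
    hence "r \<le> norm z" using norm_ge_half_sum[of z] r by simp
    thus "z \<in> upper_domain r" using z by (simp add: S_def upper_domain_def)
  qed
  have prim: "\<exists>F. \<forall>z\<in>S s. (F has_field_derivative H z) (at z within S s)" if "\<bar>s\<bar> = 1" for s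
  proof -
    have d: "H field_differentiable at z" if "z \<in> S s" for z
      using H sub[OF \<open>\<bar>s\<bar> = 1\<close>] that by blast
    hence c: "continuous_on (S s) H"
      by (intro continuous_at_imp_continuous_on ballI field_differentiable_imp_continuous_at)
    obtain F where "\<And>z. z \<in> S s \<Longrightarrow> (F has_field_derivative H z) (at z within S s)"
      by (rule holomorphic_convex_primitive[OF conv finite.emptyI c]) (use d interior_subset in blast)+
    thus ?thesis by blast
  qed
  from prim[of 1] obtain F where F: "\<And>z. z \<in> S 1 \<Longrightarrow> (F has_field_derivative H z) (at z within S 1)" by auto
  from prim[of "- 1"] obtain G where G: "\<And>z. z \<in> S (- 1) \<Longrightarrow> (G has_field_derivative H z) (at z within S (- 1))" by auto
  have in1: "of_real x \<in> S 1" "\<i> * of_real x \<in> S 1" "- of_real x \<in> S (- 1)" "\<i> * of_real x \<in> S (- 1)" if "\<rho> \<le> x" for x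
    using that r by (auto simp: S_def inner_complex_def)
  have arch: "arch H x = F (\<i> * of_real x) - F (of_real x) + (G (- of_real x) - G (\<i> * of_real x))" if "\<rho> \<le> x" for x
    unfolding arch_def
    using contour_integral_unique[OF contour_integral_linepath_primitive[OF conv F in1(1,2)[OF that]]]
      contour_integral_unique[OF contour_integral_linepath_primitive[OF conv G in1(4,3)[OF that]]] by simp
  have FG: "F (\<i> * of_real R) - F (\<i> * of_real \<rho>) = G (\<i> * of_real R) - G (\<i> * of_real \<rho>)"
    using has_contour_integral_unique[OF contour_integral_linepath_primitive[OF conv F in1(2)[OF order_refl] in1(2)[OF r(3)]]
        contour_integral_linepath_primitive[OF conv G in1(4)[OF order_refl] in1(4)[OF r(3)]]] .
  have vF: "((\<lambda>y. F (of_real y)) has_vector_derivative H (of_real y)) (at y within {\<rho>..R})" if "y \<in> {\<rho>..R}" for y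
  proof -
    have "(of_real has_vector_derivative (1::complex)) (at y within {\<rho>..R})"
      using has_vector_derivative_real_field[OF DERIV_ident, of y "{\<rho>..R}"] by simp
    moreover have "(F has_field_derivative H (of_real y)) (at (of_real y) within of_real ` {\<rho>..R})"
      by (rule has_field_derivative_subset[OF F]) (use in1(1) that in auto)
    ultimately show ?thesis
      using field_vector_diff_chain_within[of of_real 1 y "{\<rho>..R}" F "H (of_real y)"] by (simp add: o_def)
  qed
  have vG: "((\<lambda>y. - G (- of_real y)) has_vector_derivative H (- of_real y)) (at y within {\<rho>..R})" if "y \<in> {\<rho>..R}" for y
  proof -
    have "((\<lambda>y. - of_real y) has_vector_derivative (- 1::complex)) (at y within {\<rho>..R})"
      using has_vector_derivative_real_field[OF DERIV_minus[OF DERIV_ident], of y "{\<rho>..R}"] by simp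
    moreover have "(G has_field_derivative H (- of_real y)) (at (- of_real y) within (\<lambda>y. - of_real y) ` {\<rho>..R})"
      by (rule has_field_derivative_subset[OF G]) (use in1(3) that in auto)
    ultimately have "((\<lambda>y. G (- of_real y)) has_vector_derivative - H (- of_real y)) (at y within {\<rho>..R})"
      using field_vector_diff_chain_within[of "\<lambda>y. - of_real y" "- 1" y "{\<rho>..R}" G "H (- of_real y)"] by (simp add: o_def)
    from has_vector_derivative_minus[OF this] show ?thesis by simp
  qed
  have "((\<lambda>y. H (of_real y) + H (- of_real y)) has_integral
      (F (of_real R) - F (of_real \<rho>)) + (- G (- of_real R) - (- G (- of_real \<rho>)))) {\<rho>..R}"
    by (intro has_integral_add fundamental_theorem_of_calculus r(3) vF vG) auto
  hence "integral {\<rho>..R} (\<lambda>y. H (of_real y) + H (- of_real y)) =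
      (F (of_real R) - F (of_real \<rho>)) + (- G (- of_real R) - (- G (- of_real \<rho>)))"
    by (rule integral_unique)
  moreover have "F (\<i> * of_real R) = F (\<i> * of_real \<rho>) + (G (\<i> * of_real R) - G (\<i> * of_real \<rho>))"
    using FG by (simp add: algebra_simps)
  ultimately show ?thesis unfolding arch[OF r(3)] arch[OF order_refl] by simp
qed

lemma arch_segment:
  assumes "0 < R" "\<bar>s\<bar> = 1" "z \<in> closed_segment (of_real (s * R)) (\<i> * of_real R)"
  shows "0 \<le> Im z \<and> R / 2 \<le> norm z \<and> norm z \<le> R"
proof -
  obtain u where u: "0 \<le> u" "u \<le> 1" "z = (1 - u) *\<^sub>R of_real (s * R) + u *\<^sub>R (\<i> * of_real R)"
    using assms(3) by (auto simp only: in_segment)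
  have im: "Re z = (1 - u) * (s * R)" "Im z = u * R" using u by simp_all
  have "\<bar>Re z\<bar> = (1 - u) * R" "\<bar>Im z\<bar> = u * R"
    using u(1,2) assms(1,2) by (simp_all add: im abs_mult)
  hence "\<bar>Re z\<bar> + \<bar>Im z\<bar> = R" by (simp add: algebra_simps)
  moreover have "norm z \<le> \<bar>Re z\<bar> + \<bar>Im z\<bar>" by (rule cmod_le)
  moreover have "(\<bar>Re z\<bar> + \<bar>Im z\<bar>) / 2 \<le> norm z" by (rule norm_ge_half_sum)
  moreover have "0 \<le> Im z" using u(1) assms(1) by (simp add: im)
  ultimately show ?thesis by simp
qed

lemma arch_bound:
  assumes H: "\<And>z. 0 \<le> Im z \<Longrightarrow> R / 2 \<le> norm z \<Longrightarrow> norm z \<le> R \<Longrightarrow> norm (H z) \<le> B"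
    and cont: "continuous_on {z. 0 \<le> Im z \<and> R / 2 \<le> norm z} H" and "0 < R" "0 \<le> B"
  shows "norm (arch H R) \<le> 4 * B * R"
proof -
  define a where "a s = complex_of_real (s * R)" for s
  have seg: "0 \<le> Im z \<and> R / 2 \<le> norm z \<and> norm z \<le> R"
    if "z \<in> closed_segment (a s) (\<i> * of_real R)" "\<bar>s\<bar> = 1" for z s
    using arch_segment[OF \<open>0 < R\<close> that(2) that(1)[unfolded a_def]] .
  have len: "norm (\<i> * of_real R - a s) \<le> 2 * R" if "\<bar>s\<bar> = 1" for s
    using norm_triangle_ineq4[of "\<i> * of_real R" "a s"] \<open>0 < R\<close> that by (simp add: a_def norm_mult abs_mult)
  have sub: "closed_segment (a s) (\<i> * of_real R) \<subseteq> {z. 0 \<le> Im z \<and> R / 2 \<le> norm z}" if "\<bar>s\<bar> = 1" for s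
    using seg[OF _ that] by blast
  hence c1: "continuous_on (closed_segment (a s) (\<i> * of_real R)) H" if "\<bar>s\<bar> = 1" for s
    using continuous_on_subset[OF cont] that by blast
  hence c2: "continuous_on (closed_segment (\<i> * of_real R) (a s)) H" if "\<bar>s\<bar> = 1" for s
    using that by (subst closed_segment_commute)
  have b1: "norm (contour_integral (linepath (a 1) (\<i> * of_real R)) H) \<le> B * norm (\<i> * of_real R - a 1)"
  proof (rule contour_integral_bound_linepath[OF contour_integrable_continuous_linepath[OF c1] \<open>0 \<le> B\<close>])
    fix z assume "z \<in> closed_segment (a 1) (\<i> * of_real R)"
    with seg[of z 1] show "norm (H z) \<le> B" using H by simp
  qed simp
  have b2: "norm (contour_integral (linepath (\<i> * of_real R) (a (- 1))) H) \<le> B * norm (a (- 1) - \<i> * of_real R)"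
  proof (rule contour_integral_bound_linepath[OF contour_integrable_continuous_linepath[OF c2] \<open>0 \<le> B\<close>])
    fix z assume "z \<in> closed_segment (\<i> * of_real R) (a (- 1))"
    hence "z \<in> closed_segment (a (- 1)) (\<i> * of_real R)" by (subst closed_segment_commute)
    with seg[of z "- 1"] show "norm (H z) \<le> B" using H by simp
  qed simp
  have "norm (arch H R) \<le> B * norm (\<i> * of_real R - a 1) + B * norm (\<i> * of_real R - a (- 1))"
  proof -
    have eq: "arch H R = contour_integral (linepath (a 1) (\<i> * of_real R)) H
        + contour_integral (linepath (\<i> * of_real R) (a (- 1))) H"
      by (simp add: arch_def a_def)
    show ?thesis unfolding eq
      by (rule order_trans[OF norm_triangle_ineq add_mono[OF b1 b2[unfolded norm_minus_commute[of "a (- 1)"]]]])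
  qed
  also have "\<dots> \<le> B * (2 * R) + B * (2 * R)"
    using \<open>0 \<le> B\<close> by (intro add_mono mult_left_mono len) auto
  finally show ?thesis by simp
qed

lemma arch_diff:
  assumes "continuous_on {z. 0 \<le> Im z \<and> R / 2 \<le> norm z} H" "continuous_on {z. 0 \<le> Im z \<and> R / 2 \<le> norm z} L" "0 < R"
  shows "arch (\<lambda>z. H z - L z) R = arch H R - arch L R"
proof -
  have sub: "closed_segment (of_real R) (\<i> * of_real R) \<subseteq> {z. 0 \<le> Im z \<and> R / 2 \<le> norm z}"
    "closed_segment (\<i> * of_real R) (- of_real R) \<subseteq> {z. 0 \<le> Im z \<and> R / 2 \<le> norm z}"
    using arch_segment[OF \<open>0 < R\<close>, of 1] arch_segment[OF \<open>0 < R\<close>, of "- 1"]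
    by (auto simp: closed_segment_commute[of "\<i> * of_real R"])
  show ?thesis
    unfolding arch_def
    by (simp add: contour_integral_diff contour_integrable_continuous_linepath
        continuous_on_subset[OF assms(1) sub(1)] continuous_on_subset[OF assms(1) sub(2)]
        continuous_on_subset[OF assms(2) sub(1)] continuous_on_subset[OF assms(2) sub(2)])
qed

text \<open>The sign factor removes odd j. For even j the primitive \<open>z ^ j / j\<close> takes
  equal values at R and -R. What remains is 2 c times the increment of the logarithm, half a
  turn.\<close>

lemma arch_laurent_part:
  assumes "0 < R"
  shows "arch (\<lambda>z. 2 * c / z + (\<Sum>j=1..n. d j * (1 + (- 1) ^ j) * z ^ (j - 1))) R = 2 * of_real pi * \<i> * c"
    (is "arch ?H R = _")
proof -
  \<comment> \<open>The factor \<open>- \<i>\<close> turns the branch cut into the negative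
    imaginary axis, away from the closed upper half plane.\<close>
  define F where "F z = 2 * c * Ln (- \<i> * z) + (\<Sum>j=1..n. d j * (1 + (- 1) ^ j) * (z ^ j / of_nat j))" for z
  define a where "a s = complex_of_real (s * R)" for s
  have dF: "(F has_field_derivative ?H z) (at z)" if z: "0 \<le> Im z" "z \<noteq> 0" for z
  proof -
    have np: "- \<i> * z \<notin> \<real>\<^sub>\<le>\<^sub>0"
      using z by (auto simp: complex_nonpos_Reals_iff complex_eq_iff)
    have "((\<lambda>z. Ln (- \<i> * z)) has_field_derivative 1 / z) (at z)"
      using z np by (auto intro!: derivative_eq_intros simp: field_simps)
    moreover have "((\<lambda>z. z ^ j / of_nat j) has_field_derivative z ^ (j - 1)) (at z)" if "j \<in> {1..n}" for j
      using that by (auto intro!: derivative_eq_intros)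
    ultimately have "(F has_field_derivative 2 * c * (1 / z) + (\<Sum>j=1..n. d j * (1 + (- 1) ^ j) * z ^ (j - 1))) (at z)"
      unfolding F_def by (intro DERIV_add DERIV_sum DERIV_cmult) auto
    thus ?thesis by simp
  qed
  have nz: "0 \<le> Im z \<and> z \<noteq> 0" if "z \<in> closed_segment (a s) (\<i> * of_real R)" "\<bar>s\<bar> = 1" for z s
    using arch_segment[OF \<open>0 < R\<close> that(2) that(1)[unfolded a_def]] \<open>0 < R\<close> by auto
  have i1: "(?H has_contour_integral F (\<i> * of_real R) - F (a 1)) (linepath (a 1) (\<i> * of_real R))"
    by (rule contour_integral_linepath_primitive[OF convex_closed_segment[of "a 1" "\<i> * of_real R"]])
      (use dF nz[of _ 1] in \<open>auto intro: has_field_derivative_at_within\<close>)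
  have i2: "(?H has_contour_integral F (a (- 1)) - F (\<i> * of_real R)) (linepath (\<i> * of_real R) (a (- 1)))"
    by (rule contour_integral_linepath_primitive[OF convex_closed_segment[of "a (- 1)" "\<i> * of_real R"]])
      (use dF nz[of _ "- 1"] in \<open>auto intro: has_field_derivative_at_within\<close>)
  have "arch ?H R = F (a (- 1)) - F (a 1)"
    using contour_integral_unique[OF i1] contour_integral_unique[OF i2] by (simp add: arch_def a_def)
  also have "\<dots> = 2 * c * (Ln (- \<i> * a (- 1)) - Ln (- \<i> * a 1))"
  proof -
    have "d j * (1 + (- 1) ^ j) * (a (- 1) ^ j / of_nat j) = d j * (1 + (- 1) ^ j) * (a 1 ^ j / of_nat j)" for j
      by (cases "even j") (auto simp: a_def)
    thus ?thesis by (simp add: F_def algebra_simps)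
  qed
  also have "Ln (- \<i> * a (- 1)) = Ln (of_real R) + \<i> * of_real pi / 2"
    using Ln_times_of_real[OF \<open>0 < R\<close>, of "\<i>"] Ln_of_real[OF \<open>0 < R\<close>] by (simp add: a_def mult.commute)
  also have "Ln (- \<i> * a 1) = Ln (of_real R) - \<i> * of_real pi / 2"
    using Ln_minus_ii Ln_times_of_real[OF \<open>0 < R\<close>, of "- \<i>"] Ln_of_real[OF \<open>0 < R\<close>] by (simp add: a_def mult.commute)
  finally show ?thesis by (simp add: algebra_simps)
qed

text \<open>Cauchy's theorem between the arches of size 2 r and R: the outer one tends to 2 pi i
  \<alpha>(m - 3), and the inner one is an error that only grows geometrically in m. The limit c is
  the difference of the two.\<close>

lemma moment_formula:
  fixes U W :: "complex \<Rightarrow> complex" and \<alpha> :: "nat \<Rightarrow> complex"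
  assumes r: "0 < r"
    and U: "\<And>z. z \<in> upper_domain r \<Longrightarrow> U field_differentiable at z"
    and W: "\<And>z. z \<in> upper_domain r \<Longrightarrow> W field_differentiable at z"
    and B: "\<And>z. z \<in> upper_domain r \<Longrightarrow> norm (U z) \<le> B \<and> norm (W z) \<le> B"
    and asym: "\<And>N. \<exists>C r'. \<forall>z\<in>upper_domain r'.
       norm (U z - (\<Sum>k<N. \<alpha> k / z ^ (k + 4))) \<le> C / norm z ^ (N + 4) \<and>
       norm (W z - (\<Sum>k<N. (- 1) ^ k * \<alpha> k / z ^ (k + 4))) \<le> C / norm z ^ (N + 4)"
    and m: "3 \<le> m"
  shows "\<exists>c. ((\<lambda>R. integral {2 * r..R} (\<lambda>y. of_real (y ^ m) *
      ((- 1) ^ Suc m * (W (of_real y) - U (- of_real y)) + (U (of_real y) - W (- of_real y))))) \<longlongrightarrow> c) at_top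
    \<and> norm (c - (- 2 * of_real pi * \<i> * \<alpha> (m - 3))) \<le> 16 * B * r * (2 * r) ^ m"
proof -
  \<comment> \<open>The sign is chosen so that the powers of z that grow along the arch all
    integrate to zero, while the two terms in 1/z add up instead of cancelling.\<close>
  define H where "H z = z ^ m * (U z + (- 1) ^ Suc m * W z)" for z
  define n where "n = m - 3"
  have mn: "m = n + 3" using m by (simp add: n_def)
  define L where "L = (\<lambda>z. 2 * \<alpha> n / z + (\<Sum>j=1..n. \<alpha> (n - j) * (1 + (- 1) ^ j) * z ^ (j - 1)))"
  have L_eq: "z ^ m * ((\<Sum>k<Suc n. \<alpha> k / z ^ (k + 4)) + (- 1) ^ Suc m * (\<Sum>k<Suc n. (- 1) ^ k * \<alpha> k / z ^ (k + 4))) = L z"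
    if z: "z \<noteq> 0" for z
  proof -
    have "z ^ m * ((\<Sum>k<Suc n. \<alpha> k / z ^ (k + 4)) + (- 1) ^ Suc m * (\<Sum>k<Suc n. (- 1) ^ k * \<alpha> k / z ^ (k + 4)))
       = (\<Sum>k<Suc n. z ^ m * (\<alpha> k / z ^ (k + 4) + (- 1) ^ Suc m * ((- 1) ^ k * \<alpha> k / z ^ (k + 4))))"
      by (simp only: sum_distrib_left sum.distrib distrib_left)
    also have "\<dots> = (\<Sum>j<Suc n. z ^ m * (\<alpha> (n - j) / z ^ (n - j + 4) + (- 1) ^ Suc m * ((- 1) ^ (n - j) * \<alpha> (n - j) / z ^ (n - j + 4))))"
      by (subst sum.nat_diff_reindex[symmetric]) simp
    also have "\<dots> = (\<Sum>j<Suc n. \<alpha> (n - j) * (1 + (- 1) ^ j) * (z ^ j / z))"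
    proof (rule sum.cong[OF refl])
      fix j assume "j \<in> {..<Suc n}"
      then obtain i where n: "n = i + j" by (metis add.commute le_Suc_ex lessThan_iff less_Suc_eq_le)
      have s: "(- 1 :: complex) ^ Suc m * (- 1) ^ i = (- 1) ^ j"
      proof -
        have "Suc m + i = 2 * (i + 2) + j" by (simp add: mn n)
        hence "(- 1 :: complex) ^ (Suc m + i) = (- 1) ^ (2 * (i + 2) + j)" by (simp only:)
        thus ?thesis by (simp only: power_add power_mult) simp
      qed
      have q: "z ^ m / z ^ (i + 4) = z ^ j / z"
        using z by (simp add: mn n power_add field_simps eval_nat_numeral)
      have "z ^ m * (a / z ^ (i + 4) + (- 1) ^ Suc m * ((- 1) ^ i * a / z ^ (i + 4))) =
          a * (1 + (- 1) ^ Suc m * (- 1) ^ i) * (z ^ m / z ^ (i + 4))" for a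
        by (simp add: divide_inverse algebra_simps)
      thus "z ^ m * (\<alpha> (n - j) / z ^ (n - j + 4) + (- 1) ^ Suc m * ((- 1) ^ (n - j) * \<alpha> (n - j) / z ^ (n - j + 4)))
          = \<alpha> (n - j) * (1 + (- 1) ^ j) * (z ^ j / z)"
        unfolding s q n by simp
    qed
    also have "\<dots> = (\<Sum>j\<in>insert 0 {1..n}. \<alpha> (n - j) * (1 + (- 1) ^ j) * (z ^ j / z))"
      by (rule sum.cong) auto
    also have "\<dots> =
        2 * \<alpha> n / z + (\<Sum>j=1..n. \<alpha> (n - j) * (1 + (- 1) ^ j) * (z ^ j / z))"
      by simp
    also have "(\<Sum>j=1..n. \<alpha> (n - j) * (1 + (- 1) ^ j) * (z ^ j / z)) = (\<Sum>j=1..n. \<alpha> (n - j) * (1 + (- 1) ^ j) * z ^ (j - 1))"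
      using z by (intro sum.cong refl) (auto simp: power_eq_if)
    finally show ?thesis by (simp only: L_def)
  qed
  obtain C r' where C: "\<And>z. z \<in> upper_domain r' \<Longrightarrow>
       norm (U z - (\<Sum>k<Suc n. \<alpha> k / z ^ (k + 4))) \<le> C / norm z ^ (Suc n + 4) \<and>
       norm (W z - (\<Sum>k<Suc n. (- 1) ^ k * \<alpha> k / z ^ (k + 4))) \<le> C / norm z ^ (Suc n + 4)"
    using asym[of "Suc n"] by blast
  have rem: "norm (H z - L z) \<le> 2 * \<bar>C\<bar> / norm z ^ 2" if z: "z \<in> upper_domain r'" "z \<noteq> 0" for z
  proof -
    define A where "A = (\<Sum>k<Suc n. \<alpha> k / z ^ (k + 4))"
    define A' where "A' = (\<Sum>k<Suc n. (- 1) ^ k * \<alpha> k / z ^ (k + 4))"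
    have "H z - L z = z ^ m * ((U z - A) + (- 1) ^ Suc m * (W z - A'))"
      unfolding L_eq[OF z(2), symmetric] H_def A_def A'_def by (simp only: algebra_simps)
    also have "norm \<dots> \<le> norm z ^ m * (norm (U z - A) + norm (W z - A'))"
      using norm_triangle_ineq[of "U z - A" "(- 1) ^ Suc m * (W z - A')"]
      by (simp add: norm_mult norm_power mult_left_mono)
    also have "\<dots> \<le> norm z ^ m * (\<bar>C\<bar> / norm z ^ (Suc n + 4) + \<bar>C\<bar> / norm z ^ (Suc n + 4))"
    proof -
      have "C / norm z ^ (Suc n + 4) \<le> \<bar>C\<bar> / norm z ^ (Suc n + 4)" by (intro divide_right_mono) auto
      thus ?thesis using C[OF z(1)] unfolding A_def A'_def
        by (intro mult_left_mono add_mono) (auto intro: order_trans simp del: sum.lessThan_Suc)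
    qed
    also have "\<dots> = 2 * \<bar>C\<bar> * (norm z ^ m / norm z ^ (Suc n + 4))" by simp
    also have "norm z ^ m / norm z ^ (Suc n + 4) = 1 / norm z ^ 2"
      using z(2) by (simp add: mn power_add field_simps eval_nat_numeral)
    finally show ?thesis by simp
  qed
  have dH: "H field_differentiable at z" if "z \<in> upper_domain r" for z
    unfolding H_def
    by (intro field_differentiable_mult field_differentiable_add field_differentiable_power
        field_differentiable_ident field_differentiable_const U W that)
  have cH: "continuous_on {z. 0 \<le> Im z \<and> R / 2 \<le> norm z} H" if "2 * r \<le> R" for R
    using that dH by (intro continuous_at_imp_continuous_on ballI field_differentiable_imp_continuous_at)
      (auto simp: upper_domain_def)
  have cL: "continuous_on {z. 0 \<le> Im z \<and> R / 2 \<le> norm z} L" if "0 < R" for R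
    unfolding L_def using that by (intro continuous_intros) auto
  have dec: "integral {2 * r..R} (\<lambda>y. of_real (y ^ m) *
      ((- 1) ^ Suc m * (W (of_real y) - U (- of_real y)) + (U (of_real y) - W (- of_real y)))) = arch H (2 * r) - arch H R"
    if "2 * r \<le> R" for R
  proof -
    \<comment> \<open>The four boundary values regroup into two jumps between opposite rays: W(y) -
      U(-y), which carries the Stokes constant, and U(y) - W(-y).\<close>
    have "H (of_real y) + H (- of_real y) = of_real (y ^ m) *
      ((- 1) ^ Suc m * (W (of_real y) - U (- of_real y)) + (U (of_real y) - W (- of_real y)))" for y
    proof -
      have p: "(- of_real y :: complex) ^ m = (- 1) ^ m * of_real y ^ m" by (rule power_minus)
      show ?thesis
        unfolding H_def p by (cases "even m") (simp_all add: algebra_simps)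
    qed
    thus ?thesis using arch_decomposition[OF dH r order_refl that] by simp
  qed
  have "((\<lambda>R. 2 * of_real pi * \<i> * \<alpha> n - arch H R) \<longlongrightarrow> 0) at_top"
  proof (rule Lim_null_comparison)
    show "((\<lambda>R. 32 * \<bar>C\<bar> / R) \<longlongrightarrow> 0) at_top"
      by (rule tendsto_divide_0[OF tendsto_const filterlim_at_top_imp_at_infinity[OF filterlim_ident]])
    show "eventually (\<lambda>R. norm (2 * of_real pi * \<i> * \<alpha> n - arch H R) \<le> 32 * \<bar>C\<bar> / R) at_top"
      using eventually_ge_at_top[of "max (2 * r) (2 * r')"]
    proof eventually_elim
      case (elim R)
      have R: "0 < R" "2 * r \<le> R" "2 * r' \<le> R" using elim r by auto
      \<comment> \<open>On the arch |z| \<ge> R/2, so the remainder is at most 8 |C| / R^2; the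
        length is at most 4 R, and the product tends to 0.\<close>
      have "norm (arch (\<lambda>z. H z - L z) R) \<le> 4 * (8 * \<bar>C\<bar> / R ^ 2) * R"
      proof (rule arch_bound)
        fix z assume z: "0 \<le> Im z" "R / 2 \<le> norm z"
        have "z \<in> upper_domain r'" "z \<noteq> 0" using z R by (auto simp: upper_domain_def)
        hence "norm (H z - L z) \<le> 2 * \<bar>C\<bar> / norm z ^ 2" by (rule rem)
        also have "\<dots> \<le> 2 * \<bar>C\<bar> / (R / 2) ^ 2"
          using z R by (intro divide_left_mono power_mono mult_pos_pos) (auto intro!: zero_less_power)
        finally show "norm (H z - L z) \<le> 8 * \<bar>C\<bar> / R ^ 2" by (simp add: power_divide)
      qed (use R cH cL in \<open>auto intro!: continuous_on_diff\<close>)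
      also have "\<dots> = 32 * \<bar>C\<bar> / R" using R by (simp add: power2_eq_square)
      finally show ?case
        using arch_diff[OF cH[OF R(2)] cL[OF R(1)] R(1)] arch_laurent_part[OF R(1), of "\<alpha> n" "\<lambda>j. \<alpha> (n - j)" n]
        by (simp add: L_def norm_minus_commute)
    qed
  qed
  from tendsto_add[OF tendsto_const[of "arch H (2 * r) - 2 * of_real pi * \<i> * \<alpha> n"] this]
  have "((\<lambda>R. arch H (2 * r) - arch H R) \<longlongrightarrow> arch H (2 * r) - 2 * of_real pi * \<i> * \<alpha> n) at_top"
    by simp
  hence lim: "((\<lambda>R. integral {2 * r..R} (\<lambda>y. of_real (y ^ m) *
      ((- 1) ^ Suc m * (W (of_real y) - U (- of_real y)) + (U (of_real y) - W (- of_real y))))) \<longlongrightarrow>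
      arch H (2 * r) - 2 * of_real pi * \<i> * \<alpha> n) at_top"
  proof (rule Lim_transform_eventually)
    show "eventually (\<lambda>R. arch H (2 * r) - arch H R = integral {2 * r..R} (\<lambda>y. of_real (y ^ m) *
      ((- 1) ^ Suc m * (W (of_real y) - U (- of_real y)) + (U (of_real y) - W (- of_real y))))) at_top"
      using eventually_ge_at_top[of "2 * r"] by eventually_elim (simp only: dec)
  qed
  have "of_real r \<in> upper_domain r" using r by (simp add: upper_domain_def)
  hence B0: "0 \<le> B" using B norm_ge_zero order_trans by blast
  have "norm (arch H (2 * r)) \<le> 4 * ((2 * r) ^ m * (2 * B)) * (2 * r)"
  proof (rule arch_bound)
    fix z assume z: "0 \<le> Im z" "2 * r / 2 \<le> norm z" "norm z \<le> 2 * r"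
    have Bz: "norm (U z) \<le> B" "norm (W z) \<le> B" using B[of z] z by (auto simp: upper_domain_def)
    have "norm (U z + (- 1) ^ Suc m * W z) \<le> norm (U z) + norm ((- 1) ^ Suc m * W z)"
      by (rule norm_triangle_ineq)
    also have "\<dots> \<le> 2 * B" using Bz by (simp add: norm_mult norm_power)
    finally show "norm (H z) \<le> (2 * r) ^ m * (2 * B)"
      unfolding H_def norm_mult norm_power using z r by (intro mult_mono power_mono) auto
  qed (use r B0 cH[of "2 * r"] in auto)
  hence "norm ((arch H (2 * r) - 2 * of_real pi * \<i> * \<alpha> n) - (- 2 * of_real pi * \<i> * \<alpha> (m - 3))) \<le> 16 * B * r * (2 * r) ^ m"
    by (simp add: n_def mult_ac)
  with lim show ?thesis by blast
qed

text \<open>A bounded solution has no component along the growing direction \<open>exp y\<close>, so it is driven by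
  \<open>J\<close> alone and inherits its decay with the extra factor \<open>L / y\<^sup>4\<close>.\<close>

lemma unstable_component_negligible:
  fixes K J k :: "real \<Rightarrow> complex"
  assumes der: "\<And>y. r \<le> y \<Longrightarrow> (K has_vector_derivative K y + k y) (at y)"
    and k: "\<And>y. r \<le> y \<Longrightarrow> norm (k y) \<le> L / y ^ 4 * (norm (K y) + norm (J y))"
    and J: "\<And>y. r \<le> y \<Longrightarrow> norm (J y) \<le> C * exp (- y)"
    and K: "\<And>y. r \<le> y \<Longrightarrow> norm (K y) \<le> B"
    and r: "1 \<le> r" and nonneg: "0 \<le> L" "0 \<le> C" "0 \<le> B"
  shows "((\<lambda>y. exp y *\<^sub>R K y) \<longlongrightarrow> 0) at_top"
proof -
  have main: "norm (exp y *\<^sub>R K y) \<le> \<delta> * C"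
    if \<delta>: "0 < \<delta>" "\<delta> \<le> 1 / 2" and y: "max r (L / \<delta>) \<le> y" for \<delta> y
  proof -
    define Y where "Y = max r (L / \<delta>)"
    have small: "L / t ^ 4 \<le> \<delta>" if "Y \<le> t" for t
    proof -
      have t: "1 \<le> t" "L / \<delta> \<le> t" using that r by (auto simp: Y_def)
      have "L \<le> \<delta> * t" using t \<delta> by (simp add: field_simps)
      also have "\<dots> \<le> \<delta> * t ^ 4"
        using t \<delta> power_increasing[of 1 4 t] by (intro mult_left_mono) auto
      finally show ?thesis using t by (simp add: divide_le_eq)
    qed
    \<comment> \<open>Starting from boundedness, each pass multiplies the constant part by \<delta>
      and reproduces the exponential part; only the latter survives as i grows.\<close>
    have it: "norm (K t) \<le> \<delta> ^ i * B + \<delta> * C * exp (- t)" if "Y \<le> t" for i t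
      using that
    proof (induction i arbitrary: t)
      case 0
      have "r \<le> t" using 0 by (simp add: Y_def)
      thus ?case using K[of t] \<delta> nonneg by (simp add: add_increasing2)
    next
      case (Suc i)
      define b where "b = \<delta> ^ i * B"
      have b: "0 \<le> b" using \<delta> nonneg by (simp add: b_def)
      \<comment> \<open>This removes the homogeneous growth of K. Since K is bounded, h vanishes at
        infinity and may be integrated from there back to t.\<close>
      define h where "h = (\<lambda>x::real. exp (- x) *\<^sub>R K x)"
      define g where "g = (\<lambda>x. - \<delta> * (b * exp (- x) + C * exp (- x) ^ 2))"
      have dh: "(h has_vector_derivative exp (- x) *\<^sub>R k x) (at x)" if "t \<le> x" for x
      proof -
        have rx: "r \<le> x" using that Suc.prems by (simp add: Y_def)
        have "((\<lambda>x. exp (- x)) has_real_derivative - exp (- x)) (at x)"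
          by (auto intro!: derivative_eq_intros)
        from has_vector_derivative_scaleR[OF this der[OF rx]]
        show ?thesis by (simp add: h_def algebra_simps)
      qed
      have dg: "(g has_vector_derivative \<delta> * (b * exp (- x) + 2 * C * exp (- x) ^ 2)) (at x)" for x
      proof -
        have "(g has_real_derivative \<delta> * (b * exp (- x) + 2 * C * exp (- x) ^ 2)) (at x)"
          unfolding g_def by (auto intro!: derivative_eq_intros simp: algebra_simps power2_eq_square)
        thus ?thesis by (simp add: has_real_derivative_iff_has_vector_derivative)
      qed
      have bd: "norm (exp (- x) *\<^sub>R k x) \<le> \<delta> * (b * exp (- x) + 2 * C * exp (- x) ^ 2)" if "t \<le> x" for x
      proof -
        have x: "r \<le> x" "Y \<le> x" using that Suc.prems by (auto simp: Y_def)
        have "norm (k x) \<le> \<delta> * (norm (K x) + norm (J x))"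
          using k[OF x(1)] small[OF x(2)] by (rule order_trans[OF _ mult_right_mono]) auto
        also have "\<dots> \<le> \<delta> * ((b + \<delta> * C * exp (- x)) + C * exp (- x))"
          using Suc.IH[OF x(2)] J[OF x(1)] \<delta> unfolding b_def by (intro mult_left_mono add_mono) auto
        \<comment> \<open>Weakening \<delta> C to C makes the coefficient 2 C, exactly what the
          derivative of \<open>exp (- x) ^ 2\<close> in g provides; after integration C is back and
          the bound closes up.\<close>
        also have "\<dots> \<le> \<delta> * ((b + C * exp (- x)) + C * exp (- x))"
        proof -
          have "\<delta> * (C * exp (- x)) \<le> 1 * (C * exp (- x))"
            using \<delta> nonneg by (intro mult_right_mono) auto
          thus ?thesis using \<delta> by (intro mult_left_mono) auto
        qed
        finally have "exp (- x) * norm (k x) \<le> exp (- x) * (\<delta> * ((b + C * exp (- x)) + C * exp (- x)))"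
          by (intro mult_left_mono) auto
        thus ?thesis by (simp add: algebra_simps power2_eq_square)
      qed
      have fin: "norm (h t) \<le> - g t + B * exp (- T)" if "t < T" for T
      proof -
        have "norm (h T - h t) \<le> g T - g t"
          using that by (intro differentiable_bound_general[where f'="\<lambda>x. exp (- x) *\<^sub>R k x"
                and \<phi>'="\<lambda>x. \<delta> * (b * exp (- x) + 2 * C * exp (- x) ^ 2)"]
              continuous_at_imp_continuous_on ballI dh dg bd)
            (auto intro: has_vector_derivative_continuous dh dg)
        moreover have "g T \<le> 0" using \<delta> b nonneg by (simp add: g_def)
        moreover have "norm (h T) \<le> B * exp (- T)"
          using K[of T] that Suc.prems by (simp add: h_def Y_def mult.commute)
        moreover have "norm (h t) \<le> norm (h T) + norm (h T - h t)"
          by (metis norm_minus_commute norm_triangle_sub)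
        ultimately show ?thesis by simp
      qed
      have "((\<lambda>T. - g t + B * exp (- T)) \<longlongrightarrow> - g t + B * 0) at_top"
        by (intro tendsto_intros filterlim_compose[OF exp_at_bot] filterlim_uminus_at_bot_at_top)
      moreover have "eventually (\<lambda>T. norm (h t) \<le> - g t + B * exp (- T)) at_top"
        using eventually_gt_at_top[of t] by eventually_elim (rule fin)
      ultimately have "norm (h t) \<le> - g t + B * 0"
        by (intro tendsto_lowerbound) auto
      hence "exp t * norm (h t) \<le> exp t * (\<delta> * (b * exp (- t) + C * exp (- t) ^ 2))"
        by (intro mult_left_mono) (auto simp: g_def)
      moreover have "exp t * norm (h t) = norm (K t)" by (simp add: h_def exp_minus)
      moreover have "exp t * (\<delta> * (b * exp (- t) + C * exp (- t) ^ 2)) = \<delta> * b + \<delta> * C * exp (- t)"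
        by (simp add: power2_eq_square exp_minus field_simps)
      ultimately show ?case by (simp add: b_def mult_ac)
    qed
    have "(\<lambda>i. \<delta> ^ i * B + \<delta> * C * exp (- y)) \<longlonglongrightarrow> 0 * B + \<delta> * C * exp (- y)"
      using \<delta> by (intro tendsto_intros LIMSEQ_power_zero) auto
    hence "norm (K y) \<le> 0 * B + \<delta> * C * exp (- y)"
      using it[of y] y by (intro LIMSEQ_le_const) (auto simp: Y_def)
    thus ?thesis by (simp add: exp_minus field_simps)
  qed
  show ?thesis
  proof (rule tendstoI)
    fix e :: real assume e: "0 < e"
    define \<delta> where "\<delta> = min (1 / 2) (e / (C + 1))"
    have \<delta>: "0 < \<delta>" "\<delta> \<le> 1 / 2" using e nonneg by (auto simp: \<delta>_def min_def)
    have "\<delta> * C < e"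
    proof -
      have "\<delta> * C < \<delta> * (C + 1)" using \<delta> by simp
      also have "\<dots> \<le> e / (C + 1) * (C + 1)" using nonneg by (intro mult_right_mono) (auto simp: \<delta>_def)
      also have "\<dots> = e" using nonneg by simp
      finally show ?thesis .
    qed
    thus "eventually (\<lambda>y. dist (exp y *\<^sub>R K y) 0 < e) at_top"
      using eventually_ge_at_top[of "max r (L / \<delta>)"]
      by (elim eventually_mono) (use main[OF \<delta>] in \<open>force simp: dist_norm\<close>)
  qed
qed

section \<open>Incomplete gamma functions and recovery of the exponential rate\<close>

definition exp_tail :: "nat \<Rightarrow> real \<Rightarrow> real" where
  "exp_tail m y = exp (- y) * (\<Sum>k\<le>m. y ^ k / fact k)"

text \<open>The derivatives of the summands telescope. Hence \<open>exp_tail m\<close> is the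
  regularised upper incomplete gamma function Q(m + 1, y), and \<open>fact m * exp_tail m r\<close>
  is the part of the m-th exponential moment beyond r.\<close>

lemma exp_tail_deriv: "(exp_tail m has_real_derivative - (exp (- y) * y ^ m / fact m)) (at y)"
proof (induction m)
  case 0
  show ?case unfolding exp_tail_def by (auto intro!: derivative_eq_intros)
next
  case (Suc m)
  have eq: "exp_tail (Suc m) = (\<lambda>y. exp_tail m y + exp (- y) * y ^ Suc m / fact (Suc m))"
    by (auto simp: exp_tail_def algebra_simps)
  have "((\<lambda>y. exp (- y) * y ^ Suc m / fact (Suc m)) has_real_derivative
      exp (- y) * y ^ m / fact m - exp (- y) * y ^ Suc m / fact (Suc m)) (at y)"
    by (auto intro!: derivative_eq_intros simp del: power_Suc fact_Suc) (simp add: diff_divide_distrib fact_Suc)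
  from DERIV_add[OF Suc this] show ?case unfolding eq by simp
qed

lemma exp_tail_bounds:
  assumes "0 \<le> y" shows "0 \<le> exp_tail m y" "exp_tail m y \<le> 1"
proof -
  show "0 \<le> exp_tail m y" using assms by (auto simp: exp_tail_def intro!: mult_nonneg_nonneg sum_nonneg)
  have "(\<Sum>k\<le>m. y ^ k / fact k) \<le> exp y"
  proof -
    have "(\<Sum>k\<in>{..m}. y ^ k /\<^sub>R fact k) \<le> (\<Sum>k. y ^ k /\<^sub>R fact k)"
      using assms by (intro sum_le_suminf summable_exp_generic) auto
    thus ?thesis by (simp add: exp_def divide_inverse mult.commute)
  qed
  hence "exp (- y) * (\<Sum>k\<le>m. y ^ k / fact k) \<le> exp (- y) * exp y" by (intro mult_left_mono) auto
  thus "exp_tail m y \<le> 1" by (simp add: exp_tail_def flip: exp_add)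
qed

lemma exp_tail_lim_index: "(\<lambda>m. exp_tail m y) \<longlonglongrightarrow> 1"
proof -
  have "(\<lambda>k. y ^ k /\<^sub>R fact k) sums exp y" by (rule exp_converges)
  hence "(\<lambda>m. \<Sum>k\<le>m. y ^ k / fact k) \<longlonglongrightarrow> exp y"
    by (simp add: sums_def_le divide_inverse mult.commute)
  hence "(\<lambda>m. exp_tail m y) \<longlonglongrightarrow> exp (- y) * exp y"
    unfolding exp_tail_def by (intro tendsto_intros)
  thus ?thesis by (simp flip: exp_add)
qed

lemma exp_tail_lim_at_top: "(exp_tail m \<longlongrightarrow> 0) at_top"
proof -
  have "((\<lambda>y::real. \<Sum>k\<le>m. (y ^ k / exp y) / fact k) \<longlongrightarrow> (\<Sum>k\<le>m. 0 / fact k)) at_top"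
    by (intro tendsto_sum tendsto_divide tendsto_power_div_exp_0 tendsto_const) auto
  moreover have "(\<Sum>k\<le>m. (y ^ k / exp y) / fact k) = exp_tail m y" for y
    by (simp add: exp_tail_def exp_minus sum_distrib_left divide_simps)
  ultimately show ?thesis by simp
qed

lemma exp_moment_integral:
  assumes "r \<le> R"
  shows "((\<lambda>y. y ^ m * exp (- y)) has_integral fact m * (exp_tail m r - exp_tail m R)) {r..R}"
proof -
  have "((\<lambda>y. - (exp (- y) * y ^ m / fact m)) has_integral exp_tail m R - exp_tail m r) {r..R}"
    by (intro fundamental_theorem_of_calculus assms)
      (metis exp_tail_deriv has_real_derivative_iff_has_vector_derivative has_vector_derivative_at_within)
  from has_integral_mult_right[OF this, of "- fact m"] show ?thesis
    by (simp add: algebra_simps)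
qed

text \<open>After division by m!, the profile \<theta> exp (- y) contributes \<theta>. The rest is
  o(exp (- y)) at infinity and contributes at most a small multiple of m!. Compact intervals and the
  error \<open>B * r ^ m\<close> contribute powers of fixed bases, which m! defeats.\<close>

lemma moments_determine_exponential_rate:
  fixes J K :: "real \<Rightarrow> complex" and a c :: "nat \<Rightarrow> complex"
  assumes r: "0 < r" and cont: "continuous_on {r..} J" "continuous_on {r..} K"
    and J: "((\<lambda>y. exp y *\<^sub>R J y) \<longlongrightarrow> \<theta>) at_top" and K: "((\<lambda>y. exp y *\<^sub>R K y) \<longlongrightarrow> 0) at_top"
    and moments: "\<And>m. m0 \<le> m \<Longrightarrow>
      ((\<lambda>R. integral {r..R} (\<lambda>y. of_real (y ^ m) * ((- 1) ^ Suc m * J y + K y))) \<longlongrightarrow> c m) at_top"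
    and ca: "\<And>m. m0 \<le> m \<Longrightarrow> norm (c m - a m) \<le> B * r ^ m"
  shows "(\<lambda>m. (- 1) ^ Suc m * a m / fact m) \<longlonglongrightarrow> \<theta>"
proof (rule LIMSEQ_I)
  fix e :: real assume "0 < e"
  define \<epsilon> where "\<epsilon> = e / 4"
  have \<epsilon>: "0 < \<epsilon>" using \<open>0 < e\<close> by (simp add: \<epsilon>_def)
  have "eventually (\<lambda>y. dist (exp y *\<^sub>R J y) \<theta> < \<epsilon> \<and> dist (exp y *\<^sub>R K y) 0 < \<epsilon>) at_top"
    using tendstoD[OF J \<epsilon>] tendstoD[OF K \<epsilon>] by eventually_elim simp
  then obtain Y0 where Y0: "\<And>y. Y0 \<le> y \<Longrightarrow> dist (exp y *\<^sub>R J y) \<theta> < \<epsilon> \<and> dist (exp y *\<^sub>R K y) 0 < \<epsilon>"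
    unfolding eventually_at_top_linorder by blast
  define Y where "Y = max r Y0"
  have Y: "r \<le> Y" "0 < Y" using r by (auto simp: Y_def)
  obtain bJ where bJ: "\<And>y. y \<in> {r..Y} \<Longrightarrow> norm (J y) \<le> bJ"
    using compact_imp_bounded[OF compact_continuous_image[OF continuous_on_subset[OF cont(1)], of "{r..Y}"]]
    unfolding bounded_iff by fastforce
  obtain bK where bK: "\<And>y. y \<in> {r..Y} \<Longrightarrow> norm (K y) \<le> bK"
    using compact_imp_bounded[OF compact_continuous_image[OF continuous_on_subset[OF cont(2)], of "{r..Y}"]]
    unfolding bounded_iff by fastforce
  define b where "b = bJ + bK + norm \<theta>"
  have b: "0 \<le> b"
    using order_trans[OF norm_ge_zero bJ[of r]] order_trans[OF norm_ge_zero bK[of r]] Y by (simp add: b_def)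
  \<comment> \<open>Deviation of the integrand, without its factor \<open>y ^ m\<close>, from the
    pure exponential profile.\<close>
  define d where "d m y = (- 1) ^ Suc m * J y + K y - (- 1) ^ Suc m * \<theta> * of_real (exp (- y))" for m :: nat and y
  have d_bound: "norm (of_real (y ^ m) * d m y) \<le> b * exp Y * Y ^ m * exp (- y) + 2 * \<epsilon> * (y ^ m * exp (- y))"
    if "r \<le> y" for y m
  proof (cases "y \<le> Y")
    case True
    have "norm (d m y) \<le> norm (J y) + norm (K y) + norm \<theta> * exp (- y)"
      unfolding d_def by (intro order_trans[OF norm_triangle_ineq4] add_mono order_trans[OF norm_triangle_ineq])
        (auto simp: norm_mult norm_power)
    also have "\<dots> \<le> bJ + bK + norm \<theta> * 1"
      using bJ[of y] bK[of y] that True r by (intro add_mono mult_left_mono) auto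
    finally have "norm (d m y) \<le> b" by (simp add: b_def)
    hence "norm (of_real (y ^ m) * d m y) \<le> Y ^ m * b"
      unfolding norm_mult norm_of_real using that True r b
      by (intro mult_mono) (auto intro: power_mono)
    \<comment> \<open>The factor is at least 1 for y \<le> Y. It makes the bound on the compact part
      integrable up to infinity, so that one majorant serves for all y \<ge> r.\<close>
    also have "\<dots> \<le> Y ^ m * b * exp (Y - y)"
      using mult_left_mono[of 1 "exp (Y - y)" "Y ^ m * b"] True Y b by simp
    also have "\<dots> = b * exp Y * Y ^ m * exp (- y)" by (simp add: exp_diff exp_minus field_simps)
    also have "\<dots> \<le> b * exp Y * Y ^ m * exp (- y) + 2 * \<epsilon> * (y ^ m * exp (- y))"
      using \<epsilon> that r by simp
    finally show ?thesis .
  next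
    case False
    hence y: "Y0 \<le> y" "0 < y" using Y by (auto simp: Y_def)
    have "exp y *\<^sub>R d m y = (- 1) ^ Suc m * (exp y *\<^sub>R J y - \<theta>) + exp y *\<^sub>R K y"
      unfolding d_def by (simp add: algebra_simps scaleR_conv_of_real flip: exp_add of_real_mult)
    hence "norm (exp y *\<^sub>R d m y) \<le> norm (exp y *\<^sub>R J y - \<theta>) + norm (exp y *\<^sub>R K y)"
      by (metis (no_types, lifting) mult_1 norm_minus_cancel norm_mult norm_one norm_power norm_triangle_ineq power_one)
    also have "\<dots> \<le> 2 * \<epsilon>" using Y0[OF y(1)] by (simp add: dist_norm)
    finally have "norm (d m y) \<le> 2 * \<epsilon> * exp (- y)" by (simp add: exp_minus field_simps)
    hence "norm (of_real (y ^ m) * d m y) \<le> y ^ m * (2 * \<epsilon> * exp (- y))"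
      unfolding norm_mult norm_of_real using y by (intro mult_mono) auto
    also have "\<dots> \<le> b * exp Y * Y ^ m * exp (- y) + 2 * \<epsilon> * (y ^ m * exp (- y))"
      using b Y by simp
    finally show ?thesis .
  qed
  have close: "norm ((- 1) ^ Suc m * a m / fact m - \<theta>)
      \<le> B * (r ^ m / fact m) + b * exp Y * (Y ^ m / fact m) + 2 * \<epsilon> + norm \<theta> * (1 - exp_tail m r)"
    if m: "m0 \<le> m" for m
  proof -
    have int: "(\<lambda>y. of_real (y ^ m) * ((- 1) ^ Suc m * J y + K y)) integrable_on {r..R}" for R
      by (intro integrable_continuous_interval continuous_intros continuous_on_subset[OF cont(1)] continuous_on_subset[OF cont(2)]) auto
    have em: "((\<lambda>y. of_real (y ^ m * exp (- y)) :: complex) has_integral of_real (fact m * (exp_tail m r - exp_tail m R))) {r..R}"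
      if "r \<le> R" for R
      using has_integral_of_real[OF exp_moment_integral[OF that]] .
    have di: "((\<lambda>y. of_real (y ^ m) * d m y) has_integral
       (integral {r..R} (\<lambda>y. of_real (y ^ m) * ((- 1) ^ Suc m * J y + K y)) -
        (- 1) ^ Suc m * \<theta> * of_real (fact m * (exp_tail m r - exp_tail m R)))) {r..R}" if "r \<le> R" for R
      using has_integral_diff[OF integrable_integral[OF int] has_integral_mult_right[OF em[OF that], of "(- 1) ^ Suc m * \<theta>"]]
      by (rule has_integral_eq[rotated]) (simp add: d_def algebra_simps)
    have le: "norm (integral {r..R} (\<lambda>y. of_real (y ^ m) * ((- 1) ^ Suc m * J y + K y)) -
        (- 1) ^ Suc m * \<theta> * of_real (fact m * (exp_tail m r - exp_tail m R))) \<le> b * exp Y * Y ^ m + 2 * \<epsilon> * fact m"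
      if R: "r \<le> R" for R
    proof -
      have g: "((\<lambda>y. b * exp Y * Y ^ m * exp (- y) + 2 * \<epsilon> * (y ^ m * exp (- y))) has_integral
         b * exp Y * Y ^ m * (exp_tail 0 r - exp_tail 0 R) + 2 * \<epsilon> * (fact m * (exp_tail m r - exp_tail m R))) {r..R}"
        using exp_moment_integral[OF R, of 0] exp_moment_integral[OF R, of m]
        by (intro has_integral_add has_integral_mult_right) auto
      have "norm (integral {r..R} (\<lambda>y. of_real (y ^ m) * ((- 1) ^ Suc m * J y + K y)) -
        (- 1) ^ Suc m * \<theta> * of_real (fact m * (exp_tail m r - exp_tail m R)))
         \<le> b * exp Y * Y ^ m * (exp_tail 0 r - exp_tail 0 R) + 2 * \<epsilon> * (fact m * (exp_tail m r - exp_tail m R))"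
        using integral_norm_bound_integral[OF has_integral_integrable[OF di[OF R]] has_integral_integrable[OF g]]
          integral_unique[OF di[OF R]] integral_unique[OF g] d_bound by auto
      also have "\<dots> \<le> b * exp Y * Y ^ m * 1 + 2 * \<epsilon> * (fact m * 1)"
        using exp_tail_bounds[of r] exp_tail_bounds[of R] r R b Y \<epsilon>
        by (intro add_mono mult_left_mono) (auto simp: algebra_simps intro: add_increasing2)
      finally show ?thesis by simp
    qed
    have "((\<lambda>R. norm (integral {r..R} (\<lambda>y. of_real (y ^ m) * ((- 1) ^ Suc m * J y + K y)) -
        (- 1) ^ Suc m * \<theta> * of_real (fact m * (exp_tail m r - exp_tail m R)))) \<longlongrightarrow>
       norm (c m - (- 1) ^ Suc m * \<theta> * of_real (fact m * (exp_tail m r - 0)))) at_top"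
      by (intro tendsto_intros moments m exp_tail_lim_at_top)
    moreover have "eventually (\<lambda>R. norm (integral {r..R} (\<lambda>y. of_real (y ^ m) * ((- 1) ^ Suc m * J y + K y)) -
        (- 1) ^ Suc m * \<theta> * of_real (fact m * (exp_tail m r - exp_tail m R))) \<le> b * exp Y * Y ^ m + 2 * \<epsilon> * fact m) at_top"
      using eventually_ge_at_top[of r] by eventually_elim (rule le)
    ultimately have "norm (c m - (- 1) ^ Suc m * \<theta> * of_real (fact m * (exp_tail m r - 0))) \<le> b * exp Y * Y ^ m + 2 * \<epsilon> * fact m"
      by (intro tendsto_upperbound) auto
    hence cm: "norm (c m - (- 1) ^ Suc m * \<theta> * of_real (fact m * exp_tail m r)) \<le> b * exp Y * Y ^ m + 2 * \<epsilon> * fact m"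
      by simp
    have "norm (a m - (- 1) ^ Suc m * \<theta> * fact m) \<le>
        norm (c m - a m) + norm (c m - (- 1) ^ Suc m * \<theta> * of_real (fact m * exp_tail m r))
        + norm ((- 1) ^ Suc m * \<theta> * of_real (fact m * (1 - exp_tail m r)))"
    proof -
      have "a m - (- 1) ^ Suc m * \<theta> * fact m = - (c m - a m) + (c m - (- 1) ^ Suc m * \<theta> * of_real (fact m * exp_tail m r))
        - (- 1) ^ Suc m * \<theta> * of_real (fact m * (1 - exp_tail m r))"
        by (simp add: algebra_simps)
      moreover have "norm (- p + q - s) \<le> norm p + norm q + norm s" for p q s :: complex
        using norm_triangle_ineq4[of "- p + q" s] norm_triangle_ineq[of "- p" q] by simp
      ultimately show ?thesis by presburger
    qed
    also have "\<dots> \<le> B * r ^ m + (b * exp Y * Y ^ m + 2 * \<epsilon> * fact m) + norm \<theta> * (fact m * (1 - exp_tail m r))"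
      using exp_tail_bounds[of r m] r
      by (intro add_mono ca m cm) (auto simp: norm_mult norm_power simp del: of_real_mult of_real_diff)
    finally have "norm (a m - (- 1) ^ Suc m * \<theta> * fact m) / fact m \<le>
        (B * r ^ m + (b * exp Y * Y ^ m + 2 * \<epsilon> * fact m) + norm \<theta> * (fact m * (1 - exp_tail m r))) / fact m"
      by (intro divide_right_mono) auto
    moreover have "norm ((- 1) ^ Suc m * a m / fact m - \<theta>) = norm (a m - (- 1) ^ Suc m * \<theta> * fact m) / fact m"
    proof -
      have "(- 1) ^ Suc m * a m / fact m - \<theta> = (- 1) ^ Suc m * ((a m - (- 1) ^ Suc m * \<theta> * fact m) / fact m)"
        by (simp add: field_simps flip: power_mult_distrib)
      thus ?thesis by (simp add: norm_mult norm_power norm_divide)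
    qed
    ultimately show ?thesis by (simp add: add_divide_distrib)
  qed
  have pf: "(\<lambda>m. x ^ m / fact m) \<longlonglongrightarrow> 0" for x :: real
    using summable_LIMSEQ_zero[OF summable_exp[of x]] by (simp add: divide_inverse mult.commute)
  have "(\<lambda>m. B * (r ^ m / fact m) + b * exp Y * (Y ^ m / fact m) + 2 * \<epsilon> + norm \<theta> * (1 - exp_tail m r))
      \<longlonglongrightarrow> B * 0 + b * exp Y * 0 + 2 * \<epsilon> + norm \<theta> * (1 - 1)"
    by (intro tendsto_intros exp_tail_lim_index pf)
  hence "eventually (\<lambda>m. B * (r ^ m / fact m) + b * exp Y * (Y ^ m / fact m) + 2 * \<epsilon> + norm \<theta> * (1 - exp_tail m r) < e) sequentially"
    by (rule order_tendstoD) (use \<epsilon> in \<open>simp add: \<epsilon>_def\<close>)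
  hence "eventually (\<lambda>m. norm ((- 1) ^ Suc m * a m / fact m - \<theta>) < e) sequentially"
    using eventually_ge_at_top[of m0] by eventually_elim (use close in force)
  thus "\<exists>n0. \<forall>m\<ge>n0. norm ((- 1) ^ Suc m * a m / fact m - \<theta>) < e"
    by (simp add: eventually_sequentially)
qed

section \<open>The Stokes constant\<close>

lemma inner_sol_deriv:
  assumes "inner_approx_sol n 0 r U W" "z \<in> upper_domain r"
  shows "(U has_field_derivative inner_field1 z (U z) (W z)) (at z)"
    and "(W has_field_derivative inner_field2 z (U z) (W z)) (at z)"
proof -
  from assms(1) obtain R1 R2 where R: "\<forall>z\<in>upper_domain r.
     (U has_field_derivative inner_field1 z (U z) (W z) + R1 z) (at z) \<and>
     (W has_field_derivative inner_field2 z (U z) (W z) + R2 z) (at z) \<and>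
     norm (R1 z) \<le> 0 / norm z ^ n \<and> norm (R2 z) \<le> 0 / norm z ^ n"
    unfolding inner_approx_sol_def by blast
  from R[rule_format, OF assms(2)] have "R1 z = 0" "R2 z = 0" by simp_all
  with R[rule_format, OF assms(2)]
  show "(U has_field_derivative inner_field1 z (U z) (W z)) (at z)"
    "(W has_field_derivative inner_field2 z (U z) (W z)) (at z)" by simp_all
qed

text \<open>It follows that y \<mapsto> (W(-y), U(-y)) satisfies the same system on the positive
  axis as y \<mapsto> (U(y), W(y)). The two jumps are therefore the components of a difference of
  two solutions, one growing and one decaying at the linear level.\<close>

lemma inner_field2_uminus: "inner_field2 (- z) u w = - inner_field1 z w u"
  by (simp add: inner_field1_def inner_field2_def)

lemma exp_rate_bound:
  fixes J :: "real \<Rightarrow> complex"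
  assumes "((\<lambda>y. exp y *\<^sub>R J y) \<longlongrightarrow> l) at_top"
  shows "\<exists>y0. \<forall>y\<ge>y0. norm (J y) \<le> (norm l + 1) * exp (- y)"
proof -
  have "norm (J y) \<le> (norm l + 1) * exp (- y)" if "dist (exp y *\<^sub>R J y) l < 1" for y
  proof -
    have "norm (exp y *\<^sub>R J y) \<le> norm l + 1"
      using norm_triangle_sub[of "exp y *\<^sub>R J y" l] that by (simp add: dist_norm)
    thus ?thesis by (simp add: exp_minus field_simps)
  qed
  hence "eventually (\<lambda>y. norm (J y) \<le> (norm l + 1) * exp (- y)) at_top"
    by (rule eventually_mono[OF tendstoD[OF assms zero_less_one]])
  thus ?thesis by (rule eventually_at_top_linorder[THEN iffD1])
qed

text \<open>The assumed limit fixes the rate of the jump J. The other jump K lies along the growing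
  direction and is bounded, hence negligible, and the moments of both jumps are the coefficients.
  Comparing rates gives the limit of the normalised coefficients.\<close>

lemma stokes_jump_coeff_limit:
  assumes sol: "\<And>n. inner_approx_sol n 0 r U W" and r: "1 \<le> r" and M: "1 \<le> M"
    and wt: "weight4_bounded M r U" "weight4_bounded M r W"
    and lim: "((\<lambda>y. exp y *\<^sub>R (W (of_real y) - U (- of_real y))) \<longlongrightarrow> \<i> * \<Theta>) at_top"
  shows "norm_coeff \<longlonglongrightarrow> 3 * \<Theta> / of_real pi"
proof -
  define J where "J y = W (of_real y) - U (- of_real y)" for y :: real
  define K where "K y = U (of_real y) - W (- of_real y)" for y :: real
  define L where "L = 22 * M ^ 4"
  have L: "0 \<le> L" using M by (simp add: L_def)
  have up: "of_real y \<in> upper_domain r" "- of_real y \<in> upper_domain r" if "r \<le> y" for y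
    using that r by (auto simp: upper_domain_def)
  have bound: "norm (U z) \<le> M \<and> norm (W z) \<le> M" if z: "z \<in> upper_domain r" for z
  proof -
    have n1: "1 \<le> norm z ^ 4" using z r by (auto simp: upper_domain_def intro: one_le_power)
    have "norm u \<le> M" if "norm (z ^ 4 * u) \<le> M" for u
    proof -
      have "1 * norm u \<le> norm z ^ 4 * norm u" by (rule mult_right_mono[OF n1]) simp
      thus ?thesis using that by (simp add: norm_mult norm_power)
    qed
    thus ?thesis using wt z by (auto simp: weight4_bounded_def)
  qed
  define k where "k y = inner_field1 (of_real y) (U (of_real y)) (W (of_real y))
      - inner_field1 (of_real y) (W (- of_real y)) (U (- of_real y)) - K y" for y :: real
  have dK: "(K has_vector_derivative K y + k y) (at y)" if y: "r \<le> y" for y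
  proof -
    have "((\<lambda>z. W (- z)) has_field_derivative inner_field2 (- of_real y) (U (- of_real y)) (W (- of_real y)) * (- 1)) (at (of_real y))"
      by (rule DERIV_chain2[where f=W and g=uminus, OF inner_sol_deriv(2)[OF sol up(2)[OF y]]])
        (auto intro!: derivative_eq_intros)
    from has_vector_derivative_real_field[OF DERIV_diff[OF inner_sol_deriv(1)[OF sol up(1)[OF y]] this]]
    show ?thesis by (simp add: K_def[abs_def] k_def inner_field2_uminus)
  qed
  have contU: "continuous_on {r..} (\<lambda>y. U (of_real y))" "continuous_on {r..} (\<lambda>y. U (- of_real y))"
    and contW: "continuous_on {r..} (\<lambda>y. W (of_real y))" "continuous_on {r..} (\<lambda>y. W (- of_real y))"
  proof -
    have "isCont U z" "isCont W z" if "z \<in> upper_domain r" for z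
      using inner_sol_deriv[OF sol that] by (auto intro: DERIV_isCont)
    hence cd: "continuous_on (upper_domain r) U" "continuous_on (upper_domain r) W"
      by (simp_all add: continuous_at_imp_continuous_on)
    have re: "continuous_on {r..} (\<lambda>y. of_real y :: complex)" "continuous_on {r..} (\<lambda>y. - of_real y :: complex)"
      by (intro continuous_intros)+
    have sub: "of_real ` {r..} \<subseteq> upper_domain r" "(\<lambda>y. - of_real y) ` {r..} \<subseteq> upper_domain r"
      using up by auto
    show "continuous_on {r..} (\<lambda>y. U (of_real y))" "continuous_on {r..} (\<lambda>y. U (- of_real y))"
      "continuous_on {r..} (\<lambda>y. W (of_real y))" "continuous_on {r..} (\<lambda>y. W (- of_real y))"
      using continuous_on_compose2[OF cd(1) re(1) sub(1)] continuous_on_compose2[OF cd(1) re(2) sub(2)]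
        continuous_on_compose2[OF cd(2) re(1) sub(1)] continuous_on_compose2[OF cd(2) re(2) sub(2)] .
  qed
  have negligible: "((\<lambda>y. exp y *\<^sub>R K y) \<longlongrightarrow> 0) at_top"
  proof -
    obtain y0 where y0: "\<forall>y\<ge>y0. norm (J y) \<le> (norm (\<i> * \<Theta>) + 1) * exp (- y)"
      using exp_rate_bound[OF lim[folded J_def]] by (rule exE)
    define r2 where "r2 = max (max r y0) (2 * M\<^sup>2)"
    have r2: "r \<le> r2" "y0 \<le> r2" "2 * M\<^sup>2 \<le> r2" "1 \<le> r2" using r by (auto simp: r2_def)
    have JC: "norm (J y) \<le> (norm \<Theta> + 1) * exp (- y)" if "r2 \<le> y" for y
      using y0 that r2(2) by (simp add: norm_mult)
    have kb: "norm (k y) \<le> L / y ^ 4 * (norm (K y) + norm (J y))" if y: "r2 \<le> y" for y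
    proof -
      have ry: "r \<le> y" "1 \<le> y" "2 * M\<^sup>2 \<le> y" using y r2 by auto
      have "2 * M\<^sup>2 \<le> y ^ 4" using ry power_increasing[of 1 4 y] by simp
      moreover have "norm (of_real y ^ 4 * f z) \<le> M" if "weight4_bounded M r f" "z = of_real y \<or> z = - of_real y" for f z
        using that up[OF ry(1)] by (auto simp: weight4_bounded_def)
      ultimately have "norm (k y) \<le> 22 * M ^ 4 / norm (of_real y :: complex) ^ 4 *
          (norm (U (of_real y) - W (- of_real y)) + norm (W (of_real y) - U (- of_real y)))"
        unfolding k_def K_def using ry M wt by (intro inner_field_lipschitz(1)) auto
      thus ?thesis using ry by (simp add: K_def J_def L_def)
    qed
    have KB: "norm (K y) \<le> 2 * M" if "r2 \<le> y" for y
    proof -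
      have "r \<le> y" using that r2 by simp
      thus ?thesis
        using bound[OF up(1)] bound[OF up(2)] norm_triangle_ineq4[of "U (of_real y)" "W (- of_real y)"]
        unfolding K_def by fastforce
    qed
    have nonneg: "0 \<le> norm \<Theta> + 1" "0 \<le> 2 * M" using M by auto
    have dK': "(K has_vector_derivative K y + k y) (at y)" if "r2 \<le> y" for y
      using dK that r2 by simp
    show ?thesis
      by (rule unstable_component_negligible[OF dK' kb JC KB r2(4) L nonneg])
  qed
  have fd: "U field_differentiable at z" "W field_differentiable at z" if "z \<in> upper_domain r" for z
    using inner_sol_deriv[OF sol that] by (auto simp: field_differentiable_def)
  have r0: "0 < r" using r by simp
  have asym: "\<exists>C r'. \<forall>z\<in>upper_domain r'.
       norm (U z - (\<Sum>k<N. inner_coeff k / z ^ (k + 4))) \<le> C / norm z ^ (N + 4) \<and>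
       norm (W z - (\<Sum>k<N. (- 1) ^ k * inner_coeff k / z ^ (k + 4))) \<le> C / norm z ^ (N + 4)" for N
    by (rule inner_sol_asymptotic[OF sol r0 wt, of N]) blast
  define a where "a m = - 2 * of_real pi * \<i> * inner_coeff (m - 3)" for m
  define P where "P m c \<longleftrightarrow> ((\<lambda>R. integral {2 * r..R} (\<lambda>y. of_real (y ^ m) * ((- 1) ^ Suc m * J y + K y))) \<longlongrightarrow> c) at_top
    \<and> norm (c - a m) \<le> 16 * M * r * (2 * r) ^ m" for m c
  \<comment> \<open>\<open>moment_formula\<close> provides a limit for each m separately; the choice
    turns these limits into a sequence.\<close>
  define c where "c m = (SOME c. P m c)" for m
  have ex: "\<exists>c. P m c" if "3 \<le> m" for m
    unfolding P_def J_def K_def a_def by (rule moment_formula[OF r0 fd bound asym that])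
  have "P m (c m)" if "3 \<le> m" for m
    unfolding c_def by (rule someI_ex[OF ex[OF that]])
  hence c: "((\<lambda>R. integral {2 * r..R} (\<lambda>y. of_real (y ^ m) * ((- 1) ^ Suc m * J y + K y))) \<longlongrightarrow> c m) at_top"
    "norm (c m - a m) \<le> 16 * M * r * (2 * r) ^ m" if "3 \<le> m" for m
    using that unfolding P_def by simp_all
  have sub: "{2 * r..} \<subseteq> {r..}" using r0 by auto
  have contJK: "continuous_on {2 * r..} J" "continuous_on {2 * r..} K"
    unfolding J_def K_def
    by (intro continuous_on_diff continuous_on_subset[OF contU(1) sub] continuous_on_subset[OF contU(2) sub]
        continuous_on_subset[OF contW(1) sub] continuous_on_subset[OF contW(2) sub])+
  have "0 < 2 * r" using r0 by simp
  have "(\<lambda>m. (- 1) ^ Suc m * a m / fact m) \<longlonglongrightarrow> \<i> * \<Theta>"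
    by (rule moments_determine_exponential_rate[OF \<open>0 < 2 * r\<close> contJK lim[folded J_def] negligible c])
  hence "(\<lambda>k. (- 1) ^ Suc (k + 3) * a (k + 3) / fact (k + 3)) \<longlonglongrightarrow> \<i> * \<Theta>"
    by (rule LIMSEQ_ignore_initial_segment)
  \<comment> \<open>The alternating sign and the factorial cancel against the normalisation, and 2
    pi divided by its 6 gives pi / 3.\<close>
  moreover have "(- 1) ^ Suc (k + 3) * a (k + 3) / fact (k + 3) = (of_real pi * \<i> / 3) * norm_coeff k" for k
  proof -
    have s: "(- 1 :: complex) ^ Suc (k + 3) = - ((- 1) ^ Suc k)"
      by (simp add: power_add eval_nat_numeral)
    show ?thesis
      unfolding s a_def norm_coeff_def by (simp del: power_Suc fact_Suc)
  qed
  ultimately have "(\<lambda>k. (of_real pi * \<i> / 3) * norm_coeff k) \<longlonglongrightarrow> \<i> * \<Theta>" by (simp only:)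
  from tendsto_mult_left[OF this, of "3 / (of_real pi * \<i>)"] show ?thesis by simp
qed

text \<open>Reality and the bound 0.0088 pass to the limit. The endpoints pi/3 (1 - 0.0088) and pi/3
  (1 + 0.0088) are about 1.03798 and 1.05641.\<close>

lemma limit_norm_coeff_bounds:
  assumes "norm_coeff \<longlonglongrightarrow> 3 * \<Theta> / of_real pi"
  shows "Im \<Theta> = 0" "1.0378681 \<le> Re \<Theta>" "Re \<Theta> \<le> 1.0598665"
proof -
  have "Im (norm_coeff n) = 0" for n using norm_coeff_Reals[of n] by (auto simp: complex_is_Real_iff)
  with tendsto_Im[OF assms] have "Im (3 * \<Theta> / of_real pi) = 0"
    by (simp add: LIMSEQ_const_iff)
  thus "Im \<Theta> = 0" by (simp add: Im_divide_of_real)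
  have "norm (3 * \<Theta> / of_real pi - 1) \<le> 88 / 10000"
    by (rule tendsto_upperbound[OF tendsto_norm[OF tendsto_diff[OF assms tendsto_const]]])
      (intro always_eventually allI norm_coeff_bound, simp)
  hence "\<bar>Re (3 * \<Theta> / of_real pi - 1)\<bar> \<le> 88 / 10000"
    using abs_Re_le_cmod order_trans by blast
  hence "\<bar>3 * Re \<Theta> / pi - 1\<bar> \<le> 88 / 10000" by (simp add: Re_divide_of_real)
  hence "3 * Re \<Theta> / pi \<le> 1 + 88 / 10000" "1 - 88 / 10000 \<le> 3 * Re \<Theta> / pi" by linarith+
  hence "3 * Re \<Theta> \<le> (1 + 88 / 10000) * pi" "(1 - 88 / 10000) * pi \<le> 3 * Re \<Theta>"
    by (simp_all add: pos_divide_le_eq pos_le_divide_eq)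
  thus "1.0378681 \<le> Re \<Theta>" "Re \<Theta> \<le> 1.0598665" using pi_approx by simp_all
qed

section \<open>Reflection and rotation of the inner equation\<close>

definition inner_ode_on :: "complex set \<Rightarrow> (complex \<Rightarrow> complex) \<Rightarrow> (complex \<Rightarrow> complex) \<Rightarrow> bool" where
  "inner_ode_on D \<phi> \<theta> \<longleftrightarrow> (\<forall>s\<in>D. inner_denom s (\<phi> s) (\<theta> s) \<noteq> 0 \<and>
        (\<phi> has_field_derivative inner_rhs1 s (\<phi> s) (\<theta> s)) (at s) \<and>
        (\<theta> has_field_derivative inner_rhs2 s (\<phi> s) (\<theta> s)) (at s))"

text \<open>Replacing s by -s reverses the derivative and the forcing \<open>1 / s ^ 3\<close>,
  while the denominator is even and symmetric in the unknowns. The linear coefficients of the two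
  equations trade places, so the unknowns must be swapped as well.\<close>

lemma inner_ode_on_reflect:
  assumes "inner_ode_on D \<phi> \<theta>"
  shows "inner_ode_on (uminus ` D) (\<lambda>s. \<theta> (- s)) (\<lambda>s. \<phi> (- s))"
  unfolding inner_ode_on_def
proof (intro ballI conjI)
  fix s assume "s \<in> uminus ` D"
  hence s: "- s \<in> D" by auto
  have h: "inner_denom (- s) (\<phi> (- s)) (\<theta> (- s)) \<noteq> 0"
    "(\<phi> has_field_derivative inner_rhs1 (- s) (\<phi> (- s)) (\<theta> (- s))) (at (- s))"
    "(\<theta> has_field_derivative inner_rhs2 (- s) (\<phi> (- s)) (\<theta> (- s))) (at (- s))"
    using assms s by (auto simp: inner_ode_on_def)
  have den: "inner_denom s (\<theta> (- s)) (\<phi> (- s)) = inner_denom (- s) (\<phi> (- s)) (\<theta> (- s))"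
    by (simp add: inner_denom_def mult_ac)
  show "inner_denom s (\<theta> (- s)) (\<phi> (- s)) \<noteq> 0" using h(1) den by simp
  have n1: "((\<i> + 1 / - s) * t - 1 / (- s) ^ 3) * (- 1) = - (\<i> - 1 / s) * t - 1 / s ^ 3"
    and n2: "(- (\<i> - 1 / - s) * t - 1 / (- s) ^ 3) * (- 1) = (\<i> + 1 / s) * t - 1 / s ^ 3" for t
    by (simp_all add: power3_eq_cube algebra_simps)
  have r1: "inner_rhs2 (- s) (\<phi> (- s)) (\<theta> (- s)) * (- 1) = inner_rhs1 s (\<theta> (- s)) (\<phi> (- s))"
    unfolding inner_rhs1_def inner_rhs2_def den times_divide_eq_left n1 ..
  have r2: "inner_rhs1 (- s) (\<phi> (- s)) (\<theta> (- s)) * (- 1) = inner_rhs2 s (\<theta> (- s)) (\<phi> (- s))"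
    unfolding inner_rhs1_def inner_rhs2_def den times_divide_eq_left n2 ..
  have dm: "(uminus has_field_derivative - 1) (at s)" by (auto intro!: derivative_eq_intros)
  show "((\<lambda>s. \<theta> (- s)) has_field_derivative inner_rhs1 s (\<theta> (- s)) (\<phi> (- s))) (at s)"
    using DERIV_chain2[where f=\<theta> and g=uminus, OF h(3) dm] unfolding r1 .
  show "((\<lambda>s. \<phi> (- s)) has_field_derivative inner_rhs2 s (\<theta> (- s)) (\<phi> (- s))) (at s)"
    using DERIV_chain2[where f=\<phi> and g=uminus, OF h(2) dm] unfolding r2 .
qed

text \<open>The terms - u / z and - w / z come from the quotient rule and cancel the 1/s part of the
  linear coefficients, leaving exactly u and -w. The sign in \<theta> = - z w turns the denominator
  into 1 + z^4 u w.\<close>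

lemma inner_rhs_eq_field:
  assumes z: "z \<noteq> 0" and D: "inner_denom (\<i> * z) (z * u) (- z * w) \<noteq> 0"
  shows "\<i> * inner_rhs1 (\<i> * z) (z * u) (- z * w) / z - u / z = inner_field1 z u w"
    and "- \<i> * inner_rhs2 (\<i> * z) (z * u) (- z * w) / z - w / z = inner_field2 z u w"
proof -
  define E where "E = 1 + z ^ 4 * u * w"
  have dE: "inner_denom (\<i> * z) (z * u) (- z * w) = E"
    by (simp add: inner_denom_def E_def power_mult_distrib eval_nat_numeral mult_ac)
  have E: "E \<noteq> 0" using D dE by simp
  have i3: "(\<i> * z) ^ 3 = - \<i> * z ^ 3" 
  proof -
    have "\<i> ^ 3 = - \<i>" by (simp add: power3_eq_cube)
    thus ?thesis by (simp only: power_mult_distrib)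
  qed
  have z8: "z ^ 8 = z ^ 4 * z ^ 4" by (simp only: power_add[symmetric]) simp
  have can: "(z ^ 4 * p) * (z ^ 4 * q) * c / E / z ^ 8 = p * q * c / E" for p q c
    by (simp only: divide_divide_eq_left z8) (use z E in \<open>simp add: field_simps\<close>)
  have nl1: "inner_nonlin (1 / z) (z ^ 4 * u) (z ^ 4 * w) / z ^ 8 = u * w * (z ^ 4 * u * (1 + 1 / z) + 1) / E"
  proof -
    have "1 + (1 / z) ^ 4 * (z ^ 4 * u) * (z ^ 4 * w) = E" using z by (simp add: E_def power_divide)
    thus ?thesis unfolding inner_nonlin_def by (simp only: can)
  qed
  have nl2: "inner_nonlin (- 1 / z) (z ^ 4 * w) (z ^ 4 * u) / z ^ 8 = w * u * (z ^ 4 * w * (1 + - 1 / z) + 1) / E"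
  proof -
    have "1 + (- 1 / z) ^ 4 * (z ^ 4 * w) * (z ^ 4 * u) = E" using z by (simp add: E_def power_divide)
    thus ?thesis unfolding inner_nonlin_def by (simp only: can)
  qed
  have quot: "P / E - v = a - Q / E" if "P + Q = (a + v) * E" for P Q a v
  proof -
    have "(P + Q) / E = a + v" using that E by simp
    thus ?thesis by (simp add: add_divide_distrib algebra_simps)
  qed
  have "\<i> * (- (\<i> - 1 / (\<i> * z)) * (z * u) - 1 / (- \<i> * z ^ 3)) / z = (1 + 1 / z) * u + 1 / z ^ 4"
    using z by (simp add: field_simps eval_nat_numeral)
  hence "\<i> * inner_rhs1 (\<i> * z) (z * u) (- z * w) / z = ((1 + 1 / z) * u + 1 / z ^ 4) / E"
    unfolding inner_rhs1_def dE i3 by (simp only: times_divide_eq_right divide_divide_eq_left mult.commute[of E]) (simp only: divide_divide_eq_left[symmetric])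
  moreover have "((1 + 1 / z) * u + 1 / z ^ 4) / E - u / z = u + 1 / z ^ 4 - u * w * (z ^ 4 * u * (1 + 1 / z) + 1) / E"
  proof (rule quot)
    show "(1 + 1 / z) * u + 1 / z ^ 4 + u * w * (z ^ 4 * u * (1 + 1 / z) + 1) = (u + 1 / z ^ 4 + u / z) * E"
      using z by (simp add: E_def algebra_simps)
  qed
  ultimately show "\<i> * inner_rhs1 (\<i> * z) (z * u) (- z * w) / z - u / z = inner_field1 z u w"
    unfolding inner_field1_def nl1 by (simp only:)
  have "- \<i> * ((\<i> + 1 / (\<i> * z)) * (- z * w) - 1 / (- \<i> * z ^ 3)) / z = - ((1 + - 1 / z) * w) - 1 / z ^ 4"
    using z by (simp add: field_simps eval_nat_numeral)
  hence "- \<i> * inner_rhs2 (\<i> * z) (z * u) (- z * w) / z = (- ((1 + - 1 / z) * w) - 1 / z ^ 4) / E"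
    unfolding inner_rhs2_def dE i3 by (simp only: times_divide_eq_right divide_divide_eq_left mult.commute[of E]) (simp only: divide_divide_eq_left[symmetric])
  moreover have "(- ((1 + - 1 / z) * w) - 1 / z ^ 4) / E - w / z = - w - 1 / z ^ 4 - (- (w * u * (z ^ 4 * w * (1 + - 1 / z) + 1))) / E"
  proof (rule quot)
    show "- ((1 + - 1 / z) * w) - 1 / z ^ 4 + - (w * u * (z ^ 4 * w * (1 + - 1 / z) + 1)) = (- w - 1 / z ^ 4 + w / z) * E"
      using z by (simp add: E_def algebra_simps)
  qed
  ultimately show "- \<i> * inner_rhs2 (\<i> * z) (z * u) (- z * w) / z - w / z = inner_field2 z u w"
    unfolding inner_field2_def nl2 by simp
qed

text \<open>A point of the upper half plane whose rotation misses the domain satisfies |Re z| <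
  \<rho> and Im z < \<rho> / tan \<beta>, so its norm is below \<rho> + \<rho> / tan
  \<beta>.\<close>

lemma upper_domain_D_minus:
  assumes "0 < tan \<beta>" "0 < \<rho>" "\<rho> + \<rho> / tan \<beta> \<le> r" "z \<in> upper_domain r"
  shows "\<i> * z \<in> D_minus \<beta> \<rho>"
proof -
  have "\<rho> \<le> \<bar>Re z\<bar> + tan \<beta> * Im z"
  proof (rule ccontr)
    assume *: "\<not> ?thesis"
    have im: "0 \<le> Im z" using assms(4) by (simp add: upper_domain_def)
    hence "0 \<le> tan \<beta> * Im z" using assms(1) by simp
    hence "\<bar>Re z\<bar> < \<rho>" "tan \<beta> * Im z < \<rho>" using * by linarith+
    hence "\<bar>Re z\<bar> < \<rho>" "Im z < \<rho> / tan \<beta>" using assms(1) by (simp_all add: pos_less_divide_eq mult.commute)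
    moreover have "r \<le> \<bar>Re z\<bar> + \<bar>Im z\<bar>" using assms(4) cmod_le[of z] by (simp add: upper_domain_def)
    ultimately show False using assms(3) im by simp
  qed
  thus ?thesis using assms(4) by (simp add: D_minus_def upper_domain_def)
qed

lemma inner_ode_rotate:
  assumes ode: "inner_ode_on (D_minus \<beta> \<rho>) \<phi> \<theta>"
    and wt: "weight3_bounded (D_minus \<beta> \<rho>) \<phi>" "weight3_bounded (D_minus \<beta> \<rho>) \<theta>"
    and r: "0 < tan \<beta>" "0 < \<rho>" "\<rho> + \<rho> / tan \<beta> \<le> r"
  shows "inner_approx_sol n 0 r (\<lambda>z. \<phi> (\<i> * z) / z) (\<lambda>z. - \<theta> (\<i> * z) / z)"
    and "\<exists>M. weight4_bounded M r (\<lambda>z. \<phi> (\<i> * z) / z) \<and> weight4_bounded M r (\<lambda>z. - \<theta> (\<i> * z) / z)"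
proof -
  have "0 < \<rho> / tan \<beta>" using r by simp
  hence r0: "0 < r" using r by linarith
  note dom = upper_domain_D_minus[OF r]
  have nz: "z \<noteq> 0" if "z \<in> upper_domain r" for z
    using that r0 by (auto simp: upper_domain_def)
  have main: "((\<lambda>z. \<phi> (\<i> * z) / z) has_field_derivative inner_field1 z (\<phi> (\<i> * z) / z) (- \<theta> (\<i> * z) / z)) (at z) \<and>
    ((\<lambda>z. - \<theta> (\<i> * z) / z) has_field_derivative inner_field2 z (\<phi> (\<i> * z) / z) (- \<theta> (\<i> * z) / z)) (at z)"
    if z: "z \<in> upper_domain r" for z
  proof -
    define u w where "u = \<phi> (\<i> * z) / z" "w = - \<theta> (\<i> * z) / z"
    have z0: "z \<noteq> 0" by (rule nz[OF z])
    have uw: "\<phi> (\<i> * z) = z * u" "\<theta> (\<i> * z) = - z * w" using z0 by (simp_all add: u_w_def)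
    have h: "inner_denom (\<i> * z) (z * u) (- z * w) \<noteq> 0"
      "(\<phi> has_field_derivative inner_rhs1 (\<i> * z) (z * u) (- z * w)) (at (\<i> * z))"
      "(\<theta> has_field_derivative inner_rhs2 (\<i> * z) (z * u) (- z * w)) (at (\<i> * z))"
      using ode dom[OF z] unfolding inner_ode_on_def uw[symmetric] by auto
    have dm: "((*) \<i> has_field_derivative \<i>) (at z)" by (auto intro!: derivative_eq_intros)
    have d1: "((\<lambda>z. \<phi> (\<i> * z) / z) has_field_derivative
        (inner_rhs1 (\<i> * z) (z * u) (- z * w) * \<i> * z - \<phi> (\<i> * z) * 1) / (z * z)) (at z)"
      by (rule DERIV_divide[OF DERIV_chain2[where f=\<phi> and g="(*) \<i>", OF h(2) dm] DERIV_ident z0])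
    have e1: "(A * \<i> * z - z * u * 1) / (z * z) = \<i> * A / z - u / z" for A
      using z0 by (simp add: field_simps)
    have d2: "((\<lambda>z. - \<theta> (\<i> * z) / z) has_field_derivative
        (- (inner_rhs2 (\<i> * z) (z * u) (- z * w) * \<i>) * z - (- \<theta> (\<i> * z)) * 1) / (z * z)) (at z)"
      by (rule DERIV_divide[OF DERIV_minus[OF DERIV_chain2[where f=\<theta> and g="(*) \<i>", OF h(3) dm]] DERIV_ident z0])
    have e2: "(- (A * \<i>) * z - (- (- z * w)) * 1) / (z * z) = - \<i> * A / z - w / z" for A
      using z0 by (simp add: field_simps)
    have f1: "((\<lambda>z. \<phi> (\<i> * z) / z) has_field_derivative inner_field1 z u w) (at z)"
      using d1 unfolding uw e1 inner_rhs_eq_field(1)[OF z0 h(1)] .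
    have f2: "((\<lambda>z. - \<theta> (\<i> * z) / z) has_field_derivative inner_field2 z u w) (at z)"
      using d2 unfolding uw e2 inner_rhs_eq_field(2)[OF z0 h(1)] .
    show ?thesis using conjI[OF f1 f2] unfolding u_w_def .
  qed
  show "inner_approx_sol n 0 r (\<lambda>z. \<phi> (\<i> * z) / z) (\<lambda>z. - \<theta> (\<i> * z) / z)"
    unfolding inner_approx_sol_def
    by (rule exI[of _ "\<lambda>_. 0"], rule exI[of _ "\<lambda>_. 0"]) (use main in simp)
  obtain M1 where M1: "\<And>s. s \<in> D_minus \<beta> \<rho> \<Longrightarrow> cmod (s ^ 3 * \<phi> s) \<le> M1"
    using wt(1) unfolding weight3_bounded_def bdd_above_def by auto
  obtain M2 where M2: "\<And>s. s \<in> D_minus \<beta> \<rho> \<Longrightarrow> cmod (s ^ 3 * \<theta> s) \<le> M2"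
    using wt(2) unfolding weight3_bounded_def bdd_above_def by auto
  \<comment> \<open>Division by z turns the weight 3 of the given solutions into weight 4.\<close>
  have e: "norm (z ^ 4 * (f / z)) = norm ((\<i> * z) ^ 3 * f)" if "z \<noteq> 0" for z f :: complex
    using that by (simp add: norm_mult norm_divide norm_power eval_nat_numeral)
  show "\<exists>M. weight4_bounded M r (\<lambda>z. \<phi> (\<i> * z) / z) \<and> weight4_bounded M r (\<lambda>z. - \<theta> (\<i> * z) / z)"
  proof (intro exI conjI)
    show "weight4_bounded (max M1 M2) r (\<lambda>z. \<phi> (\<i> * z) / z)"
      unfolding weight4_bounded_def
    proof
      fix z assume z: "z \<in> upper_domain r"
      show "norm (z ^ 4 * (\<phi> (\<i> * z) / z)) \<le> max M1 M2"
        unfolding e[OF nz[OF z]] using M1[OF dom[OF z]] by simp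
    qed
    show "weight4_bounded (max M1 M2) r (\<lambda>z. - \<theta> (\<i> * z) / z)"
      unfolding weight4_bounded_def
    proof
      fix z assume z: "z \<in> upper_domain r"
      show "norm (z ^ 4 * (- \<theta> (\<i> * z) / z)) \<le> max M1 M2"
        unfolding e[OF nz[OF z]] using M2[OF dom[OF z]] by simp
    qed
  qed
qed

theorem mainTheorem1:
  fixes \<beta> \<rho> :: real
    and \<phi>p \<theta>p \<phi>m \<theta>m :: "complex \<Rightarrow> complex"
    and \<Theta> :: complex
  assumes "0 < \<beta>" "\<beta> < pi / 2" "6 * (sin \<beta>)^2 = 1"
    and "\<rho> > 0"
    and "distinguished_plus \<beta> \<rho> \<phi>p \<theta>p"
    and "distinguished_minus \<beta> \<rho> \<phi>m \<theta>m"
    and "is_stokes_constant \<phi>p \<phi>m \<Theta>"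
  shows "\<Theta> \<noteq> 0 \<and>
         Re \<Theta> \<in> {1.0378681 .. 1.0598665} \<and>
         Im \<Theta> \<in> {- 0.000253 .. 0.000253}"
proof -
  have tan: "0 < tan \<beta>" using assms(1,2) by (intro tan_gt_zero)
  have D_eq: "D_minus \<beta> \<rho> = uminus ` D_plus \<beta> \<rho>"
    by (force simp: D_plus_def image_iff intro: exI[of _ "- _"])
  define r0 where "r0 = \<rho> + \<rho> / tan \<beta>"
  have odem: "inner_ode_on (D_minus \<beta> \<rho>) \<phi>m \<theta>m"
    and wtm: "weight3_bounded (D_minus \<beta> \<rho>) \<phi>m" "weight3_bounded (D_minus \<beta> \<rho>) \<theta>m"
    using assms(6) by (auto simp: distinguished_minus_def inner_solution_on_def inner_ode_on_def)
  have odep: "inner_ode_on (D_minus \<beta> \<rho>) (\<lambda>s. \<theta>p (- s)) (\<lambda>s. \<phi>p (- s))"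
    unfolding D_eq using assms(5)
    by (intro inner_ode_on_reflect) (auto simp: distinguished_plus_def inner_solution_on_def inner_ode_on_def)
  have refl: "weight3_bounded (D_minus \<beta> \<rho>) (\<lambda>s. f (- s))" if "weight3_bounded (D_plus \<beta> \<rho>) f" for f
    using that unfolding weight3_bounded_def D_eq by (simp add: image_image norm_mult norm_power)
  have wtp: "weight3_bounded (D_minus \<beta> \<rho>) (\<lambda>s. \<theta>p (- s))" "weight3_bounded (D_minus \<beta> \<rho>) (\<lambda>s. \<phi>p (- s))"
    using assms(5) by (auto simp: distinguished_plus_def intro: refl)
  define U W where "U = (\<lambda>z. \<phi>m (\<i> * z) / z)" "W = (\<lambda>z. - \<theta>m (\<i> * z) / z)"
  define U' W' where "U' = (\<lambda>z. \<theta>p (- (\<i> * z)) / z)" "W' = (\<lambda>z. - \<phi>p (- (\<i> * z)) / z)"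
  obtain M1 where M1: "weight4_bounded M1 r0 U" "weight4_bounded M1 r0 W"
    using inner_ode_rotate(2)[OF odem wtm tan assms(4), of r0] by (auto simp: r0_def U_W_def)
  obtain M2 where M2: "weight4_bounded M2 r0 U'" "weight4_bounded M2 r0 W'"
    using inner_ode_rotate(2)[OF odep wtp tan assms(4), of r0] by (auto simp: r0_def U'_W'_def)
  define M where "M = max 1 (max M1 M2)"
  have M: "1 \<le> M" "M1 \<le> M" "M2 \<le> M" by (auto simp: M_def)
  \<comment> \<open>Since r \<ge> 1, these bounds on r itself imply those on \<open>r ^ 4\<close>
    and \<open>r ^ 3\<close> that uniqueness asks for.\<close>
  define r where "r = max (max 1 r0) (max (2 * M\<^sup>2) (64 * 2 * (22 * M ^ 4)))"
  have r: "1 \<le> r" "r0 \<le> r" "2 * M\<^sup>2 \<le> r" "64 * 2 * (22 * M ^ 4) \<le> r" by (auto simp: r_def)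
  have r4: "2 * M\<^sup>2 \<le> r ^ 4" "64 * 2 * (22 * M ^ 4) \<le> r ^ 3"
    using r(3) power_increasing[of 1 4 r] power_increasing[of 1 3 r] r(1) order_trans[OF r(4)] by simp_all
  have sol: "inner_approx_sol n 0 r U W" "inner_approx_sol n 0 r U' W'" for n
    using inner_ode_rotate(1)[OF odem wtm tan assms(4), of r n] inner_ode_rotate(1)[OF odep wtp tan assms(4), of r n] r(2)
    by (simp_all add: r0_def U_W_def U'_W'_def)
  have wt: "weight4_bounded M r U" "weight4_bounded M r W" "weight4_bounded M r U'" "weight4_bounded M r W'"
    using weight4_bounded_mono M1 M2 r(2) M by blast+
  \<comment> \<open>By uniqueness the reflected plus solution is the minus solution. So W(y) equals
    - \<phi>p(-i y) / y, while U(-y) equals - \<phi>m(-i y) / y: both sides of the Stokes limit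
    belong to one pair.\<close>
  have eq: "W z = W' z" if "z \<in> upper_domain r" for z
    by (rule inner_sol_unique(2)[OF sol wt M(1) r(1) r4 that])
  have "((\<lambda>y. exp y *\<^sub>R (W (of_real y) - U (- of_real y))) \<longlongrightarrow> \<i> * \<Theta>) at_top"
  proof (rule Lim_transform_eventually)
    \<comment> \<open>On the negative imaginary axis s = -i y the factor exp (i s) becomes exp y,
      and 1/s combines with the division by y; multiplication by i then gives the scaled jump of (U,
      W).\<close>
    have "filterlim (\<lambda>y. - \<i> * of_real y) (inf (filtercomap Im at_bot) (principal {s. Re s = 0})) at_top"
      by (auto simp: filterlim_inf filterlim_principal filterlim_filtercomap_iff o_def filterlim_uminus_at_bot_at_top)
    from filterlim_compose[OF assms(7)[unfolded is_stokes_constant_def] this]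
    have "((\<lambda>y. inverse (- \<i> * of_real y) * exp (\<i> * (- \<i> * of_real y)) *
        (\<phi>p (- \<i> * of_real y) - \<phi>m (- \<i> * of_real y))) \<longlongrightarrow> \<Theta>) at_top" .
    from tendsto_mult_left[OF this, of \<i>]
    show "((\<lambda>y. \<i> * (inverse (- \<i> * of_real y) * exp (\<i> * (- \<i> * of_real y)) *
        (\<phi>p (- \<i> * of_real y) - \<phi>m (- \<i> * of_real y)))) \<longlongrightarrow> \<i> * \<Theta>) at_top" .
    show "eventually (\<lambda>y. \<i> * (inverse (- \<i> * of_real y) * exp (\<i> * (- \<i> * of_real y)) *
        (\<phi>p (- \<i> * of_real y) - \<phi>m (- \<i> * of_real y))) = exp y *\<^sub>R (W (of_real y) - U (- of_real y))) at_top"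
      using eventually_ge_at_top[of r]
    proof eventually_elim
      case (elim y)
      have y: "of_real y \<in> upper_domain r" "y \<noteq> 0" using elim r(1) by (auto simp: upper_domain_def)
      have "exp (\<i> * (- \<i> * of_real y)) = complex_of_real (exp y)" by (simp flip: exp_of_real)
      thus ?case unfolding eq[OF y(1)] using y(2)
        by (simp add: U_W_def U'_W'_def scaleR_conv_of_real divide_simps) (simp add: algebra_simps)
    qed
  qed
  from limit_norm_coeff_bounds[OF stokes_jump_coeff_limit[OF sol(1) r(1) M(1) wt(1,2) this]]
  show ?thesis by auto
qed

end
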